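(* Let $\mathbb{K}$ be a field with $\operatorname{char}\mathbb{K}\neq2$, let $V$ be a $\mathbb{K}$-vector space with basis $v_1,\dots,v_n$, let $G\subset GL(V)$ be a finite group with $\operatorname{char}\mathbb{K}\nmid|G|$, and let $\mathbf{q}=\{q_{ij}\}_{1\le i,j\le n}$ be nonzero elements of $\mathbb{K}$ with $q_{ij}=q_{ji}^{-1}$ for $i\neq j$. If the action of $G$ on $V$ extends to an action on $\Lambda_{\mathbf{q}}(V)$ by algebra automorphisms, then each constant Hochschild 2-cocycle $\eta$ of $\Lambda_{\mathbf{q}}(V)\rtimes G$ that sends $\epsilon_{2[i]}\mapsto 0$ for all $i\in\{1,\dots,n\}$ produces a truncated quantum Drinfeld Hecke algebra. That is, if $\kappa:V\times V\to\mathbb{K}G$ is the bilinear function determined by $\kappa(v_i,v_i)=0$ for all $i$, and, for $i<j$, $\kappa(v_j,v_i)=\eta(\epsilon_{[i]+[j]})$ and $\kappa(v_i,v_j)=-q_{ij}\,\eta(\epsilon_{[i]+[j]})$, then $\hat{\mathscr{H}}_{\mathbf{q},\kappa,1}$ is a truncated quantum Drinfeld Hecke algebra over $\mathbb{K}$.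
   Context: Write $\Lambda=\Lambda_{\mathbf{q}}(V)=\mathbb{K}\langle v_1,\dots,v_n\mid v_jv_i=q_{ij}v_iv_j\text{ for }i\neq j,\ v_i^2=0\text{ for all }i\rangle$ (quantum exterior algebra). The skew group algebra $A\rtimes G$ is $A\otimes\mathbb{K}G$ as a vector space with multiplication $(ag)(bh)=a({}^gb)gh$. The algebra $\hat{\mathscr{H}}_{\mathbf{q},\kappa,1}$ is the quotient of $T(V)\rtimes G$ ($T(V)$ the tensor algebra) by the two-sided ideal generated by $v_jv_i-q_{ij}v_iv_j-\kappa(v_i,v_j)$ and $v_i^2$ for all $i,j$. It is a truncated quantum Drinfeld Hecke algebra over $\mathbb{K}$ if it has a PBW basis, i.e. if the images of $v_1^{\alpha_1}\cdots v_n^{\alpha_n}g$ ($\alpha_i\in\{0,1\}$, $g\in G$) form a $\mathbb{K}$-basis. Resolution. For $\beta\in\mathbb{N}^n$ put $|\beta|=\sum\beta_i$, and let $[j]$ be the $j$-th standard basis $n$-tuple. Define $f_\beta\in V^{\otimes|\beta|}$ by $f_0=1$, $f_{[j]}=v_j$, $f_\beta=0$ if some $\beta_j<0$, and $f_\beta=\sum_{j=1}^n\prod_{k>j}(-q_{kj})^{\beta_k}f_{\beta-[j]}\otimes v_j$. Set $\epsilon_\beta=1\otimes f_\beta\otimes1\in\Lambda^{\otimes(|\beta|+2)}$. For example $\epsilon_{2[i]}=1\otimes v_i\otimes v_i\otimes1$ and, for $i<j$, $\epsilon_{[i]+[j]}=1\otimes v_i\otimes v_j\otimes1-q_{ji}\otimes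 v_j\otimes v_i\otimes1$. The complex $\mathbf{C}$ has $\mathbf{C}_m=\bigoplus_{|\beta|=m}\Lambda\,\epsilon_\beta\,\Lambda$ (a free $\Lambda$-bimodule on the $\epsilon_\beta$) with differential $$d_m(\epsilon_\beta)=\sum_{j=1}^n(-1)^{\sum_{l<j}\beta_l}\Big(\prod_{l<j}q_{jl}^{\beta_l}\,v_j\epsilon_{\beta-[j]}+(-1)^{\beta_j}\prod_{l>j}q_{lj}^{\beta_l}\,\epsilon_{\beta-[j]}v_j\Big),$$ where terms with $\beta_j=0$ are omitted. It is a subcomplex of the bar resolution of $\Lambda$ and a projective resolution of $\Lambda$ as a $\Lambda$-bimodule. When $G$ acts on $\Lambda$ by automorphisms, $G$ acts on $\mathbf{C}$ by restricting the factorwise action on the bar resolution (the tensor powers of $\Lambda$). Since $\operatorname{char}\mathbb{K}\nmid|G|$, $\mathrm{HH}^*(\Lambda\rtimes G)\cong\mathrm{HH}^*(\Lambda,\Lambda\rtimes G)^G$. A constant Hochschild 2-cocycle of $\Lambda\rtimes G$ means a $\Lambda$-bimodule homomorphism $\eta:\mathbf{C}_2\to\Lambda\rtimes G$ such that $\eta\circ d_3=0$ (cocycle), $\eta(\epsilon_\beta)\in\mathbb{K}G$ for all $|\beta|=2$ (constant), and $\eta$ is $G$-invariant, i.e. $\eta(x)=h\,\eta({}^{h^{-1}}x)\,h^{-1}$ for all $h\in G$, $x\in\mathbf{C}_2$. *)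

theory Defs
  imports
    Complex_Main
    "HOL-Algebra.QuotRing"
    "HOL-Algebra.Module"
    "HOL-Algebra.Group_Action"
    "HOL-Algebra.Generated_Groups"
    "HOL-Library.Poly_Mapping"
begin

text \<open>
  A vector space or an algebra over a field \<open>'k\<close> whose carrier is not a whole type is a record of
  type \<open>('k, 'a) module\<close>, i.e. a ring record together with a scalar multiplication. As in
  \<open>HOL-Algebra.Module\<close>, the multiplicative slots carry no meaning for structures that are only
  vector spaces. The index set \<open>{1, ..., n}\<close> is an arbitrary finite linearly ordered type \<open>'i\<close>.
\<close>

section \<open>Vector spaces, bases and quotients\<close>

definition basis_family ::
  "('k::field \<Rightarrow> 'v::ab_group_add \<Rightarrow> 'v) \<Rightarrow> ('i \<Rightarrow> 'v) \<Rightarrow> bool" where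
  "basis_family s v \<longleftrightarrow>
     inj v \<and> \<not> module.dependent s (range v) \<and> module.span s (range v) = UNIV"

definition coord ::
  "('k::field \<Rightarrow> 'v::ab_group_add \<Rightarrow> 'v) \<Rightarrow> ('i \<Rightarrow> 'v) \<Rightarrow> 'v \<Rightarrow> 'i \<Rightarrow> 'k" where
  "coord s v x i = module.representation s (range v) x (v i)"

definition finite_family_basis :: "('k::field, 'a) module \<Rightarrow> 'b set \<Rightarrow> ('b \<Rightarrow> 'a) \<Rightarrow> bool" where
  "finite_family_basis M B b \<longleftrightarrow>
     finite B \<and> b \<in> B \<rightarrow> carrier M \<and>
     (\<forall>x\<in>carrier M. \<exists>!c. c \<in> B \<rightarrow>\<^sub>E UNIV \<and> x = (\<Oplus>\<^bsub>M\<^esub>i\<in>B. c i \<odot>\<^bsub>M\<^esub> b i))"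

text \<open>The library quotient ring, with the scalar multiplication induced on cosets.\<close>

definition quot :: "('k, 'a) module \<Rightarrow> 'a set \<Rightarrow> ('k, 'a set) module" where
  "quot A I = ring.extend (A Quot I)
     (module.fields (\<lambda>c X. \<Union>x\<in>X. I +>\<^bsub>A\<^esub> (c \<odot>\<^bsub>A\<^esub> x)))"

section \<open>The general linear group and skew group algebras\<close>

definition GL :: "('k::field \<Rightarrow> 'v::ab_group_add \<Rightarrow> 'v) \<Rightarrow> ('v \<Rightarrow> 'v) monoid" where
  "GL s = \<lparr>carrier = {f. Vector_Spaces.linear s s f \<and> bij f}, mult = (\<circ>), one = id\<rparr>"

definition linear_group ::
  "('k::field \<Rightarrow> 'v::ab_group_add \<Rightarrow> 'v) \<Rightarrow> ('v \<Rightarrow> 'v) set \<Rightarrow> ('v \<Rightarrow> 'v) monoid" where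
  "linear_group s G = (GL s)\<lparr>carrier := G\<rparr>"

text \<open>
  For a finite group the vector space \<open>A \<otimes> KG\<close> is the space of functions from the group to \<open>A\<close>,
  where \<open>x\<close> stands for the sum of the elements \<open>x(g) g\<close>. In the product, the coefficient of \<open>g\<close>
  collects the terms \<open>(x(h) h) (y(l) l)\<close> with \<open>h l = g\<close>.
\<close>

definition skew :: "('k, 'a) module \<Rightarrow> 'g monoid \<Rightarrow> ('g \<Rightarrow> 'a \<Rightarrow> 'a) \<Rightarrow> ('k, 'g \<Rightarrow> 'a) module" where
  "skew A G act =
     \<lparr>carrier = carrier G \<rightarrow>\<^sub>E carrier A,
      mult = (\<lambda>x y. \<lambda>g\<in>carrier G.
        \<Oplus>\<^bsub>A\<^esub>h\<in>carrier G. x h \<otimes>\<^bsub>A\<^esub> act h (y (inv\<^bsub>G\<^esub> h \<otimes>\<^bsub>G\<^esub> g))),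
      one = (\<lambda>g\<in>carrier G. if g = \<one>\<^bsub>G\<^esub> then \<one>\<^bsub>A\<^esub> else \<zero>\<^bsub>A\<^esub>),
      zero = (\<lambda>g\<in>carrier G. \<zero>\<^bsub>A\<^esub>),
      add = (\<lambda>x y. \<lambda>g\<in>carrier G. x g \<oplus>\<^bsub>A\<^esub> y g),
      smult = (\<lambda>c x. \<lambda>g\<in>carrier G. c \<odot>\<^bsub>A\<^esub> x g)\<rparr>"

text \<open>The element \<open>a g\<close>, and the image of an element \<open>c\<close> of the group algebra \<open>KG\<close>.\<close>

definition skew_elt :: "('k, 'a) module \<Rightarrow> 'g monoid \<Rightarrow> 'a \<Rightarrow> 'g \<Rightarrow> ('g \<Rightarrow> 'a)" where
  "skew_elt A G a g = (\<lambda>h\<in>carrier G. if h = g then a else \<zero>\<^bsub>A\<^esub>)"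

definition group_alg_elt :: "('k, 'a) module \<Rightarrow> 'g monoid \<Rightarrow> ('g \<Rightarrow> 'k) \<Rightarrow> ('g \<Rightarrow> 'a)" where
  "group_alg_elt A G c = (\<lambda>g\<in>carrier G. c g \<odot>\<^bsub>A\<^esub> \<one>\<^bsub>A\<^esub>)"

section \<open>Tensor algebra and quantum exterior algebra\<close>

definition pm_scale :: "'k::field \<Rightarrow> ('a \<Rightarrow>\<^sub>0 'k) \<Rightarrow> ('a \<Rightarrow>\<^sub>0 'k)" where
  "pm_scale c p = Poly_Mapping.map ((*) c) p"

text \<open>
  The tensor algebra of \<open>V\<close>, written in the basis \<open>v\<close>: the word \<open>[i\<^sub>1, ..., i\<^sub>m]\<close> stands for the
  tensor product of the corresponding basis vectors.
\<close>

definition tensor_alg :: "('k::field, 'i list \<Rightarrow>\<^sub>0 'k) module" where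
  "tensor_alg =
     \<lparr>carrier = UNIV,
      mult = (\<lambda>p r. \<Sum>u\<in>Poly_Mapping.keys p. \<Sum>w\<in>Poly_Mapping.keys r.
        Poly_Mapping.single (u @ w) (Poly_Mapping.lookup p u * Poly_Mapping.lookup r w)),
      one = Poly_Mapping.single [] 1,
      zero = 0,
      add = (+),
      smult = pm_scale\<rparr>"

definition word :: "'i list \<Rightarrow> ('i list \<Rightarrow>\<^sub>0 'k::field)" where
  "word w = Poly_Mapping.single w 1"

definition vec_in_tensor_alg ::
  "('k::field \<Rightarrow> 'v::ab_group_add \<Rightarrow> 'v) \<Rightarrow> ('i::finite \<Rightarrow> 'v) \<Rightarrow> 'v \<Rightarrow> ('i list \<Rightarrow>\<^sub>0 'k)" where
  "vec_in_tensor_alg s v x = (\<Sum>i\<in>UNIV. pm_scale (coord s v x i) (word [i]))"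

definition tensor_alg_act ::
  "('k::field \<Rightarrow> 'v::ab_group_add \<Rightarrow> 'v) \<Rightarrow> ('i::finite \<Rightarrow> 'v) \<Rightarrow> ('v \<Rightarrow> 'v) \<Rightarrow>
   ('i list \<Rightarrow>\<^sub>0 'k) \<Rightarrow> ('i list \<Rightarrow>\<^sub>0 'k)" where
  "tensor_alg_act s v g p = (\<Sum>w\<in>Poly_Mapping.keys p. pm_scale (Poly_Mapping.lookup p w)
     (foldr (\<lambda>i r. vec_in_tensor_alg s v (g (v i)) \<otimes>\<^bsub>tensor_alg\<^esub> r) w \<one>\<^bsub>tensor_alg\<^esub>))"

definition qext_ideal :: "('i \<Rightarrow> 'i \<Rightarrow> 'k::field) \<Rightarrow> ('i list \<Rightarrow>\<^sub>0 'k) set" where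
  "qext_ideal q = Idl\<^bsub>tensor_alg\<^esub>
     ({word [j, i] - pm_scale (q i j) (word [i, j]) | i j. i \<noteq> j} \<union> {word [i, i] | i. True})"

definition qext :: "('i \<Rightarrow> 'i \<Rightarrow> 'k::field) \<Rightarrow> ('k, ('i list \<Rightarrow>\<^sub>0 'k) set) module" where
  "qext q = quot tensor_alg (qext_ideal q)"

definition qext_class :: "('i \<Rightarrow> 'i \<Rightarrow> 'k::field) \<Rightarrow> ('i list \<Rightarrow>\<^sub>0 'k) \<Rightarrow> ('i list \<Rightarrow>\<^sub>0 'k) set" where
  "qext_class q p = qext_ideal q +>\<^bsub>tensor_alg\<^esub> p"

text \<open>
  \<open>act\<close> is an action of \<open>G\<close> on the quantum exterior algebra by algebra automorphisms that
  extends the action of \<open>G\<close> on \<open>V\<close>. Since \<open>V\<close> generates the algebra, there is at most one.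
\<close>

definition extends_action ::
  "('k::field \<Rightarrow> 'v::ab_group_add \<Rightarrow> 'v) \<Rightarrow> ('i::finite \<Rightarrow> 'v) \<Rightarrow> ('i \<Rightarrow> 'i \<Rightarrow> 'k) \<Rightarrow> ('v \<Rightarrow> 'v) set \<Rightarrow>
   (('v \<Rightarrow> 'v) \<Rightarrow> ('i list \<Rightarrow>\<^sub>0 'k) set \<Rightarrow> ('i list \<Rightarrow>\<^sub>0 'k) set) \<Rightarrow> bool" where
  "extends_action s v q G act \<longleftrightarrow>
     group_action (linear_group s G) (carrier (qext q)) act \<and>
     (\<forall>g\<in>G. act g \<in> ring_iso (qext q) (qext q) \<and>
       (\<forall>c. \<forall>a\<in>carrier (qext q). act g (c \<odot>\<^bsub>qext q\<^esub> a) = c \<odot>\<^bsub>qext q\<^esub> act g a) \<and>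
       (\<forall>x. act g (qext_class q (vec_in_tensor_alg s v x)) =
            qext_class q (vec_in_tensor_alg s v (g x))))"

section \<open>Tensor powers\<close>

text \<open>
  The \<open>m\<close>-fold tensor power over \<open>'k\<close> of a vector space \<open>A\<close>: the free vector space on
  \<open>m\<close>-tuples of elements of \<open>A\<close> modulo the relations expressing multilinearity.
\<close>

definition free_tensors :: "('k::field, 'a) module \<Rightarrow> nat \<Rightarrow> ('k, 'a list \<Rightarrow>\<^sub>0 'k) module" where
  "free_tensors A m =
     \<lparr>carrier = {p. \<forall>xs\<in>Poly_Mapping.keys p. length xs = m \<and> set xs \<subseteq> carrier A},
      mult = (\<lambda>_ _. 0), one = 0, zero = 0, add = (+), smult = pm_scale\<rparr>"

definition tensor_relations :: "('k::field, 'a) module \<Rightarrow> nat \<Rightarrow> ('a list \<Rightarrow>\<^sub>0 'k) set" where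
  "tensor_relations A m = module.span pm_scale
     ({Poly_Mapping.single (xs @ (x \<oplus>\<^bsub>A\<^esub> y) # ys) 1
         - Poly_Mapping.single (xs @ x # ys) 1 - Poly_Mapping.single (xs @ y # ys) 1 | xs x y ys.
         {x, y} \<union> set xs \<union> set ys \<subseteq> carrier A \<and> length xs + length ys + 1 = m} \<union>
      {Poly_Mapping.single (xs @ (c \<odot>\<^bsub>A\<^esub> x) # ys) 1 - Poly_Mapping.single (xs @ x # ys) c | c xs x ys.
         {x} \<union> set xs \<union> set ys \<subseteq> carrier A \<and> length xs + length ys + 1 = m})"

definition tensor_power :: "('k::field, 'a) module \<Rightarrow> nat \<Rightarrow> ('k, ('a list \<Rightarrow>\<^sub>0 'k) set) module" where
  "tensor_power A m = quot (free_tensors A m) (tensor_relations A m)"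

definition pure_tensor :: "('k::field, 'a) module \<Rightarrow> 'a list \<Rightarrow> ('a list \<Rightarrow>\<^sub>0 'k) set" where
  "pure_tensor A xs =
     tensor_relations A (length xs) +>\<^bsub>free_tensors A (length xs)\<^esub> Poly_Mapping.single xs 1"

text \<open>The linear map on the \<open>m\<close>-th tensor power induced by a multilinear operation on tuples.\<close>

definition tensor_map :: "('k::field, 'a) module \<Rightarrow> nat \<Rightarrow> ('a list \<Rightarrow> 'a list) \<Rightarrow>
   ('a list \<Rightarrow>\<^sub>0 'k) set \<Rightarrow> ('a list \<Rightarrow>\<^sub>0 'k) set" where
  "tensor_map A m \<phi> X = (\<Union>p\<in>X. tensor_relations A m +>\<^bsub>free_tensors A m\<^esub>
     (\<Sum>xs\<in>Poly_Mapping.keys p. Poly_Mapping.single (\<phi> xs) (Poly_Mapping.lookup p xs)))"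

section \<open>Bimodules\<close>

record ('a, 'm) bimodule = "'m partial_object" +
  badd :: "'m \<Rightarrow> 'm \<Rightarrow> 'm"
  lact :: "'a \<Rightarrow> 'm \<Rightarrow> 'm"
  ract :: "'m \<Rightarrow> 'a \<Rightarrow> 'm"

definition bimodule_hom ::
  "('k, 'a) module \<Rightarrow> ('a, 'm) bimodule \<Rightarrow> ('a, 'n) bimodule \<Rightarrow> ('m \<Rightarrow> 'n) set" where
  "bimodule_hom A M N = {f. f \<in> carrier M \<rightarrow> carrier N \<and>
     (\<forall>x\<in>carrier M. \<forall>y\<in>carrier M. f (badd M x y) = badd N (f x) (f y)) \<and>
     (\<forall>a\<in>carrier A. \<forall>x\<in>carrier M. f (lact M a x) = lact N a (f x)) \<and>
     (\<forall>a\<in>carrier A. \<forall>x\<in>carrier M. f (ract M x a) = ract N (f x) a)}"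

text \<open>\<open>A\<close> acts on its skew group algebra through the embedding \<open>a \<mapsto> a 1\<close>.\<close>

definition skew_bimodule ::
  "('k, 'a) module \<Rightarrow> 'g monoid \<Rightarrow> ('g \<Rightarrow> 'a \<Rightarrow> 'a) \<Rightarrow> ('a, 'g \<Rightarrow> 'a) bimodule" where
  "skew_bimodule A G act =
     \<lparr>carrier = carrier (skew A G act),
      badd = add (skew A G act),
      lact = (\<lambda>a x. skew_elt A G a \<one>\<^bsub>G\<^esub> \<otimes>\<^bsub>skew A G act\<^esub> x),
      ract = (\<lambda>x a. x \<otimes>\<^bsub>skew A G act\<^esub> skew_elt A G a \<one>\<^bsub>G\<^esub>)\<rparr>"

section \<open>The resolution\<close>

definition msize :: "('i::finite \<Rightarrow> nat) \<Rightarrow> nat" where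
  "msize \<beta> = (\<Sum>i\<in>UNIV. \<beta> i)"

definition unit_idx :: "'i \<Rightarrow> 'i \<Rightarrow> nat" where
  "unit_idx j = (\<lambda>i. if i = j then 1 else 0)"

abbreviation idx_add :: "('i \<Rightarrow> nat) \<Rightarrow> ('i \<Rightarrow> nat) \<Rightarrow> ('i \<Rightarrow> nat)" where
  "idx_add \<alpha> \<beta> \<equiv> (\<lambda>i. \<alpha> i + \<beta> i)"

abbreviation idx_dec :: "('i \<Rightarrow> nat) \<Rightarrow> 'i \<Rightarrow> ('i \<Rightarrow> nat)" where
  "idx_dec \<beta> j \<equiv> \<beta>(j := \<beta> j - 1)"

lemma msize_idx_dec: "\<beta> j > 0 \<Longrightarrow> msize (idx_dec \<beta> j) < msize \<beta>"
  unfolding msize_def by (rule sum_strict_mono_ex1) auto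

text \<open>Terms with \<open>\<beta> j = 0\<close>, for which \<open>\<beta> - [j]\<close> has a negative entry, are omitted.\<close>

function koszul_f :: "('i::{finite,linorder} \<Rightarrow> 'i \<Rightarrow> 'k::field) \<Rightarrow> ('i \<Rightarrow> nat) \<Rightarrow> ('i list \<Rightarrow>\<^sub>0 'k)" where
  "koszul_f q \<beta> =
     (if \<forall>i. \<beta> i = 0 then \<one>\<^bsub>tensor_alg\<^esub>
      else \<Sum>j\<in>{j. \<beta> j > 0}. pm_scale (\<Prod>k\<in>{k. k > j}. (- q k j) ^ \<beta> k)
             (koszul_f q (idx_dec \<beta> j) \<otimes>\<^bsub>tensor_alg\<^esub> word [j]))"
  by pat_completeness auto
termination
  by (relation "measure (\<lambda>(q, \<beta>). msize \<beta>)") (auto simp: msize_idx_dec simp del: One_nat_def)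

declare koszul_f.simps [simp del]

text \<open>
  The tensor \<open>1 \<otimes> f\<^sub>\<beta> \<otimes> 1\<close>, where a word in \<open>V \<otimes> ... \<otimes> V\<close> is read letter by letter as a tensor
  of generators of the quantum exterior algebra.
\<close>

definition koszul_eps ::
  "('i::{finite,linorder} \<Rightarrow> 'i \<Rightarrow> 'k::field) \<Rightarrow> ('i \<Rightarrow> nat) \<Rightarrow> (('i list \<Rightarrow>\<^sub>0 'k) set list \<Rightarrow>\<^sub>0 'k) set" where
  "koszul_eps q \<beta> =
     (let T = tensor_power (qext q) (msize \<beta> + 2) in
      \<Oplus>\<^bsub>T\<^esub>w\<in>Poly_Mapping.keys (koszul_f q \<beta>). Poly_Mapping.lookup (koszul_f q \<beta>) w \<odot>\<^bsub>T\<^esub>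
        pure_tensor (qext q)
          ([\<one>\<^bsub>qext q\<^esub>] @ map (\<lambda>i. qext_class q (word [i])) w @ [\<one>\<^bsub>qext q\<^esub>]))"

definition tensor_lact ::
  "('k::field, 'a) module \<Rightarrow> nat \<Rightarrow> 'a \<Rightarrow> ('a list \<Rightarrow>\<^sub>0 'k) set \<Rightarrow> ('a list \<Rightarrow>\<^sub>0 'k) set" where
  "tensor_lact A m a = tensor_map A m (\<lambda>xs. (a \<otimes>\<^bsub>A\<^esub> hd xs) # tl xs)"

definition tensor_ract ::
  "('k::field, 'a) module \<Rightarrow> nat \<Rightarrow> ('a list \<Rightarrow>\<^sub>0 'k) set \<Rightarrow> 'a \<Rightarrow> ('a list \<Rightarrow>\<^sub>0 'k) set" where
  "tensor_ract A m X a = tensor_map A m (\<lambda>xs. butlast xs @ [last xs \<otimes>\<^bsub>A\<^esub> a]) X"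

text \<open>The sub-bimodule of the \<open>(m+2)\<close>-fold tensor power generated by the \<open>\<epsilon>\<^sub>\<beta>\<close> with \<open>|\<beta>| = m\<close>.\<close>

definition koszul ::
  "('i::{finite,linorder} \<Rightarrow> 'i \<Rightarrow> 'k::field) \<Rightarrow> nat \<Rightarrow>
   (('i list \<Rightarrow>\<^sub>0 'k) set, (('i list \<Rightarrow>\<^sub>0 'k) set list \<Rightarrow>\<^sub>0 'k) set) bimodule" where
  "koszul q m =
     \<lparr>carrier = generate (add_monoid (tensor_power (qext q) (m + 2)))
        {tensor_ract (qext q) (m + 2) (tensor_lact (qext q) (m + 2) a (koszul_eps q \<beta>)) b | a b \<beta>.
           a \<in> carrier (qext q) \<and> b \<in> carrier (qext q) \<and> msize \<beta> = m},
      badd = add (tensor_power (qext q) (m + 2)),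
      lact = tensor_lact (qext q) (m + 2),
      ract = tensor_ract (qext q) (m + 2)\<rparr>"

text \<open>The value of the differential on \<open>\<epsilon>\<^sub>\<beta>\<close>, for \<open>|\<beta>| \<ge> 1\<close>.\<close>

definition koszul_d_eps ::
  "('i::{finite,linorder} \<Rightarrow> 'i \<Rightarrow> 'k::field) \<Rightarrow> ('i \<Rightarrow> nat) \<Rightarrow> (('i list \<Rightarrow>\<^sub>0 'k) set list \<Rightarrow>\<^sub>0 'k) set" where
  "koszul_d_eps q \<beta> =
     (let m = msize \<beta> + 1; T = tensor_power (qext q) m; x = (\<lambda>j. qext_class q (word [j])) in
      \<Oplus>\<^bsub>T\<^esub>j\<in>{j. \<beta> j > 0}. ((-1) ^ (\<Sum>l\<in>{l. l < j}. \<beta> l)) \<odot>\<^bsub>T\<^esub>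
        (((\<Prod>l\<in>{l. l < j}. q j l ^ \<beta> l) \<odot>\<^bsub>T\<^esub>
            tensor_lact (qext q) m (x j) (koszul_eps q (idx_dec \<beta> j))) \<oplus>\<^bsub>T\<^esub>
         (((-1) ^ \<beta> j * (\<Prod>l\<in>{l. l > j}. q l j ^ \<beta> l)) \<odot>\<^bsub>T\<^esub>
            tensor_ract (qext q) m (koszul_eps q (idx_dec \<beta> j)) (x j))))"

text \<open>
  The differential in degree \<open>m \<ge> 1\<close>. It exists and is unique on the resolution, because the
  \<open>\<epsilon>\<^sub>\<beta>\<close> with \<open>|\<beta>| = m\<close> are free generators.
\<close>

definition koszul_differential ::
  "('i::{finite,linorder} \<Rightarrow> 'i \<Rightarrow> 'k::field) \<Rightarrow> nat \<Rightarrow>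
   ((('i list \<Rightarrow>\<^sub>0 'k) set list \<Rightarrow>\<^sub>0 'k) set \<Rightarrow> (('i list \<Rightarrow>\<^sub>0 'k) set list \<Rightarrow>\<^sub>0 'k) set) \<Rightarrow> bool" where
  "koszul_differential q m d \<longleftrightarrow>
     d \<in> bimodule_hom (qext q) (koszul q m) (koszul q (m - 1)) \<and>
     (\<forall>\<beta>. msize \<beta> = m \<longrightarrow> d (koszul_eps q \<beta>) = koszul_d_eps q \<beta>)"

definition constant_2_cocycle ::
  "('i::{finite,linorder} \<Rightarrow> 'i \<Rightarrow> 'k::field) \<Rightarrow> 'g monoid \<Rightarrow>
   ('g \<Rightarrow> ('i list \<Rightarrow>\<^sub>0 'k) set \<Rightarrow> ('i list \<Rightarrow>\<^sub>0 'k) set) \<Rightarrow>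
   ((('i list \<Rightarrow>\<^sub>0 'k) set list \<Rightarrow>\<^sub>0 'k) set \<Rightarrow> ('g \<Rightarrow> ('i list \<Rightarrow>\<^sub>0 'k) set)) \<Rightarrow> bool" where
  "constant_2_cocycle q G act \<eta> \<longleftrightarrow>
     (let \<Lambda> = qext q; S = skew \<Lambda> G act in
      \<eta> \<in> bimodule_hom \<Lambda> (koszul q 2) (skew_bimodule \<Lambda> G act) \<and>
      (\<exists>d. koszul_differential q 3 d \<and> (\<forall>x\<in>carrier (koszul q 3). \<eta> (d x) = \<zero>\<^bsub>S\<^esub>)) \<and>
      (\<forall>\<beta>. msize \<beta> = 2 \<longrightarrow> \<eta> (koszul_eps q \<beta>) \<in> range (group_alg_elt \<Lambda> G)) \<and>
      (\<forall>h\<in>carrier G. \<forall>x\<in>carrier (koszul q 2).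
         \<eta> x = skew_elt \<Lambda> G \<one>\<^bsub>\<Lambda>\<^esub> h
                \<otimes>\<^bsub>S\<^esub> \<eta> (tensor_map \<Lambda> 4 (map (act (inv\<^bsub>G\<^esub> h))) x)
                \<otimes>\<^bsub>S\<^esub> skew_elt \<Lambda> G \<one>\<^bsub>\<Lambda>\<^esub> (inv\<^bsub>G\<^esub> h)))"

section \<open>Truncated quantum Drinfeld Hecke algebras\<close>

text \<open>An element of \<open>KG\<close> is a function on \<open>G\<close>, extended by \<open>undefined\<close> outside \<open>G\<close>.\<close>

definition bilinear_to_group_alg ::
  "('k::field \<Rightarrow> 'v::ab_group_add \<Rightarrow> 'v) \<Rightarrow> 'g set \<Rightarrow> ('v \<Rightarrow> 'v \<Rightarrow> 'g \<Rightarrow> 'k) \<Rightarrow> bool" where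
  "bilinear_to_group_alg s G \<kappa> \<longleftrightarrow>
     (\<forall>x y. \<kappa> x y \<in> G \<rightarrow>\<^sub>E UNIV) \<and>
     (\<forall>g\<in>G. (\<forall>y. Vector_Spaces.linear s (*) (\<lambda>x. \<kappa> x y g)) \<and>
             (\<forall>x. Vector_Spaces.linear s (*) (\<lambda>y. \<kappa> x y g)))"

definition tensor_skew ::
  "('k::field \<Rightarrow> 'v::ab_group_add \<Rightarrow> 'v) \<Rightarrow> ('i::finite \<Rightarrow> 'v) \<Rightarrow> ('v \<Rightarrow> 'v) set \<Rightarrow>
   ('k, ('v \<Rightarrow> 'v) \<Rightarrow> ('i list \<Rightarrow>\<^sub>0 'k)) module" where
  "tensor_skew s v G = skew tensor_alg (linear_group s G) (tensor_alg_act s v)"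

definition hecke_ideal ::
  "('k::field \<Rightarrow> 'v::ab_group_add \<Rightarrow> 'v) \<Rightarrow> ('i::finite \<Rightarrow> 'v) \<Rightarrow> ('i \<Rightarrow> 'i \<Rightarrow> 'k) \<Rightarrow> ('v \<Rightarrow> 'v) set \<Rightarrow>
   ('v \<Rightarrow> 'v \<Rightarrow> ('v \<Rightarrow> 'v) \<Rightarrow> 'k) \<Rightarrow> (('v \<Rightarrow> 'v) \<Rightarrow> ('i list \<Rightarrow>\<^sub>0 'k)) set" where
  "hecke_ideal s v q G \<kappa> =
     (let S = tensor_skew s v G; \<Gamma> = linear_group s G in
      Idl\<^bsub>S\<^esub>
        ({skew_elt tensor_alg \<Gamma> (word [j, i] - pm_scale (q i j) (word [i, j])) \<one>\<^bsub>\<Gamma>\<^esub>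
            \<ominus>\<^bsub>S\<^esub> group_alg_elt tensor_alg \<Gamma> (\<kappa> (v i) (v j)) | i j. True} \<union>
         {skew_elt tensor_alg \<Gamma> (word [i, i]) \<one>\<^bsub>\<Gamma>\<^esub> | i. True}))"

definition hecke_alg ::
  "('k::field \<Rightarrow> 'v::ab_group_add \<Rightarrow> 'v) \<Rightarrow> ('i::finite \<Rightarrow> 'v) \<Rightarrow> ('i \<Rightarrow> 'i \<Rightarrow> 'k) \<Rightarrow> ('v \<Rightarrow> 'v) set \<Rightarrow>
   ('v \<Rightarrow> 'v \<Rightarrow> ('v \<Rightarrow> 'v) \<Rightarrow> 'k) \<Rightarrow> ('k, (('v \<Rightarrow> 'v) \<Rightarrow> ('i list \<Rightarrow>\<^sub>0 'k)) set) module" where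
  "hecke_alg s v q G \<kappa> = quot (tensor_skew s v G) (hecke_ideal s v q G \<kappa>)"

text \<open>The word of the monomial in which the exponents \<open>\<alpha>\<close> occur in the order of the indices.\<close>

definition ordered_word :: "('i::{finite,linorder} \<Rightarrow> nat) \<Rightarrow> 'i list" where
  "ordered_word \<alpha> = concat (map (\<lambda>i. replicate (\<alpha> i) i) (sorted_list_of_set UNIV))"

definition truncated_quantum_DHA ::
  "('k::field \<Rightarrow> 'v::ab_group_add \<Rightarrow> 'v) \<Rightarrow> ('i::{finite,linorder} \<Rightarrow> 'v) \<Rightarrow> ('i \<Rightarrow> 'i \<Rightarrow> 'k) \<Rightarrow>
   ('v \<Rightarrow> 'v) set \<Rightarrow> ('v \<Rightarrow> 'v \<Rightarrow> ('v \<Rightarrow> 'v) \<Rightarrow> 'k) \<Rightarrow> bool" where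
  "truncated_quantum_DHA s v q G \<kappa> \<longleftrightarrow>
     finite_family_basis (hecke_alg s v q G \<kappa>) ({\<alpha>. \<forall>i. \<alpha> i \<in> {0, 1}} \<times> G)
       (\<lambda>(\<alpha>, g). hecke_ideal s v q G \<kappa> +>\<^bsub>tensor_skew s v G\<^esub>
          skew_elt tensor_alg (linear_group s G) (word (ordered_word \<alpha>)) g)"

end

theory Submission
  imports Defs
begin

text \<open>
  Evaluating the cocycle condition on \<open>\<epsilon>\<^sub>\<beta>\<close> for \<open>\<beta> = 2[i] + [j]\<close> and \<open>\<beta> = [i] + [j] + [k]\<close> shows that every
  \<open>g\<close> in the support of \<open>\<kappa>(v\<^sub>i, v\<^sub>j)\<close> is diagonal in the basis \<open>v\<close>, with eigenvalue \<open>- q\<^sub>i\<^sub>j\<close> at \<open>v\<^sub>i\<close>,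
  \<open>- q\<^sub>j\<^sub>i\<close> at \<open>v\<^sub>j\<close> and \<open>q\<^sub>k\<^sub>i q\<^sub>k\<^sub>j\<close> at every other \<open>v\<^sub>k\<close>. Hence the obvious reordering of \<open>v\<^sub>i\<close> into an increasing
  monomial defines operators on the space spanned by the symbols \<open>v\<^sub>a\<^sub>1 ... v\<^sub>a\<^sub>m g\<close> with \<open>a\<^sub>1 < ... < a\<^sub>m\<close>, and
  these eigenvalues are precisely what is needed for the operators to satisfy the relations of the Hecke
  algebra. Applying a word to the empty monomial is then a normal form map; by \<open>G\<close>-invariance of the
  cocycle it annihilates the two-sided ideal, and modulo the ideal every element is
  congruent to its normal form.
\<close>

text \<open>The group acts by arbitrary matrices, but only elements in the support of some \<kappa>
  enter the reordering operators, and those are diagonal, so moving them past a word costs a scalar.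
  The delicate point is a reordering that produces two \<kappa>-terms, one after the other. It is
  consistent if any two elements g, h of the supports commute and if \<chi>_g(a) \<chi>_g(b) = 1
  whenever \<kappa>(v_a, v_b) is nonzero at h. Diagonal maps commute; the second fact comes from
  invariance under g itself: g multiplies the relation between v_a and v_b by \<chi>_g(a)
  \<chi>_g(b), while conjugation by g fixes h. Arbitrary elements of G meet the operators only in
  the proof that normal forms vanish on the ideal. There the effect of such an element is expressed
  through a tensor p representing a vector p g, not through an operator on the symbols. On the side
  of the cocycle, equations live in quotients. They are compared in degrees at most two, where
  membership in the defining ideal is visible in the coefficients of short words.\<close>

abbreviation lookup :: "('a \<Rightarrow>\<^sub>0 'k::zero) \<Rightarrow> 'a \<Rightarrow> 'k" where "lookup \<equiv> Poly_Mapping.lookup"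
abbreviation keys :: "('a \<Rightarrow>\<^sub>0 'k::zero) \<Rightarrow> 'a set" where "keys \<equiv> Poly_Mapping.keys"
abbreviation single :: "'a \<Rightarrow> 'k::zero \<Rightarrow> 'a \<Rightarrow>\<^sub>0 'k" where "single \<equiv> Poly_Mapping.single"

section \<open>Free vector spaces\<close>

lemma lookup_pm_scale [simp]: "lookup (pm_scale c p) x = c * lookup p x"
  by (simp add: pm_scale_def Poly_Mapping.map.rep_eq when_def)

lemma vector_space_pm_scale: "vector_space pm_scale"
  by standard (auto intro!: poly_mapping_eqI simp: lookup_add algebra_simps)

interpretation pm: vector_space pm_scale
  by (rule vector_space_pm_scale)

abbreviation pm_linear :: "(('a \<Rightarrow>\<^sub>0 'k::field) \<Rightarrow> ('b \<Rightarrow>\<^sub>0 'k)) \<Rightarrow> bool" where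
  "pm_linear \<equiv> Vector_Spaces.linear pm_scale pm_scale"

lemma pm_linear_iff:
  "pm_linear F \<longleftrightarrow> (\<forall>x y. F (x + y) = F x + F y) \<and> (\<forall>c x. F (pm_scale c x) = pm_scale c (F x))"
  by (simp add: Vector_Spaces.linear_iff vector_space_pm_scale)

lemma pm_linear_add: "pm_linear F \<Longrightarrow> F (x + y) = F x + F y"
  and pm_linear_scale: "pm_linear F \<Longrightarrow> F (pm_scale c x) = pm_scale c (F x)"
  by (auto simp: pm_linear_iff)

lemma pm_linear_0: "pm_linear F \<Longrightarrow> F 0 = 0"
  using pm_linear_scale[of F 0 0] by simp

lemma pm_linear_diff: "pm_linear F \<Longrightarrow> F (x - y) = F x - F y"
  using pm_linear_add[of F "x - y" y] by (simp add: algebra_simps)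

lemma pm_linear_sum: "pm_linear F \<Longrightarrow> F (\<Sum>i\<in>A. f i) = (\<Sum>i\<in>A. F (f i))"
  by (induction A rule: infinite_finite_induct) (auto simp: pm_linear_0 pm_linear_add)

lemma pm_scale_single [simp]: "pm_scale c (single x a) = single x (c * a)"
  by (rule poly_mapping_eqI) (simp add: lookup_single when_def)

lemma keys_pm_scale: "keys (pm_scale c p) \<subseteq> keys p"
  by (auto simp: in_keys_iff)

lemma pm_scale_sum: "pm_scale c (\<Sum>i\<in>A. f i) = (\<Sum>i\<in>A. pm_scale c (f i))"
  by (rule pm.scale_sum_right)

definition lin :: "('a \<Rightarrow> 'b \<Rightarrow>\<^sub>0 'k::field) \<Rightarrow> ('a \<Rightarrow>\<^sub>0 'k) \<Rightarrow> ('b \<Rightarrow>\<^sub>0 'k)" where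
  "lin f p = (\<Sum>x\<in>keys p. pm_scale (lookup p x) (f x))"

lemma lin_superset: "finite A \<Longrightarrow> keys p \<subseteq> A \<Longrightarrow> lin f p = (\<Sum>x\<in>A. pm_scale (lookup p x) (f x))"
  unfolding lin_def by (rule sum.mono_neutral_left) (auto simp: in_keys_iff)

lemma lin_add: "lin f (p + r) = lin f p + lin f r"
  using Poly_Mapping.keys_add[of p r]
  by (simp add: lin_superset[of "keys p \<union> keys r"] lookup_add pm.scale_left_distrib sum.distrib)

lemma lin_scale: "lin f (pm_scale c p) = pm_scale c (lin f p)"
  by (subst lin_superset[OF finite_keys keys_pm_scale]) (simp add: lin_def pm_scale_sum)

lemma pm_linear_lin [simp]: "pm_linear (lin f)"
  by (simp add: pm_linear_iff lin_add lin_scale)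

lemma lin_single [simp]: "lin f (single x c) = pm_scale c (f x)"
  by (simp add: lin_def)

lemmas lin_0 [simp] = pm_linear_0[OF pm_linear_lin]
lemmas lin_diff = pm_linear_diff[OF pm_linear_lin]
lemmas lin_sum = pm_linear_sum[OF pm_linear_lin]

lemma lin_cong: "(\<And>x. x \<in> keys p \<Longrightarrow> f x = g x) \<Longrightarrow> lin f p = lin g p"
  by (simp add: lin_def)

lemma lin_singles [simp]: "lin (\<lambda>x. single x 1) p = p"
proof (rule poly_mapping_eqI)
  fix y
  have "lookup (lin (\<lambda>x. single x 1) p) y = (\<Sum>x\<in>keys p. if y = x then lookup p x else 0)"
    by (auto simp: lin_def lookup_sum lookup_single when_def intro!: sum.cong)
  then show "lookup (lin (\<lambda>x. single x 1) p) y = lookup p y"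
    by (simp add: in_keys_iff)
qed

lemma pm_linear_lin_eq: "pm_linear F \<Longrightarrow> F (lin f p) = lin (\<lambda>x. F (f x)) p"
  by (simp add: lin_def pm_linear_sum pm_linear_scale)

lemma pm_linear_eq_lin: "pm_linear F \<Longrightarrow> F p = lin (\<lambda>x. F (single x 1)) p"
  using pm_linear_lin_eq[of F "\<lambda>x. single x 1" p] by simp

text \<open>Testing only the symbols in the support of \<open>p\<close> matters: most operator
  identities below are asserted on normal words only.\<close>

lemma pm_linear_eqI:
  assumes "pm_linear F" "pm_linear H" "\<And>x. x \<in> keys p \<Longrightarrow> F (single x 1) = H (single x 1)"
  shows "F p = H p"
  unfolding pm_linear_eq_lin[OF assms(1), of p] pm_linear_eq_lin[OF assms(2), of p]
  by (rule lin_cong) (rule assms(3))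

lemma pm_linear_id [simp]: "pm_linear (\<lambda>x. x)"
  and pm_linear_zero [simp]: "pm_linear (\<lambda>x. 0)"
  by (auto simp: pm_linear_iff)

lemma pm_linear_comp: "pm_linear F \<Longrightarrow> pm_linear H \<Longrightarrow> pm_linear (\<lambda>x. F (H x))"
  by (simp add: pm_linear_iff)

lemma pm_linear_plus: "pm_linear F \<Longrightarrow> pm_linear H \<Longrightarrow> pm_linear (\<lambda>x. F x + H x)"
  by (simp add: pm_linear_iff pm.scale_right_distrib add_ac)

lemma pm_linear_minus: "pm_linear F \<Longrightarrow> pm_linear H \<Longrightarrow> pm_linear (\<lambda>x. F x - H x)"
  by (simp add: pm_linear_iff pm.scale_right_diff_distrib algebra_simps)

lemma pm_linear_scale_comp: "pm_linear F \<Longrightarrow> pm_linear (\<lambda>x. pm_scale c (F x))"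
  by (simp add: pm_linear_iff pm.scale_right_distrib mult.commute)

lemma pm_linear_sum_comp: "(\<And>i. i \<in> A \<Longrightarrow> pm_linear (F i)) \<Longrightarrow> pm_linear (\<lambda>x. \<Sum>i\<in>A. F i x)"
  by (induction A rule: infinite_finite_induct) (auto intro: pm_linear_plus)

lemma pm_linear_lin_param:
  assumes "\<And>x. pm_linear (F x)"
  shows "pm_linear (\<lambda>y. lin (\<lambda>x. F x y) p)"
  unfolding lin_def by (intro pm_linear_sum_comp pm_linear_scale_comp assms)

lemmas pm_linear_intros = pm_linear_lin pm_linear_id pm_linear_zero pm_linear_plus pm_linear_minus
  pm_linear_scale_comp pm_linear_sum_comp pm_linear_lin_param

lemma keys_lin_subset:
  assumes "\<And>x. x \<in> keys p \<Longrightarrow> keys (f x) \<subseteq> B"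
  shows "keys (lin f p) \<subseteq> B"
proof
  fix y assume "y \<in> keys (lin f p)"
  then have "(\<Sum>x\<in>keys p. lookup p x * lookup (f x) y) \<noteq> 0"
    by (simp add: lin_def in_keys_iff lookup_sum)
  then obtain x where "x \<in> keys p" "lookup (f x) y \<noteq> 0"
    by (metis (no_types, lifting) mult_zero_right sum.neutral)
  then show "y \<in> B" using assms[of x] by (metis in_keys_iff subsetD)
qed

lemma keys_add_subset: "keys x \<subseteq> B \<Longrightarrow> keys y \<subseteq> B \<Longrightarrow> keys (x + y) \<subseteq> B"
  using Poly_Mapping.keys_add[of x y] by blast

lemma keys_scale_subset: "keys x \<subseteq> B \<Longrightarrow> keys (pm_scale c x) \<subseteq> B"
  using keys_pm_scale[of c x] by blast

lemma keys_sum_subset: "(\<And>i. i \<in> A \<Longrightarrow> keys (f i) \<subseteq> B) \<Longrightarrow> keys (\<Sum>i\<in>A. f i) \<subseteq> B"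
  using keys_sum[of f A] by blast

section \<open>Reordering operators on increasing words times group elements\<close>

text \<open>The conditions on \<open>\<kappa>\<close> and its supports under which reordering is
  consistent, stated without reference to a vector space. \<open>\<chi> g i\<close> stands for the
  eigenvalue of \<open>g\<close> at the letter \<open>i\<close>; every assumption about it is
  restricted to \<open>g\<close> in the support of some \<open>\<kappa> i j\<close>, since other
  group elements need not be diagonal. \<open>\<kappa>_comm\<close> and \<open>\<chi>_inv\<close>
  govern a reordering in which two group elements appear one after the other.\<close>

locale pbw_data = \<Gamma>: group \<Gamma> for \<Gamma> :: "'g monoid" (structure) +
  fixes q :: "'i::linorder \<Rightarrow> 'i \<Rightarrow> 'k::field"
    and \<kappa> :: "'i \<Rightarrow> 'i \<Rightarrow> 'g \<Rightarrow> 'k"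
    and \<chi> :: "'g \<Rightarrow> 'i \<Rightarrow> 'k"
  assumes fin: "finite (carrier \<Gamma>)"
    and q_inv: "i \<noteq> j \<Longrightarrow> q i j * q j i = 1"
    and \<kappa>_skew: "i \<noteq> j \<Longrightarrow> g \<in> carrier \<Gamma> \<Longrightarrow> \<kappa> i j g = - q i j * \<kappa> j i g"
    and \<chi>_pair: "i \<noteq> j \<Longrightarrow> g \<in> carrier \<Gamma> \<Longrightarrow> \<kappa> i j g \<noteq> 0 \<Longrightarrow> \<chi> g i = - q i j"
    and \<chi>_other: "i \<noteq> j \<Longrightarrow> k \<noteq> i \<Longrightarrow> k \<noteq> j \<Longrightarrow> g \<in> carrier \<Gamma> \<Longrightarrow> \<kappa> i j g \<noteq> 0 \<Longrightarrow> \<chi> g k = q k i * q k j"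
    and \<kappa>_comm: "i \<noteq> j \<Longrightarrow> a \<noteq> b \<Longrightarrow> g \<in> carrier \<Gamma> \<Longrightarrow> h \<in> carrier \<Gamma> \<Longrightarrow> \<kappa> i j g \<noteq> 0 \<Longrightarrow> \<kappa> a b h \<noteq> 0
      \<Longrightarrow> g \<otimes> h = h \<otimes> g"
    and \<chi>_inv: "i \<noteq> j \<Longrightarrow> a \<noteq> b \<Longrightarrow> g \<in> carrier \<Gamma> \<Longrightarrow> h \<in> carrier \<Gamma> \<Longrightarrow> \<kappa> i j g \<noteq> 0 \<Longrightarrow> \<kappa> a b h \<noteq> 0
      \<Longrightarrow> \<chi> g a * \<chi> g b = 1"
begin

definition wt :: "'g \<Rightarrow> 'i list \<Rightarrow> 'k" where "wt h l = prod_list (map (\<chi> h) l)"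

lemma wt_simps [simp]: "wt h [] = 1" "wt h (a # l) = \<chi> h a * wt h l"
  by (simp_all add: wt_def)

text \<open>Left multiplication by \<open>h\<close>: moving \<open>h\<close> past the word
  \<open>l\<close> applies \<open>h\<close> to each letter, which for diagonal \<open>h\<close>
  gives the factor \<open>wt h l\<close>. For other \<open>h\<close> the formula does not describe
  multiplication by \<open>h\<close>; in the use that \<open>twist\<close> makes of it, such
  \<open>h\<close> have coefficient zero.\<close>

definition shift :: "'g \<Rightarrow> ('i list \<times> 'g \<Rightarrow>\<^sub>0 'k) \<Rightarrow> ('i list \<times> 'g \<Rightarrow>\<^sub>0 'k)" where
  "shift h = lin (\<lambda>(l, g). single (l, h \<otimes> g) (wt h l))"

definition twist :: "'i \<Rightarrow> 'i \<Rightarrow> ('i list \<times> 'g \<Rightarrow>\<^sub>0 'k) \<Rightarrow> ('i list \<times> 'g \<Rightarrow>\<^sub>0 'k)" where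
  "twist i j x = (\<Sum>h\<in>carrier \<Gamma>. pm_scale (\<kappa> i j h) (shift h x))"

definition prep :: "'i \<Rightarrow> ('i list \<times> 'g \<Rightarrow>\<^sub>0 'k) \<Rightarrow> ('i list \<times> 'g \<Rightarrow>\<^sub>0 'k)" where
  "prep a = lin (\<lambda>(l, g). single (a # l, g) 1)"

text \<open>Left multiplication by v_i on an increasing word, computed by v_i v_a = q_ai v_a v_i +
  \<kappa>(v_a, v_i) for a < i and by v_i v_i = 0. The recursion moves v_i to the right past smaller
  letters; each passage adds a correction term in which both letters are gone and a group element
  has moved past the rest of the word.\<close>

fun ins :: "'i \<Rightarrow> 'i list \<Rightarrow> 'g \<Rightarrow> ('i list \<times> 'g \<Rightarrow>\<^sub>0 'k)" where
  "ins i [] g = single ([i], g) 1"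
| "ins i (a # l) g = (if i < a then single (i # a # l, g) 1 else if i = a then 0
     else pm_scale (q a i) (prep a (ins i l g)) + twist a i (single (l, g) 1))"

definition op :: "'i \<Rightarrow> ('i list \<times> 'g \<Rightarrow>\<^sub>0 'k) \<Rightarrow> ('i list \<times> 'g \<Rightarrow>\<^sub>0 'k)" where
  "op i = lin (\<lambda>(l, g). ins i l g)"

text \<open>The bound \<open>X\<close> on the letters is kept so that \<open>X = {a<..}\<close> can
  express that \<open>a\<close> may be prepended without reordering.\<close>

definition normal_words :: "'i set \<Rightarrow> ('i list \<times> 'g) set" where
  "normal_words X = {(l, g). sorted_wrt (<) l \<and> set l \<subseteq> X \<and> g \<in> carrier \<Gamma>}"

lemma linear_ops [simp]:
  "pm_linear (shift h)" "pm_linear (twist i j)" "pm_linear (prep a)" "pm_linear (op i)"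
  unfolding shift_def twist_def[abs_def] prep_def op_def by (intro pm_linear_intros)+

lemmas op_add = pm_linear_add[OF linear_ops(1)] pm_linear_add[OF linear_ops(2)]
  pm_linear_add[OF linear_ops(3)] pm_linear_add[OF linear_ops(4)]
lemmas op_scale = pm_linear_scale[OF linear_ops(1)] pm_linear_scale[OF linear_ops(2)]
  pm_linear_scale[OF linear_ops(3)] pm_linear_scale[OF linear_ops(4)]
lemmas op_zero [simp] = pm_linear_0[OF linear_ops(1)] pm_linear_0[OF linear_ops(2)]
  pm_linear_0[OF linear_ops(3)] pm_linear_0[OF linear_ops(4)]
lemmas op_sum = pm_linear_sum[OF linear_ops(1)] pm_linear_sum[OF linear_ops(2)]
  pm_linear_sum[OF linear_ops(3)] pm_linear_sum[OF linear_ops(4)]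

lemmas op_linears = linear_ops pm_linear_comp[OF linear_ops(1)] pm_linear_comp[OF linear_ops(2)]
  pm_linear_comp[OF linear_ops(3)] pm_linear_comp[OF linear_ops(4)] pm_linear_intros

lemma op_single [simp]:
  "shift h (single (l, g) c) = single (l, h \<otimes> g) (c * wt h l)"
  "prep a (single (l, g) c) = single (a # l, g) c"
  "op i (single (l, g) c) = pm_scale c (ins i l g)"
  by (simp_all add: shift_def prep_def op_def)

lemma keys_shift: "keys x \<subseteq> normal_words X \<Longrightarrow> h \<in> carrier \<Gamma> \<Longrightarrow> keys (shift h x) \<subseteq> normal_words X"
  unfolding shift_def
  by (rule keys_lin_subset) (fastforce simp: normal_words_def split: if_splits)

lemma keys_twist: "keys x \<subseteq> normal_words X \<Longrightarrow> keys (twist i j x) \<subseteq> normal_words X"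
  unfolding twist_def by (intro keys_sum_subset keys_scale_subset keys_shift)

lemma keys_prep: "keys x \<subseteq> normal_words X \<Longrightarrow> X \<subseteq> {a<..} \<Longrightarrow> keys (prep a x) \<subseteq> normal_words (insert a X)"
  unfolding prep_def
  by (rule keys_lin_subset) (fastforce simp: normal_words_def split: if_splits)

lemma keys_ins: "(l, g) \<in> normal_words X \<Longrightarrow> keys (ins i l g) \<subseteq> normal_words (insert i X)"
proof (induction l arbitrary: X)
  case Nil
  then show ?case by (auto simp: normal_words_def)
next
  case (Cons a l)
  consider "i < a" | "i = a" | "a < i" by fastforce
  then show ?case
  proof cases
    case 1
    then show ?thesis using Cons.prems by (auto simp: normal_words_def)
  next
    case 2
    then show ?thesis by simp
  next
    case 3
    \<comment> \<open>Intersecting with \<open>{a<..}\<close> keeps the information that the tail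
      lies above \<open>a\<close>, which is what allows \<open>a\<close> to be prepended to the
      result.\<close>
    have "(l, g) \<in> normal_words (X \<inter> {a<..})" using Cons.prems by (auto simp: normal_words_def)
    from Cons.IH[OF this] have "keys (ins i l g) \<subseteq> normal_words (insert i (X \<inter> {a<..}))" .
    then have "keys (prep a (ins i l g)) \<subseteq> normal_words (insert a (insert i (X \<inter> {a<..})))"
      by (rule keys_prep) (use 3 in auto)
    also have "\<dots> \<subseteq> normal_words (insert i X)" using Cons.prems by (auto simp: normal_words_def)
    finally have A: "keys (prep a (ins i l g)) \<subseteq> normal_words (insert i X)" .
    have "keys (single (l, g) (1::'k)) \<subseteq> normal_words (insert i X)"
      using Cons.prems by (auto simp: normal_words_def)
    then have "keys (pm_scale (q a i) (prep a (ins i l g)) + twist a i (single (l, g) 1)) \<subseteq> normal_words (insert i X)"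
      by (intro keys_add_subset keys_scale_subset keys_twist A)
    with 3 show ?thesis by auto
  qed
qed

lemma keys_op: "keys x \<subseteq> normal_words X \<Longrightarrow> i \<in> X \<Longrightarrow> keys (op i x) \<subseteq> normal_words X"
  unfolding op_def using keys_ins[of _ _ X i]
  by (intro keys_lin_subset) (auto simp: insert_absorb)

lemma op_eq_prep: "keys x \<subseteq> normal_words {a<..} \<Longrightarrow> op a x = prep a x"
proof (rule pm_linear_eqI[OF linear_ops(4) linear_ops(3)])
  fix y assume "keys x \<subseteq> normal_words {a<..}" "y \<in> keys x"
  then show "op a (single y 1) = prep a (single y 1)"
    by (cases y; cases "fst y") (auto simp: normal_words_def)
qed

text \<open>On words with letters above \<open>a\<close> the inner operator merely prepends
  \<open>a\<close>, and the outer one then takes the last clause of \<open>ins\<close>. So one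
  instance of the wanted relation holds by construction, and the others are reduced to it.\<close>

lemma op_op_greater: "a < i \<Longrightarrow> keys x \<subseteq> normal_words {a<..} \<Longrightarrow>
  op i (op a x) = pm_scale (q a i) (op a (op i x)) + twist a i x"
proof -
  assume a: "a < i" "keys x \<subseteq> normal_words {a<..}"
  have "op i (prep a x) = pm_scale (q a i) (prep a (op i x)) + twist a i x"
    by (rule pm_linear_eqI[of _ _ x]; (intro op_linears)?) (use a in auto)
  then show ?thesis using a by (simp add: op_eq_prep keys_op)
qed

lemma op_op_same: "keys x \<subseteq> normal_words {a<..} \<Longrightarrow> op a (op a x) = 0"
  unfolding op_eq_prep
  by (rule pm_linear_eqI[of "\<lambda>x. op a (prep a x)" "\<lambda>x. 0"]; (intro op_linears)?) auto

text \<open>Conjugation by a diagonal \<open>h\<close> scales v_i. In the correction term of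
  \<open>ins\<close> the letters \<open>a\<close> and \<open>i\<close> have disappeared, so the
  factor \<open>\<chi> h a * \<chi> h i\<close> carried by the main term has to come for free: it is
  1 by \<open>\<chi>_inv\<close>, and \<open>\<kappa>_comm\<close> lets \<open>h\<close> pass the
  group elements of \<open>\<kappa> a i\<close>. Both facts concern an \<open>h\<close> that lies in
  some support, whence the hypothesis on \<open>i0\<close> and \<open>j0\<close>.\<close>

lemma shift_op:
  assumes h: "h \<in> carrier \<Gamma>" and hk: "i0 \<noteq> j0" "\<kappa> i0 j0 h \<noteq> 0" and x: "keys x \<subseteq> normal_words UNIV"
  shows "shift h (op i x) = pm_scale (\<chi> h i) (op i (shift h x))"
proof -
  have prep: "shift h (prep a y) = pm_scale (\<chi> h a) (prep a (shift h y))" for a y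
    by (rule pm_linear_eqI; (intro op_linears)?) auto
  have tw: "shift h (twist a b (single (l, g) 1)) =
      pm_scale (\<chi> h a * \<chi> h b) (twist a b (shift h (single (l, g) 1)))"
    if "a \<noteq> b" "g \<in> carrier \<Gamma>" for a b l g
  proof -
    have "pm_scale (\<kappa> a b k) (single (l, h \<otimes> (k \<otimes> g)) (wt k l * wt h l)) =
       pm_scale (\<chi> h a * \<chi> h b * \<kappa> a b k) (single (l, k \<otimes> (h \<otimes> g)) (wt h l * wt k l))"
      if "k \<in> carrier \<Gamma>" for k
    \<comment> \<open>Commutation with \<open>k\<close> is known on the support of
      \<open>\<kappa> a b\<close>; elsewhere both coefficients vanish.\<close>
    proof (cases "\<kappa> a b k = 0")
      case False
      have "h \<otimes> k = k \<otimes> h" "\<chi> h a * \<chi> h b = 1"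
        using \<kappa>_comm[OF hk(1) \<open>a \<noteq> b\<close> h that hk(2) False] \<chi>_inv[OF hk(1) \<open>a \<noteq> b\<close> h that hk(2) False] .
      then show ?thesis using h that \<open>g \<in> carrier \<Gamma>\<close> by (simp add: \<Gamma>.m_assoc[symmetric] mult_ac)
    qed simp
    then show ?thesis
      by (simp add: twist_def op_sum op_scale pm_scale_sum mult_ac del: pm_scale_single pm.scale_scale)
         (simp add: mult_ac)
  qed
  have "shift h (ins i l g) = pm_scale (\<chi> h i * wt h l) (ins i l (h \<otimes> g))"
    if "(l, g) \<in> normal_words UNIV" for l g
    using that
  proof (induction l)
    case Nil
    then show ?case by simp
  next
    case (Cons a l)
    then have l: "(l, g) \<in> normal_words UNIV" and g: "g \<in> carrier \<Gamma>" by (auto simp: normal_words_def)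
    have tw_scale: "twist a b (single (l, k) c) = pm_scale c (twist a b (single (l, k) 1))" for a b k c
      using op_scale(2)[of a b c "single (l, k) 1"] by simp
    show ?case using Cons.IH[OF l] tw[OF _ g, of a i l] 
      by (auto simp: op_add op_scale prep tw_scale[of _ _ _ "wt h l"] pm.scale_right_distrib mult_ac)
  qed
  then show ?thesis
    by (intro pm_linear_eqI[of "\<lambda>x. shift h (op i x)" "\<lambda>x. pm_scale (\<chi> h i) (op i (shift h x))" x])
       (use x in \<open>auto intro!: op_linears\<close>)
qed

text \<open>All group elements in the support of \<open>\<kappa> i j\<close> share the eigenvalue
  \<open>c\<close> at \<open>k\<close>, so it can be taken out of the sum.\<close>

lemma twist_op:
  assumes "i \<noteq> j" "keys x \<subseteq> normal_words UNIV" "\<And>h. h \<in> carrier \<Gamma> \<Longrightarrow> \<kappa> i j h \<noteq> 0 \<Longrightarrow> \<chi> h k = c"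
  shows "twist i j (op k x) = pm_scale c (op k (twist i j x))"
proof -
  have "pm_scale (\<kappa> i j h) (shift h (op k x)) = pm_scale (\<kappa> i j h) (pm_scale c (op k (shift h x)))"
    if "h \<in> carrier \<Gamma>" for h
    using that assms shift_op[of h i j x k] by (cases "\<kappa> i j h = 0") auto
  then show ?thesis
    by (simp add: twist_def op_sum op_scale pm_scale_sum mult_ac)
qed

lemma twist_op_same: "i \<noteq> j \<Longrightarrow> keys x \<subseteq> normal_words UNIV \<Longrightarrow> twist i j (op i x) = pm_scale (- q i j) (op i (twist i j x))"
  by (rule twist_op) (auto simp: \<chi>_pair)

lemma twist_op_same': "i \<noteq> j \<Longrightarrow> keys x \<subseteq> normal_words UNIV \<Longrightarrow> twist i j (op j x) = pm_scale (- q j i) (op j (twist i j x))"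
  using \<kappa>_skew[of i j] q_inv[of i j] by (intro twist_op) (auto intro!: \<chi>_pair)

lemma twist_op_other: "i \<noteq> j \<Longrightarrow> k \<noteq> i \<Longrightarrow> k \<noteq> j \<Longrightarrow> keys x \<subseteq> normal_words UNIV \<Longrightarrow>
   twist i j (op k x) = pm_scale (q k i * q k j) (op k (twist i j x))"
  by (rule twist_op) (auto simp: \<chi>_other)

lemma normal_mono: "X \<subseteq> Y \<Longrightarrow> normal_words X \<subseteq> normal_words Y"
  by (auto simp: normal_words_def)

text \<open>Induction on the word, peeling off its first letter \<open>a\<close>. If
  \<open>j < a\<close> the relation is a case of \<open>op_op_greater\<close>. Otherwise the
  operators are moved past \<open>a\<close>, so that the induction hypothesis applies to the tail,
  and the remaining \<kappa>-terms cancel or match because of the eigenvalues of their group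
  elements. This is the overlap check of a PBW theorem: v_i v_j v_a can be reordered beginning with
  either pair.\<close>

lemma op_relations_single:
  "(l, g) \<in> normal_words UNIV \<Longrightarrow>
    (\<forall>i j. j < i \<longrightarrow> op i (op j (single (l, g) 1)) =
       pm_scale (q j i) (op j (op i (single (l, g) 1))) + twist j i (single (l, g) 1)) \<and>
    (\<forall>i. op i (op i (single (l, g) 1)) = 0)"
proof (induction l)
  case Nil
  then have "keys (single ([], g) (1::'k)) \<subseteq> normal_words {a<..}" for a by (auto simp: normal_words_def)
  then show ?case using op_op_greater op_op_same by blast
next
  case (Cons a l)
  define x :: "'i list \<times> 'g \<Rightarrow>\<^sub>0 'k" where "x = single (l, g) 1"
  have xa: "keys x \<subseteq> normal_words {a<..}" and xU: "keys x \<subseteq> normal_words UNIV" and l: "(l, g) \<in> normal_words UNIV"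
    using Cons.prems by (auto simp: x_def normal_words_def)
  have y: "single (a # l, g) 1 = op a x"
    using op_eq_prep[OF xa] by (simp add: x_def)
  have IH: "op i (op j x) = pm_scale (q j i) (op j (op i x)) + twist j i x" if "j < i" for i j
    using Cons.IH[OF l] that by (simp add: x_def)
  have IH2: "op i (op i x) = 0" for i using Cons.IH[OF l] by (simp add: x_def)
  have ya: "keys (op a x) \<subseteq> normal_words {b<..}" if "b < a" for b
    using keys_op[of x "{b<..}" a] xa normal_mono[of "{a<..}" "{b<..}"] that by fastforce
  note opa = op_op_greater[OF _ xa] op_op_same[OF xa]
  have opx: "keys (op i x) \<subseteq> normal_words {a<..}" if "a < i" for i using keys_op[OF xa] that by simp
  have twx: "keys (twist i j x) \<subseteq> normal_words {a<..}" for i j using keys_twist[OF xa] .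
  have R: "op i (op j (op a x)) = pm_scale (q j i) (op j (op i (op a x))) + twist j i (op a x)"
    if "j < i" for i j
  proof -
    consider "j < a" | "j = a" | "a < j" by fastforce
    then show ?thesis
    proof cases
      case 1
      then show ?thesis using op_op_greater[OF that ya] by simp
    next
      case 2
      then have ai: "a < i" using that by simp
      \<comment> \<open>The left side contains v_a v_a and is zero. On the right, moving v_a past
        v_i gives \<open>q a i\<close> times \<open>op a (twist a i x)\<close>, and the eigenvalue
        \<open>- q a i\<close> at v_a makes the twist term its negative.\<close>
      have "op a (op a (op i x)) = 0" using op_op_same[OF opx[OF ai]] .
      then show ?thesis using 2 ai twist_op_same[of a i x, OF _ xU]
        by (simp add: opa op_add op_scale)
    next
      case 3
      then have ai: "a < i" using that by simp
      \<comment> \<open>Both sides are rewritten with \<open>op a\<close> outermost in their main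
        terms. Comparing them leaves three \<kappa>-terms, one for each pair out of
        \<open>a\<close>, \<open>j\<close>, \<open>i\<close>; each matches separately once
        \<open>t1\<close>, \<open>t2\<close>, \<open>t3\<close> have moved the third letter out of
        its twist.\<close>
      have A: "op i (op j (op a x)) = pm_scale (q a j) (pm_scale (q a i) (op a (op i (op j x))) + twist a i (op j x)) + op i (twist a j x)"
        using 3 ai by (simp add: opa op_add op_scale op_op_greater[OF ai opx])
      have B: "op j (op i (op a x)) = pm_scale (q a i) (pm_scale (q a j) (op a (op j (op i x))) + twist a j (op i x)) + op j (twist a i x)"
        using 3 ai by (simp add: opa op_add op_scale op_op_greater[OF 3 opx])
      have t1: "twist a i (op j x) = pm_scale (q j a * q j i) (op j (twist a i x))"
        using 3 ai that by (intro twist_op_other xU) auto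
      have t2: "twist a j (op i x) = pm_scale (q i a * q i j) (op i (twist a j x))"
        using 3 ai that by (intro twist_op_other xU) auto
      have t3: "twist j i (op a x) = pm_scale (q a j * q a i) (op a (twist j i x))"
        using 3 ai that by (intro twist_op_other xU) auto
      have qs: "q a j * q j a = 1" "q i a * q a i = 1" "q i j * q j i = 1" "q a i * q i a = 1" "q j i * q i j = 1"
        using 3 ai that q_inv by auto
      have c1: "q a j * (q j a * q j i) = q j i" using qs(1) by (simp add: mult.assoc[symmetric])
      have c2: "q j i * (q a i * (q i a * q i j)) = 1"
      proof -
        have "q j i * (q a i * (q i a * q i j)) = (q j i * q i j) * (q a i * q i a)" by (simp only: mult_ac)
        then show ?thesis using qs by simp
      qed
      show ?thesis unfolding A B t1 t2 t3 IH[OF that]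
        by (rule poly_mapping_eqI) (use c1 c2 in \<open>simp add: op_add op_scale lookup_add distrib_left mult.assoc[symmetric]\<close>)
    qed
  qed
  have Q: "op i (op i (op a x)) = 0" for i
  proof -
    consider "i < a" | "i = a" | "a < i" by fastforce
    then show ?thesis
    proof cases
      case 1
      then show ?thesis using op_op_same[OF ya] by simp
    next
      case 2
      then show ?thesis by (simp add: opa)
    next
      case 3
      \<comment> \<open>Moving v_a to the front produces v_i v_i, which is zero on the tail, and two
        twist terms. They are negatives of each other since \<open>- q i a\<close> is the eigenvalue
        at v_i.\<close>
      have "op i (op i (op a x)) = pm_scale (q a i) (twist a i (op i x)) + op i (twist a i x)"
        using 3 by (simp add: opa op_add op_scale op_op_greater[OF 3 opx] IH2)
      also have "twist a i (op i x) = pm_scale (- q i a) (op i (twist a i x))"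
        using 3 by (intro twist_op_same' xU) auto
      finally show ?thesis using q_inv[of a i] 3 by simp
    qed
  qed
  show ?case unfolding y using R Q by blast
qed

text \<open>For \<open>i < j\<close> this is the relation with \<open>i\<close> and \<open>j\<close>
  exchanged, solved for the other product; \<open>\<kappa>_skew\<close> is exactly the compatibility
  that this requires.\<close>

lemma op_op:
  assumes "i \<noteq> j" "keys x \<subseteq> normal_words UNIV"
  shows "op i (op j x) = pm_scale (q j i) (op j (op i x)) + twist j i x"
proof (rule pm_linear_eqI[of _ _ x]; (intro op_linears)?)
  fix y assume "y \<in> keys x"
  then obtain l g where y: "y = (l, g)" "(l, g) \<in> normal_words UNIV" using assms by (cases y) auto
  show "op i (op j (single y 1)) = pm_scale (q j i) (op j (op i (single y 1))) + twist j i (single y 1)"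
  proof (cases "j < i")
    case True
    then show ?thesis using op_relations_single[OF y(2)] by (simp add: y(1))
  next
    case False
    then have "i < j" using assms by simp
    then have "op j (op i (single y 1)) = pm_scale (q i j) (op i (op j (single y 1))) + twist i j (single y 1)"
      using op_relations_single[OF y(2)] by (simp add: y(1))
    moreover have "twist i j z = pm_scale (- q i j) (twist j i z)" for z
      using \<kappa>_skew[OF assms(1)] by (simp add: twist_def pm_scale_sum)
    ultimately show ?thesis using q_inv[of j i] assms(1)
      by (simp only: pm.scale_right_distrib pm.scale_scale) simp
  qed
qed

lemma op_op_eq_0:
  assumes "keys x \<subseteq> normal_words UNIV"
  shows "op i (op i x) = 0"
proof (rule pm_linear_eqI[of "\<lambda>x. op i (op i x)" "\<lambda>_. 0"]; (intro op_linears)?)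
  fix y assume "y \<in> keys x"
  then show "op i (op i (single y 1)) = 0"
    using assms op_relations_single[of "fst y" "snd y"] by (cases y) auto
qed

definition opw :: "'i list \<Rightarrow> ('i list \<times> 'g \<Rightarrow>\<^sub>0 'k) \<Rightarrow> ('i list \<times> 'g \<Rightarrow>\<^sub>0 'k)" where
  "opw w x = foldr op w x"

lemma opw_simps [simp]: "opw [] x = x" "opw (i # w) x = op i (opw w x)"
  by (simp_all add: opw_def)

lemma opw_append: "opw (u @ w) x = opw u (opw w x)"
  by (simp add: opw_def)

lemma linear_opw [simp]: "pm_linear (opw w)"
  by (induction w) (auto simp: opw_def[abs_def] intro!: pm_linear_comp[OF linear_ops(4)])

lemma keys_opw: "keys x \<subseteq> normal_words UNIV \<Longrightarrow> keys (opw w x) \<subseteq> normal_words UNIV"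
  by (induction w) (auto simp: keys_op)

text \<open>The letters of an increasing word are inserted from the right, each below all earlier
  ones, so only the prepending clauses of \<open>ins\<close> are used.\<close>

lemma opw_normal: "(w, g) \<in> normal_words UNIV \<Longrightarrow> opw w (single ([], g) 1) = single (w, g) 1"
proof (induction w)
  case (Cons a w)
  then have "(w, g) \<in> normal_words UNIV" "keys (single (w, g) (1::'k)) \<subseteq> normal_words {a<..}"
    by (auto simp: normal_words_def)
  then show ?case using Cons.IH op_eq_prep[of "single (w, g) 1" a] by simp
qed simp

lemma shift_opw:
  assumes "h \<in> carrier \<Gamma>" "i0 \<noteq> j0" "\<kappa> i0 j0 h \<noteq> 0" "keys x \<subseteq> normal_words UNIV"
  shows "shift h (opw w x) = pm_scale (wt h w) (opw w (shift h x))"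
  using assms by (induction w) (auto simp: shift_op keys_opw op_scale mult_ac)

lemma twist_opw:
  assumes "i \<noteq> j" "g \<in> carrier \<Gamma>"
  shows "twist i j (opw w (single ([], g) 1)) =
    (\<Sum>h\<in>carrier \<Gamma>. pm_scale (\<kappa> i j h * wt h w) (opw w (single ([], h \<otimes> g) 1)))"
proof -
  have "keys (single ([], g) (1::'k)) \<subseteq> normal_words UNIV" using assms by (auto simp: normal_words_def)
  \<comment> \<open>Outside the support \<open>shift_opw\<close> does not apply, as \<open>h\<close>
    need not be diagonal, but there both sides are zero.\<close>
  then have "pm_scale (\<kappa> i j h) (shift h (opw w (single ([], g) 1))) =
      pm_scale (\<kappa> i j h * wt h w) (opw w (single ([], h \<otimes> g) 1))" if "h \<in> carrier \<Gamma>" for h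
    using that assms shift_opw[of h i j "single ([], g) 1" w] by (cases "\<kappa> i j h = 0") auto
  then show ?thesis by (simp add: twist_def)
qed

end

section \<open>The tensor algebra\<close>

abbreviation tensor_mult :: "('i list \<Rightarrow>\<^sub>0 'k::field) \<Rightarrow> ('i list \<Rightarrow>\<^sub>0 'k) \<Rightarrow> ('i list \<Rightarrow>\<^sub>0 'k)" (infixl "\<star>" 70) where
  "p \<star> r \<equiv> p \<otimes>\<^bsub>tensor_alg\<^esub> r"

lemma tensor_alg_simps [simp]:
  "carrier tensor_alg = UNIV" "\<zero>\<^bsub>tensor_alg\<^esub> = 0" "\<one>\<^bsub>tensor_alg\<^esub> = single [] 1"
  "p \<oplus>\<^bsub>tensor_alg\<^esub> r = p + r" "c \<odot>\<^bsub>tensor_alg\<^esub> p = pm_scale c p"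
  by (simp_all add: tensor_alg_def)

lemma tensor_mult_eq_lin: "p \<star> r = lin (\<lambda>u. lin (\<lambda>w. single (u @ w) 1) r) p"
  by (simp add: tensor_alg_def lin_def pm_scale_sum)

lemma pm_linear_mult_left [simp]: "pm_linear (\<lambda>p. p \<star> r)"
  unfolding tensor_mult_eq_lin by (rule pm_linear_lin)

lemma pm_linear_mult_right [simp]: "pm_linear (\<lambda>r. p \<star> r)"
  unfolding tensor_mult_eq_lin by (rule pm_linear_lin_param) simp

lemmas tensor_mult_linears = pm_linear_mult_left pm_linear_mult_right
  pm_linear_comp[OF pm_linear_mult_left] pm_linear_comp[OF pm_linear_mult_right] pm_linear_intros

lemmas tensor_mult_add = pm_linear_add[OF pm_linear_mult_left] pm_linear_add[OF pm_linear_mult_right]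
lemmas tensor_mult_diff = pm_linear_diff[OF pm_linear_mult_left] pm_linear_diff[OF pm_linear_mult_right]
lemmas tensor_mult_scale = pm_linear_scale[OF pm_linear_mult_left] pm_linear_scale[OF pm_linear_mult_right]
lemmas tensor_mult_sum = pm_linear_sum[OF pm_linear_mult_left] pm_linear_sum[OF pm_linear_mult_right]
lemmas tensor_mult_0 [simp] = pm_linear_0[OF pm_linear_mult_left] pm_linear_0[OF pm_linear_mult_right]

lemma tensor_mult_single [simp]: "single u a \<star> single w b = single (u @ w) (a * b)"
  by (simp add: tensor_mult_eq_lin)

lemma tensor_mult_1 [simp]: "single [] 1 \<star> p = p" "p \<star> single [] 1 = p"
  by (rule pm_linear_eqI; (intro tensor_mult_linears)?; simp)+

lemma tensor_mult_assoc: "(p \<star> r) \<star> s = p \<star> (r \<star> s)"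
proof (rule pm_linear_eqI[of "\<lambda>p. (p \<star> r) \<star> s" "\<lambda>p. p \<star> (r \<star> s)" p]; (intro tensor_mult_linears)?)
  fix u
  show "(single u 1 \<star> r) \<star> s = single u 1 \<star> (r \<star> s)"
  proof (rule pm_linear_eqI[of "\<lambda>r. (single u 1 \<star> r) \<star> s" "\<lambda>r. single u 1 \<star> (r \<star> s)" r];
      (intro tensor_mult_linears)?)
    fix w
    show "(single u 1 \<star> single w 1) \<star> s = single u 1 \<star> (single w 1 \<star> s)"
      by (rule pm_linear_eqI[of _ _ s]; (intro tensor_mult_linears)?; simp)
  qed
qed

lemma ring_tensor_alg: "ring (tensor_alg :: ('k::field, 'i list \<Rightarrow>\<^sub>0 'k) module)"
proof (intro ringI abelian_groupI monoidI)
  fix x :: "'i list \<Rightarrow>\<^sub>0 'k"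
  show "\<exists>y\<in>carrier tensor_alg. y \<oplus>\<^bsub>tensor_alg\<^esub> x = \<zero>\<^bsub>tensor_alg\<^esub>"
    by (rule bexI[of _ "- x"]) auto
qed (auto simp: tensor_mult_add tensor_mult_assoc add_ac)

lemma finsum_tensor_alg:
  fixes f :: "'a \<Rightarrow> 'i list \<Rightarrow>\<^sub>0 'k::field"
  shows "finite A \<Longrightarrow> finsum tensor_alg f A = sum f A"
proof (induction A rule: finite_induct)
  case (insert x A)
  interpret ring "tensor_alg :: ('k, 'i list \<Rightarrow>\<^sub>0 'k) module" by (rule ring_tensor_alg)
  show ?case using insert by (simp add: finsum_insert)
next
  case empty
  interpret ring "tensor_alg :: ('k, 'i list \<Rightarrow>\<^sub>0 'k) module" by (rule ring_tensor_alg)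
  show ?case by simp
qed

text \<open>A word receives one contribution for every way of cutting it in two. This makes the
  coefficients of a product in degrees at most two explicit, which is where the exterior algebra is
  inspected.\<close>

lemma lookup_tensor_mult:
  fixes p r :: "'a list \<Rightarrow>\<^sub>0 'b::field"
  shows "lookup (p \<star> r) w = (\<Sum>n\<le>length w. lookup p (take n w) * lookup r (drop n w))"
proof -
  have A: "lookup (single u 1 \<star> single x (1::'b)) w = (\<Sum>n\<le>length w. lookup (single u 1) (take n w) * lookup (single x 1) (drop n w))" for u x
  proof (cases "w = u @ x")
    case True
    have "lookup (single u (1::'b)) (take n w) * lookup (single x (1::'b)) (drop n w) = (if n = length u then 1 else 0)"
      if "n \<le> length w" for n
    proof (cases "n = length u")
      case True
      then show ?thesis using \<open>w = u @ x\<close> by (simp add: lookup_single)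
    next
      case False
      then have "u \<noteq> take n w" using that by auto
      then show ?thesis using False by (simp add: lookup_single_not_eq)
    qed
    then show ?thesis using True by (simp add: lookup_single)
  next
    case False
    then have "lookup (single u (1::'b)) (take n w) * lookup (single x (1::'b)) (drop n w) = 0" for n
      by (auto simp: lookup_single when_def)
    then have "(\<Sum>n\<le>length w. lookup (single u (1::'b)) (take n w) * lookup (single x (1::'b)) (drop n w)) = 0"
      by (intro sum.neutral) blast
    then show ?thesis using False by (simp add: lookup_single_not_eq)
  qed
  have B: "lookup (lin f s) v = (\<Sum>u\<in>keys s. lookup s u * lookup (f u) v)" for v and f :: "'a list \<Rightarrow> 'a list \<Rightarrow>\<^sub>0 'b" and s
    by (simp add: lin_def lookup_sum)
  have C: "lookup s w = (\<Sum>u\<in>keys s. lookup s u * lookup (single u 1) w)" for s :: "'a list \<Rightarrow>\<^sub>0 'b" and w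
    unfolding B[symmetric] by simp
  have "lookup (p \<star> r) w = (\<Sum>u\<in>keys p. lookup p u * (\<Sum>x\<in>keys r. lookup r x * lookup (single u 1 \<star> single x 1) w))"
    by (simp add: tensor_mult_eq_lin B)
  also have "\<dots> = (\<Sum>u\<in>keys p. \<Sum>x\<in>keys r. \<Sum>n\<le>length w. (lookup p u * lookup (single u 1) (take n w)) * (lookup r x * lookup (single x 1) (drop n w)))"
    unfolding A by (simp add: sum_distrib_left mult_ac)
  also have "\<dots> = (\<Sum>n\<le>length w. \<Sum>u\<in>keys p. \<Sum>x\<in>keys r. (lookup p u * lookup (single u 1) (take n w)) * (lookup r x * lookup (single x 1) (drop n w)))"
    by (subst sum.swap[of _ "{..length w}" "keys r"], subst sum.swap[of _ "{..length w}" "keys p"]) (rule refl)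
  also have "\<dots> = (\<Sum>n\<le>length w. lookup p (take n w) * lookup r (drop n w))"
    by (simp add: C[of p "take _ _"] C[of r "drop _ _"] sum_product)
  finally show ?thesis .
qed

lemma lookup_tensor_mult_short:
  "lookup (p \<star> r) [] = lookup p [] * lookup r []"
  "lookup (p \<star> r) [i] = lookup p [] * lookup r [i] + lookup p [i] * lookup r []"
  "lookup (p \<star> r) [i, j] = lookup p [] * lookup r [i, j] + lookup p [i] * lookup r [j] + lookup p [i, j] * lookup r []"
  by (simp_all add: lookup_tensor_mult atMost_Suc add_ac)

section \<open>The quantum exterior algebra\<close>

lemma ideal_qext_ideal: "ideal (qext_ideal q) tensor_alg"
  unfolding qext_ideal_def by (rule ring.genideal_ideal[OF ring_tensor_alg]) simp

text \<open>The three conditions define a set \<open>J\<close> that contains the generators. It is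
  an ideal: a member of \<open>J\<close> has no terms of degree below two, so in degree two a
  product with it sees just the constant term of the other factor. Consequently scalars and
  coefficients of letters can be read off from a class in the exterior algebra, and in degree two
  the coefficients of a member of the ideal are antisymmetric up to \<open>q\<close>.\<close>

lemma qext_ideal_low_degree:
  assumes q: "\<And>i j. i \<noteq> j \<Longrightarrow> q i j * q j i = 1" and p: "p \<in> qext_ideal q"
  shows "lookup p [] = 0" "lookup p [i] = 0" "i \<noteq> j \<Longrightarrow> lookup p [i, j] + q i j * lookup p [j, i] = 0"
proof -
  define D where "D p i j = lookup p [i, j] + q i j * lookup p [j, i]" for p i j
  have D_add: "D (a + b) i j = D a i j + D b i j" and D_neg: "D (- a) i j = - D a i j" and
    D_mult: "lookup a [] = 0 \<Longrightarrow> \<forall>i. lookup a [i] = 0 \<Longrightarrow>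
      D (b \<star> a) i j = lookup b [] * D a i j \<and> D (a \<star> b) i j = D a i j * lookup b []" for a b i j
    by (simp_all add: D_def lookup_add algebra_simps lookup_tensor_mult_short)
  define J where "J = {p. lookup p [] = 0 \<and> (\<forall>i. lookup p [i] = 0) \<and> (\<forall>i j. i \<noteq> j \<longrightarrow> D p i j = 0)}"
  interpret T: ring "tensor_alg :: ('b, 'a list \<Rightarrow>\<^sub>0 'b) module" by (rule ring_tensor_alg)
  have neg: "\<ominus>\<^bsub>tensor_alg\<^esub> x = - x" for x :: "'a list \<Rightarrow>\<^sub>0 'b"
    by (rule T.minus_equality) auto
  have "ideal J tensor_alg"
  proof (rule idealI[OF ring_tensor_alg])
    show "subgroup J (add_monoid tensor_alg)"
    proof (rule T.add.subgroupI)
      have "0 \<in> J" by (simp add: J_def D_def)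
      then show "J \<noteq> {}" by blast
    next
      fix a assume "a \<in> J"
      then show "\<ominus>\<^bsub>tensor_alg\<^esub> a \<in> J" unfolding neg by (simp add: J_def D_neg)
    next
      fix a b assume "a \<in> J" "b \<in> J"
      then show "a \<oplus>\<^bsub>tensor_alg\<^esub> b \<in> J" by (simp add: J_def lookup_add D_add)
    qed simp
  next
    fix a x :: "'a list \<Rightarrow>\<^sub>0 'b" assume "a \<in> J"
    then show "x \<star> a \<in> J" "a \<star> x \<in> J"
      by (simp_all add: J_def D_mult) (simp_all add: lookup_tensor_mult_short)
  qed
  moreover have "{word [j, i] - pm_scale (q i j) (word [i, j]) | i j. i \<noteq> j} \<union> {word [i, i] | i. True} \<subseteq> J"
    using q by (auto simp: J_def D_def word_def lookup_minus lookup_single when_def)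
  ultimately have "qext_ideal q \<subseteq> J"
    unfolding qext_ideal_def by (rule T.genideal_minimal)
  with p have "p \<in> J" by blast
  then show "lookup p [] = 0" "lookup p [i] = 0" "i \<noteq> j \<Longrightarrow> lookup p [i, j] + q i j * lookup p [j, i] = 0"
    by (simp_all add: J_def D_def)
qed

section \<open>Quotients of vector spaces\<close>

text \<open>Only addition and scalars are assumed, so that the quotient of
  \<open>free_tensors\<close>, whose multiplication is a dummy, is treated together with those of
  the tensor algebra and of the skew group algebra.\<close>

locale quotient_space = abelian_subgroup I A for I and A :: "('k, 'a) module" (structure) +
  assumes smult_closed: "x \<in> carrier A \<Longrightarrow> c \<odot> x \<in> carrier A"
    and smult_add: "x \<in> carrier A \<Longrightarrow> y \<in> carrier A \<Longrightarrow> c \<odot> (x \<oplus> y) = c \<odot> x \<oplus> c \<odot> y"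
    and smult_sub: "x \<in> I \<Longrightarrow> c \<odot> x \<in> I"
begin

lemma quot_simps:
  "carrier (quot A I) = a_rcosets I" "\<zero>\<^bsub>quot A I\<^esub> = I"
  "X \<oplus>\<^bsub>quot A I\<^esub> Y = X <+> Y" "X \<otimes>\<^bsub>quot A I\<^esub> Y = [mod I:] X \<Otimes> Y" "\<one>\<^bsub>quot A I\<^esub> = I +> \<one>"
  by (simp_all add: quot_def FactRing_def ring.defs module.defs monoid.defs partial_object.defs)

lemma quot_class_closed: "x \<in> carrier A \<Longrightarrow> I +> x \<in> carrier (quot A I)"
  by (auto simp: quot_simps A_RCOSETS_def')

lemma quot_carrier_cases:
  assumes "X \<in> carrier (quot A I)" obtains x where "x \<in> carrier A" "X = I +> x"
  using assms by (auto simp: quot_simps A_RCOSETS_def')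

lemma quot_add: "x \<in> carrier A \<Longrightarrow> y \<in> carrier A \<Longrightarrow> (I +> x) \<oplus>\<^bsub>quot A I\<^esub> (I +> y) = I +> (x \<oplus> y)"
  by (simp add: quot_simps a_rcos_sum)

lemma quot_eq_iff: "x \<in> carrier A \<Longrightarrow> y \<in> carrier A \<Longrightarrow> I +> x = I +> y \<longleftrightarrow> x \<ominus> y \<in> I"
  by (metis a_minus_def a_repr_independenceD a_repr_independence' a_rcos_module)

lemma quot_smult:
  assumes x: "x \<in> carrier A"
  shows "c \<odot>\<^bsub>quot A I\<^esub> (I +> x) = I +> (c \<odot> x)"
proof -
  \<comment> \<open>Every representative gives the same coset, so the union in the scalar
    multiplication of \<open>quot\<close> collapses to a single coset.\<close>
  have "I +> (c \<odot> y) = I +> (c \<odot> x)" if y: "y \<in> I +> x" for y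
  proof -
    obtain i where i: "i \<in> I" "y = i \<oplus> x" using y by (auto simp: a_r_coset_def')
    have ic: "i \<in> carrier A" using i a_subset by blast
    have "c \<odot> y = c \<odot> i \<oplus> c \<odot> x" using i ic x by (simp add: smult_add)
    then have "c \<odot> y \<in> I +> (c \<odot> x)" using smult_sub[OF i(1)] by (auto simp: a_r_coset_def')
    then show ?thesis using smult_closed[OF x] by (metis a_repr_independence')
  qed
  moreover have "x \<in> I +> x" using a_rcos_self[OF x] .
  moreover have "c \<odot>\<^bsub>quot A I\<^esub> (I +> x) = (\<Union>y\<in>I +> x. I +> (c \<odot> y))"
    by (simp add: quot_def FactRing_def ring.defs module.defs monoid.defs partial_object.defs)
  ultimately show ?thesis by blast
qed

lemma quot_zero: "\<zero>\<^bsub>quot A I\<^esub> = I +> \<zero>"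
  using a_rcos_const[OF additive_subgroup.zero_closed[OF additive_subgroup_axioms]] by (simp add: quot_simps)

lemma quot_abelian_group: "abelian_group (quot A I)"
proof (intro abelian_groupI)
  fix X Y assume "X \<in> carrier (quot A I)" "Y \<in> carrier (quot A I)"
  then obtain x y where "x \<in> carrier A" "X = I +> x" "y \<in> carrier A" "Y = I +> y"
    by (metis quot_carrier_cases)
  then show "X \<oplus>\<^bsub>quot A I\<^esub> Y = Y \<oplus>\<^bsub>quot A I\<^esub> X" "X \<oplus>\<^bsub>quot A I\<^esub> Y \<in> carrier (quot A I)"
    by (simp_all add: quot_add a_comm quot_class_closed)
next
  show "\<zero>\<^bsub>quot A I\<^esub> \<in> carrier (quot A I)"
    unfolding quot_zero by (rule quot_class_closed) simp
next
  fix X Y Z assume "X \<in> carrier (quot A I)" "Y \<in> carrier (quot A I)" "Z \<in> carrier (quot A I)"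
  then obtain x y z where "x \<in> carrier A" "X = I +> x" "y \<in> carrier A" "Y = I +> y" "z \<in> carrier A" "Z = I +> z"
    by (metis quot_carrier_cases)
  then show "X \<oplus>\<^bsub>quot A I\<^esub> Y \<oplus>\<^bsub>quot A I\<^esub> Z = X \<oplus>\<^bsub>quot A I\<^esub> (Y \<oplus>\<^bsub>quot A I\<^esub> Z)"
    by (simp add: quot_add a_assoc)
next
  fix X assume "X \<in> carrier (quot A I)"
  then obtain x where x: "x \<in> carrier A" "X = I +> x" by (metis quot_carrier_cases)
  then show "\<zero>\<^bsub>quot A I\<^esub> \<oplus>\<^bsub>quot A I\<^esub> X = X" by (simp add: quot_zero quot_add)
  show "\<exists>Y\<in>carrier (quot A I). Y \<oplus>\<^bsub>quot A I\<^esub> X = \<zero>\<^bsub>quot A I\<^esub>"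
    by (rule bexI[of _ "I +> \<ominus> x"]) (use x in \<open>simp_all add: quot_zero quot_add quot_class_closed l_neg\<close>)
qed

lemma quot_finsum:
  assumes "finite B" "f \<in> B \<rightarrow> carrier A"
  shows "finsum (quot A I) (\<lambda>b. I +> f b) B = I +> finsum A f B"
proof -
  interpret Q: abelian_group "quot A I" by (rule quot_abelian_group)
  show ?thesis using assms
  proof (induction B rule: finite_induct)
    case empty
    then show ?case by (simp add: quot_zero)
  next
    case (insert b B)
    then show ?case
      by (subst Q.finsum_insert) (auto simp: Pi_iff quot_class_closed quot_add)
  qed
qed

end

section \<open>The action on the tensor algebra and the skew group algebra\<close>

locale linear_group_data = V: vector_space scale
  for scale :: "'k::field \<Rightarrow> 'v::ab_group_add \<Rightarrow> 'v" +
  fixes v :: "'i::{finite,linorder} \<Rightarrow> 'v" and G :: "('v \<Rightarrow> 'v) set"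
  assumes basis: "basis_family scale v"
    and subgroup_G: "subgroup G (GL scale)"
    and finite_G: "finite G"
begin

abbreviation "\<Gamma> \<equiv> linear_group scale G"
abbreviation "vec \<equiv> vec_in_tensor_alg scale v"
abbreviation "crd \<equiv> coord scale v"
abbreviation "tact \<equiv> tensor_alg_act scale v"

lemma carrier_\<Gamma> [simp]: "carrier \<Gamma> = G"
  and mult_\<Gamma> [simp]: "g \<otimes>\<^bsub>\<Gamma>\<^esub> h = g \<circ> h"
  and one_\<Gamma> [simp]: "\<one>\<^bsub>\<Gamma>\<^esub> = id"
  by (simp_all add: linear_group_def GL_def)

lemma group_GL: "group (GL scale)"
proof (rule groupI)
  fix f assume "f \<in> carrier (GL scale)"
  then have f: "Vector_Spaces.linear scale scale f" "bij f" by (auto simp: GL_def)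
  define g where "g = inv_into UNIV f"
  have "g (x + y) = g x + g y" "g (scale c x) = scale c (g x)" for x y c
    using f by (simp_all add: g_def bij_is_inj bij_is_surj surj_f_inv_f inv_f_eq Vector_Spaces.linear_iff)
  then have "g \<in> carrier (GL scale)"
    using f by (simp add: GL_def Vector_Spaces.linear_iff V.vector_space_axioms g_def bij_imp_bij_inv)
  moreover have "g \<otimes>\<^bsub>GL scale\<^esub> f = \<one>\<^bsub>GL scale\<^esub>"
    using f by (simp add: GL_def g_def bij_is_inj)
  ultimately show "\<exists>g\<in>carrier (GL scale). g \<otimes>\<^bsub>GL scale\<^esub> f = \<one>\<^bsub>GL scale\<^esub>" by blast
qed (auto simp: GL_def Vector_Spaces.linear_iff V.vector_space_axioms bij_comp o_assoc)

lemma group_\<Gamma>: "group \<Gamma>"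
  unfolding linear_group_def by (rule subgroup.subgroup_is_group[OF subgroup_G group_GL])

sublocale \<Gamma>: group \<Gamma> by (rule group_\<Gamma>)

lemma G_linear: "g \<in> G \<Longrightarrow> Vector_Spaces.linear scale scale g"
  using subgroup.subset[OF subgroup_G] by (auto simp: GL_def)

lemma G_add: "g \<in> G \<Longrightarrow> g (x + y) = g x + g y"
  and G_scale: "g \<in> G \<Longrightarrow> g (scale c x) = scale c (g x)"
  using G_linear[of g] by (auto simp: Vector_Spaces.linear_iff)

lemma G_comp [simp]: "g \<in> G \<Longrightarrow> h \<in> G \<Longrightarrow> g \<circ> h \<in> G"
  and G_id [simp]: "id \<in> G"
  and G_inv [simp]: "g \<in> G \<Longrightarrow> inv\<^bsub>\<Gamma>\<^esub> g \<in> G"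
  and G_inv_comp [simp]: "g \<in> G \<Longrightarrow> g \<circ> inv\<^bsub>\<Gamma>\<^esub> g = id" "g \<in> G \<Longrightarrow> inv\<^bsub>\<Gamma>\<^esub> g \<circ> g = id"
  and G_inv_inv [simp]: "g \<in> G \<Longrightarrow> inv\<^bsub>\<Gamma>\<^esub> (inv\<^bsub>\<Gamma>\<^esub> g) = g"
  using \<Gamma>.m_closed[of g h] \<Gamma>.one_closed \<Gamma>.inv_closed[of g] \<Gamma>.r_inv[of g] \<Gamma>.l_inv[of g] \<Gamma>.inv_inv[of g] by simp_all

lemma G_inv_comp_assoc [simp]:
  "g \<in> G \<Longrightarrow> g \<circ> (inv\<^bsub>\<Gamma>\<^esub> g \<circ> h) = h" "g \<in> G \<Longrightarrow> inv\<^bsub>\<Gamma>\<^esub> g \<circ> (g \<circ> h) = h"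
  by (simp_all add: o_assoc)

lemma inj_v: "inj v" and independent_v: "\<not> V.dependent (range v)" and span_v: "V.span (range v) = UNIV"
  using basis by (simp_all add: basis_family_def)

lemma coord_v: "crd (v i) j = (if i = j then 1 else 0)"
  by (simp add: coord_def V.representation_basis[OF independent_v] inj_eq[OF inj_v])

lemma coord_add: "crd (x + y) j = crd x j + crd y j"
  unfolding coord_def by (rule fun_cong[OF V.representation_add[OF independent_v]]) (simp_all add: span_v)

lemma coord_scale: "crd (scale c x) j = c * crd x j"
  unfolding coord_def by (rule fun_cong[OF V.representation_scale[OF independent_v]]) (simp_all add: span_v)

lemma coord_expand: "x = (\<Sum>i\<in>UNIV. scale (crd x i) (v i))"
proof -
  have "(\<Sum>b\<in>range v. scale (V.representation (range v) x b) b) = x"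
    using V.sum_representation_eq[OF independent_v, of x "range v"] by (simp add: span_v)
  then show ?thesis by (simp add: coord_def sum.reindex[OF inj_v])
qed

lemma vec_add: "vec (x + y) = vec x + vec y"
  by (simp add: vec_in_tensor_alg_def coord_add pm.scale_left_distrib sum.distrib)

lemma vec_scale: "vec (scale c x) = pm_scale c (vec x)"
  by (simp add: vec_in_tensor_alg_def coord_scale pm_scale_sum)

lemma vec_v [simp]: "vec (v i) = single [i] 1"
proof -
  have "vec (v i) = (\<Sum>j\<in>UNIV. if j = i then single [i] 1 else 0)"
    unfolding vec_in_tensor_alg_def by (rule sum.cong) (auto simp: coord_v word_def)
  then show ?thesis by simp
qed

lemma vec_0: "vec 0 = 0"
  using vec_scale[of 0 0] by simp

lemma vec_sum: "vec (\<Sum>i\<in>A. f i) = (\<Sum>i\<in>A. vec (f i))"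
  by (induction A rule: infinite_finite_induct) (auto simp: vec_0 vec_add)

lemma vec_expand: "vec x = (\<Sum>i\<in>UNIV. pm_scale (crd x i) (single [i] 1))"
  by (simp add: vec_in_tensor_alg_def word_def)

lemma tact_eq_lin: "tact g = lin (\<lambda>w. foldr (\<lambda>i r. vec (g (v i)) \<star> r) w (single [] 1))"
  by (rule ext) (simp add: tensor_alg_act_def lin_def)

lemma linear_tact [simp]: "pm_linear (tact g)"
  unfolding tact_eq_lin by simp

lemmas tact_add = pm_linear_add[OF linear_tact]
lemmas tact_diff = pm_linear_diff[OF linear_tact]
lemmas tact_scale = pm_linear_scale[OF linear_tact]
lemmas tact_sum = pm_linear_sum[OF linear_tact]
lemmas tact_0 [simp] = pm_linear_0[OF linear_tact]
lemmas tact_linears = linear_tact pm_linear_comp[OF linear_tact] tensor_mult_linears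

lemma tact_Nil [simp]: "tact g (single [] c) = single [] c"
  and tact_Cons: "tact g (single (i # w) 1) = vec (g (v i)) \<star> tact g (single w 1)"
  by (simp_all add: tact_eq_lin)

lemma tact_letter [simp]: "tact g (single [i] 1) = vec (g (v i))"
  by (simp add: tact_Cons)

lemma tact_mult: "tact g (p \<star> r) = tact g p \<star> tact g r"
proof (rule pm_linear_eqI[of "\<lambda>p. tact g (p \<star> r)" "\<lambda>p. tact g p \<star> tact g r" p]; (intro tact_linears)?)
  fix u
  show "tact g (single u 1 \<star> r) = tact g (single u 1) \<star> tact g r"
  proof (rule pm_linear_eqI[of "\<lambda>r. tact g (single u 1 \<star> r)" "\<lambda>r. tact g (single u 1) \<star> tact g r" r]; (intro tact_linears)?)
    fix w
    show "tact g (single u 1 \<star> single w 1) = tact g (single u 1) \<star> tact g (single w 1)"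
      by (induction u) (simp_all add: tact_Cons tensor_mult_assoc)
  qed
qed

lemma tact_vec: "g \<in> G \<Longrightarrow> tact g (vec x) = vec (g x)"
proof -
  assume g: "g \<in> G"
  have lin0: "g 0 = 0" using G_scale[OF g, of 0 0] by simp
  have "g (\<Sum>i\<in>A. f i) = (\<Sum>i\<in>A. g (f i))" for A and f :: "'i \<Rightarrow> 'v"
    by (induction A rule: infinite_finite_induct) (auto simp: lin0 G_add[OF g])
  then have "g x = (\<Sum>i\<in>UNIV. scale (crd x i) (g (v i)))"
    by (subst coord_expand[of x]) (simp add: G_scale[OF g])
  then show ?thesis by (simp add: vec_expand[of x] tact_sum tact_scale vec_sum vec_scale del: pm_scale_single)
qed

lemma tact_comp:
  assumes "g \<in> G" "h \<in> G"
  shows "tact (g \<circ> h) p = tact g (tact h p)"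
proof (rule pm_linear_eqI[of _ "\<lambda>p. tact g (tact h p)"]; (intro tact_linears)?)
  fix w
  show "tact (g \<circ> h) (single w 1) = tact g (tact h (single w 1))"
    by (induction w) (simp_all add: tact_Cons tact_mult tact_vec assms)
qed

lemma tact_id [simp]: "tact id p = p"
proof (rule pm_linear_eqI[of _ "\<lambda>p. p"]; (intro tact_linears)?)
  fix w
  show "tact id (single w 1) = single w 1" by (induction w) (simp_all add: tact_Cons)
qed

abbreviation "S \<equiv> tensor_skew scale v G"

lemma S_simps [simp]:
  "carrier S = G \<rightarrow>\<^sub>E UNIV" "\<zero>\<^bsub>S\<^esub> = (\<lambda>g\<in>G. 0)" "x \<oplus>\<^bsub>S\<^esub> y = (\<lambda>g\<in>G. x g + y g)"
  "c \<odot>\<^bsub>S\<^esub> x = (\<lambda>g\<in>G. pm_scale c (x g))"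
  "\<one>\<^bsub>S\<^esub> = (\<lambda>g\<in>G. if g = id then single [] 1 else 0)"
  by (simp_all add: tensor_skew_def skew_def cong: if_cong)

lemma S_mult: "x \<otimes>\<^bsub>S\<^esub> y = (\<lambda>g\<in>G. \<Sum>h\<in>G. x h \<star> tact h (y (inv\<^bsub>\<Gamma>\<^esub> h \<circ> g)))"
  by (simp add: tensor_skew_def skew_def finsum_tensor_alg[OF finite_G])

lemma sum_G_left: "h \<in> G \<Longrightarrow> (\<Sum>g\<in>G. f (h \<circ> g)) = (\<Sum>g\<in>G. f g)"
  by (rule sum.reindex_bij_witness[of _ "\<lambda>g. inv\<^bsub>\<Gamma>\<^esub> h \<circ> g" "\<lambda>g. h \<circ> g"]) auto

lemma S_mult_assoc:
  assumes "x \<in> carrier S" "y \<in> carrier S" "z \<in> carrier S"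
  shows "(x \<otimes>\<^bsub>S\<^esub> y) \<otimes>\<^bsub>S\<^esub> z = x \<otimes>\<^bsub>S\<^esub> (y \<otimes>\<^bsub>S\<^esub> z)"
proof
  fix g
  show "((x \<otimes>\<^bsub>S\<^esub> y) \<otimes>\<^bsub>S\<^esub> z) g = (x \<otimes>\<^bsub>S\<^esub> (y \<otimes>\<^bsub>S\<^esub> z)) g"
  proof (cases "g \<in> G")
    case g: True
    have "((x \<otimes>\<^bsub>S\<^esub> y) \<otimes>\<^bsub>S\<^esub> z) g =
        (\<Sum>h\<in>G. \<Sum>k\<in>G. x k \<star> (tact k (y (inv\<^bsub>\<Gamma>\<^esub> k \<circ> h)) \<star> tact h (z (inv\<^bsub>\<Gamma>\<^esub> h \<circ> g))))"
      using g by (simp add: S_mult tensor_mult_sum tensor_mult_assoc)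
    also have "\<dots> = (\<Sum>k\<in>G. \<Sum>h\<in>G. x k \<star> (tact k (y (inv\<^bsub>\<Gamma>\<^esub> k \<circ> h)) \<star> tact h (z (inv\<^bsub>\<Gamma>\<^esub> h \<circ> g))))"
      by (rule sum.swap)
    \<comment> \<open>The substitution h = k l separates the group elements belonging to
      \<open>y\<close> and \<open>z\<close>. It makes \<open>tact (k \<circ> l)\<close> appear,
      which the action law splits.\<close>
    also have "\<dots> = (\<Sum>k\<in>G. \<Sum>l\<in>G. x k \<star> (tact k (y l) \<star> tact (k \<circ> l) (z (inv\<^bsub>\<Gamma>\<^esub> l \<circ> (inv\<^bsub>\<Gamma>\<^esub> k \<circ> g)))))"
    proof (rule sum.cong[OF refl])
      fix k assume k: "k \<in> G"
      have iv: "inv\<^bsub>\<Gamma>\<^esub> (k \<circ> l) \<circ> g = inv\<^bsub>\<Gamma>\<^esub> l \<circ> (inv\<^bsub>\<Gamma>\<^esub> k \<circ> g)" if "l \<in> G" for l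
        using \<Gamma>.inv_mult_group[of k l] k that by (simp add: o_assoc)
      show "(\<Sum>h\<in>G. x k \<star> (tact k (y (inv\<^bsub>\<Gamma>\<^esub> k \<circ> h)) \<star> tact h (z (inv\<^bsub>\<Gamma>\<^esub> h \<circ> g)))) =
        (\<Sum>l\<in>G. x k \<star> (tact k (y l) \<star> tact (k \<circ> l) (z (inv\<^bsub>\<Gamma>\<^esub> l \<circ> (inv\<^bsub>\<Gamma>\<^esub> k \<circ> g)))))"
        by (subst sum_G_left[OF k, symmetric]) (simp add: k iv)
    qed
    also have "\<dots> = (x \<otimes>\<^bsub>S\<^esub> (y \<otimes>\<^bsub>S\<^esub> z)) g"
      using g by (simp add: S_mult tact_sum tact_mult tensor_mult_sum tact_comp)
    finally show ?thesis .
  qed (simp add: S_mult)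
qed

lemma S_ext: "x \<in> carrier S \<Longrightarrow> y \<in> carrier S \<Longrightarrow> (\<And>g. g \<in> G \<Longrightarrow> x g = y g) \<Longrightarrow> x = y"
  by (auto intro: PiE_ext)

lemma ring_S: "ring S"
proof (intro ringI abelian_groupI monoidI)
  fix x assume x: "x \<in> carrier S"
  show "\<exists>y\<in>carrier S. y \<oplus>\<^bsub>S\<^esub> x = \<zero>\<^bsub>S\<^esub>"
    by (rule bexI[of _ "\<lambda>g\<in>G. - x g"]) (auto intro!: restrict_ext)
  have if1: "(if P then single [] 1 else 0) \<star> p = (if P then p else 0)" for P and p :: "'i list \<Rightarrow>\<^sub>0 'k"
    by simp
  have if2: "p \<star> tact h (if P then single [] 1 else 0) = (if P then p else 0)" for P h p
    by simp
  have eq: "inv\<^bsub>\<Gamma>\<^esub> h \<circ> g = id \<longleftrightarrow> h = g" if "g \<in> G" "h \<in> G" for g h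
    by (metis that G_inv_comp(2) G_inv_comp_assoc(1) comp_id)
  show "\<one>\<^bsub>S\<^esub> \<otimes>\<^bsub>S\<^esub> x = x" "x \<otimes>\<^bsub>S\<^esub> \<one>\<^bsub>S\<^esub> = x"
    using x by (auto intro!: S_ext simp: S_mult if1 if2 eq finite_G \<Gamma>.inv_one[simplified] cong: sum.cong if_cong)
next
  fix x y z assume "x \<in> carrier S" "y \<in> carrier S" "z \<in> carrier S"
  then show "(x \<otimes>\<^bsub>S\<^esub> y) \<otimes>\<^bsub>S\<^esub> z = x \<otimes>\<^bsub>S\<^esub> (y \<otimes>\<^bsub>S\<^esub> z)" by (rule S_mult_assoc)
qed (auto simp: add_ac S_mult tensor_mult_add tact_add sum.distrib restrict_def extensional_def fun_eq_iff PiE_def)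

definition welt :: "('i list \<Rightarrow>\<^sub>0 'k) \<Rightarrow> ('v \<Rightarrow> 'v) \<Rightarrow> ('v \<Rightarrow> 'v) \<Rightarrow> ('i list \<Rightarrow>\<^sub>0 'k)" where
  "welt p g = (\<lambda>h\<in>G. if h = g then p else 0)"

lemma welt_skew_elt: "skew_elt tensor_alg \<Gamma> p g = welt p g"
  by (simp add: skew_elt_def welt_def cong: if_cong)

lemma welt_closed [simp]: "welt p g \<in> G \<rightarrow>\<^sub>E UNIV"
  by (simp add: welt_def)

lemma welt_smult: "c \<odot>\<^bsub>S\<^esub> welt p g = welt (pm_scale c p) g"
  by (auto simp: welt_def fun_eq_iff)

lemma welt_mult:
  assumes "g \<in> G" "h \<in> G"
  shows "welt p g \<otimes>\<^bsub>S\<^esub> welt r h = welt (p \<star> tact g r) (g \<circ> h)"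
proof (rule S_ext)
  fix k assume k: "k \<in> G"
  have eq: "inv\<^bsub>\<Gamma>\<^esub> g \<circ> k = h \<longleftrightarrow> k = g \<circ> h"
    using assms k by (metis G_inv_comp_assoc)
  have "(welt p g \<otimes>\<^bsub>S\<^esub> welt r h) k = (\<Sum>l\<in>G. if l = g then p \<star> tact g (welt r h (inv\<^bsub>\<Gamma>\<^esub> g \<circ> k)) else 0)"
    using k by (auto simp: S_mult welt_def intro!: sum.cong)
  also have "\<dots> = welt (p \<star> tact g r) (g \<circ> h) k"
    using assms k by (simp add: finite_G welt_def eq)
  finally show "(welt p g \<otimes>\<^bsub>S\<^esub> welt r h) k = welt (p \<star> tact g r) (g \<circ> h) k" .
qed (simp_all add: S_mult)

lemma S_finsum:
  assumes "finite B" "\<And>b. b \<in> B \<Longrightarrow> f b \<in> carrier S"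
  shows "finsum S f B = (\<lambda>g\<in>G. \<Sum>b\<in>B. f b g)"
proof -
  interpret S: ring S by (rule ring_S)
  show ?thesis using assms
  proof (induction B rule: finite_induct)
    case (insert b B)
    have "finsum S f (insert b B) = f b \<oplus>\<^bsub>S\<^esub> finsum S f B"
      using insert by (intro S.finsum_insert) auto
    then show ?case using insert by (auto simp: fun_eq_iff)
  qed simp
qed

lemma S_expand:
  assumes "x \<in> carrier S"
  shows "x = finsum S (\<lambda>g. welt (x g) g) G"
proof (rule S_ext)
  fix g assume g: "g \<in> G"
  have "(\<Sum>b\<in>G. welt (x b) b g) = (\<Sum>b\<in>G. if b = g then x g else 0)"
    using g by (intro sum.cong) (auto simp: welt_def)
  then show "x g = finsum S (\<lambda>g. welt (x g) g) G g"
    using g by (simp add: S_finsum finite_G)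
qed (use assms in \<open>simp_all add: S_finsum finite_G\<close>)

end

section \<open>The PBW theorem\<close>

text \<open>The Koszul form of the quantum relation: for \<open>i \<le> j\<close> it is the element
  f_\<beta> with \<beta> = [i] + [j]. In the Hecke algebra \<open>qrel q i j\<close> becomes
  \<kappa>(v_j, v_i), and for \<open>i \<noteq> j\<close> the quadratic part of the generator that
  starts with v_j v_i is \<open>- q i j\<close> times it.\<close>

definition qrel :: "('i \<Rightarrow> 'i \<Rightarrow> 'k::field) \<Rightarrow> 'i \<Rightarrow> 'i \<Rightarrow> ('i list \<Rightarrow>\<^sub>0 'k)" where
  "qrel q i j = single [i, j] 1 - (if i = j then 0 else single [j, i] (q j i))"

text \<open>What the cocycle contributes to the PBW theorem. \<open>tact_qrel\<close> says that G
  preserves the span of the relations with \<open>a \<le> b\<close>, and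
  \<open>\<kappa>_invariant\<close> that the linear map from this span to KG sending
  \<open>qrel q a b\<close> to \<kappa>(v_b, v_a) is equivariant for conjugation, read off at the
  coefficient of \<open>g\<close>. The coefficient along \<open>qrel q a b\<close> is that of the
  word \<open>[a, b]\<close>, which occurs in no other \<open>qrel\<close> with ordered
  indices.\<close>

locale hecke_data = linear_group_data scale v G
  for scale :: "'k::field \<Rightarrow> 'v::ab_group_add \<Rightarrow> 'v" and v :: "'i::{finite,linorder} \<Rightarrow> 'v" and G +
  fixes q :: "'i \<Rightarrow> 'i \<Rightarrow> 'k" and \<kappa> :: "'v \<Rightarrow> 'v \<Rightarrow> ('v \<Rightarrow> 'v) \<Rightarrow> 'k"
  assumes q_inv: "i \<noteq> j \<Longrightarrow> q i j * q j i = 1"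
    and \<kappa>_skew: "i \<noteq> j \<Longrightarrow> g \<in> G \<Longrightarrow> \<kappa> (v i) (v j) g = - q i j * \<kappa> (v j) (v i) g"
    and \<kappa>_diag: "g \<in> G \<Longrightarrow> \<kappa> (v i) (v i) g = 0"
    and eigen_pair: "i \<noteq> j \<Longrightarrow> g \<in> G \<Longrightarrow> \<kappa> (v i) (v j) g \<noteq> 0 \<Longrightarrow> g (v i) = scale (- q i j) (v i)"
    and eigen_other: "i \<noteq> j \<Longrightarrow> k \<noteq> i \<Longrightarrow> k \<noteq> j \<Longrightarrow> g \<in> G \<Longrightarrow> \<kappa> (v i) (v j) g \<noteq> 0 \<Longrightarrow>
      g (v k) = scale (q k i * q k j) (v k)"
    and tact_qrel: "h \<in> G \<Longrightarrow> i \<le> j \<Longrightarrow> tact h (qrel q i j) =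
      (\<Sum>(a, b) | a \<le> b. pm_scale (lookup (tact h (qrel q i j)) [a, b]) (qrel q a b))"
    and \<kappa>_invariant: "h \<in> G \<Longrightarrow> i \<le> j \<Longrightarrow> g \<in> G \<Longrightarrow>
      (\<Sum>(a, b) | a \<le> b. lookup (tact h (qrel q i j)) [a, b] * \<kappa> (v b) (v a) g)
        = \<kappa> (v j) (v i) (inv\<^bsub>\<Gamma>\<^esub> h \<circ> g \<circ> h)"
begin

abbreviation \<chi> :: "('v \<Rightarrow> 'v) \<Rightarrow> 'i \<Rightarrow> 'k" where "\<chi> g i \<equiv> crd (g (v i)) i"

lemma eigen:
  assumes "i \<noteq> j" "g \<in> G" "\<kappa> (v i) (v j) g \<noteq> 0"
  shows "g (v k) = scale (\<chi> g k) (v k)"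
proof -
  have "\<kappa> (v j) (v i) g \<noteq> 0" using \<kappa>_skew[of i j g] assms by auto
  then have "\<exists>c. g (v k) = scale c (v k)"
    using eigen_pair[of i j g] eigen_pair[of j i g] eigen_other[of i j k g] assms by metis
  then show ?thesis by (auto simp: coord_scale coord_v)
qed

lemma eigen_commute:
  assumes "\<And>k. g (v k) = scale (a k) (v k)" "\<And>k. h (v k) = scale (b k) (v k)" "g \<in> G" "h \<in> G"
  shows "g \<circ> h = h \<circ> g"
proof
  have G_sum: "f (\<Sum>i\<in>A. u i) = (\<Sum>i\<in>A. f (u i))" if "f \<in> G" for f A and u :: "'i \<Rightarrow> 'v"
    using G_scale[OF that, of 0 0] by (induction A rule: infinite_finite_induct) (auto simp: G_add[OF that])
  fix x
  show "(g \<circ> h) x = (h \<circ> g) x"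
    by (subst (1 2) coord_expand[of x]) (simp add: G_sum assms G_scale mult_ac)
qed

lemma tact_qrel_eigen:
  assumes "g \<in> G" "\<And>k. g (v k) = scale (a k) (v k)"
  shows "tact g (qrel q i j) = pm_scale (a i * a j) (qrel q i j)"
proof -
  have "tact g (single [i, j] 1) = single [i, j] (a i * a j)" for i j
    by (simp add: tact_Cons assms vec_scale)
  moreover have "tact g (single [j, i] (q j i)) = pm_scale (q j i) (tact g (single [j, i] 1))"
    using tact_scale[of g "q j i" "single [j, i] 1"] by simp
  ultimately show ?thesis
    by (simp add: qrel_def tact_diff pm.scale_right_diff_distrib mult_ac)
qed

text \<open>Invariance is applied to the element \<open>g\<close> of a support. It multiplies
  \<open>qrel q a b\<close> by \<open>\<chi> g a * \<chi> g b\<close>, so one side is this factor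
  times the value of \<kappa>(v_b, v_a) at \<open>h\<close>. The other side is the value at the
  conjugate of \<open>h\<close> by \<open>g\<close>, which is \<open>h\<close> because both are
  diagonal.\<close>

lemma eigen_inv:
  assumes "i \<noteq> j" "a \<noteq> b" "g \<in> G" "h \<in> G" "\<kappa> (v i) (v j) g \<noteq> 0" "\<kappa> (v a) (v b) h \<noteq> 0"
  shows "\<chi> g a * \<chi> g b = 1"
proof -
  have *: "\<chi> g a * \<chi> g b = 1" if "a < b" "\<kappa> (v b) (v a) h \<noteq> 0" for a b
  proof -
    have F: "tact g (qrel q a b) = pm_scale (\<chi> g a * \<chi> g b) (qrel q a b)"
      by (rule tact_qrel_eigen[OF assms(3)]) (rule eigen[OF assms(1,3,5)])
    \<comment> \<open>Of all ordered pairs only the given one contributes, as \<open>g\<close> maps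
      the relation to a multiple of itself.\<close>
    have "(\<Sum>(a', b') | a' \<le> b'. lookup (tact g (qrel q a b)) [a', b'] * \<kappa> (v b') (v a') h) =
      (\<Sum>x | case x of (a, b) \<Rightarrow> a \<le> b. if x = (a, b) then \<chi> g a * \<chi> g b * \<kappa> (v b) (v a) h else 0)"
    proof (rule sum.cong[OF refl])
      fix x :: "'i \<times> 'i" assume "x \<in> {x. case x of (a, b) \<Rightarrow> a \<le> b}"
      then show "(case x of (a', b') \<Rightarrow> lookup (tact g (qrel q a b)) [a', b'] * \<kappa> (v b') (v a') h) =
        (if x = (a, b) then \<chi> g a * \<chi> g b * \<kappa> (v b) (v a) h else 0)"
        using that(1) unfolding F by (auto simp: qrel_def lookup_minus lookup_single when_def split: if_splits)
    qed
    also have "\<dots> = \<chi> g a * \<chi> g b * \<kappa> (v b) (v a) h" using that by (simp add: less_imp_le)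
    finally have "\<chi> g a * \<chi> g b * \<kappa> (v b) (v a) h = \<kappa> (v b) (v a) (inv\<^bsub>\<Gamma>\<^esub> g \<circ> h \<circ> g)"
      using \<kappa>_invariant[OF assms(3) less_imp_le[OF that(1)] assms(4)] by simp
    moreover have "h \<circ> g = g \<circ> h"
      by (rule eigen_commute[OF eigen[OF _ assms(4)] eigen[OF assms(1,3,5)] assms(4,3)])
         (use that in auto)
    ultimately show ?thesis using that assms by (simp add: comp_assoc)
  qed
  have "\<kappa> (v b) (v a) h \<noteq> 0" using \<kappa>_skew[of a b h] assms by auto
  then show ?thesis
    using *[of a b] *[of b a] assms by (cases "a < b") (auto simp: mult.commute)
qed

lemma pbw_data: "pbw_data \<Gamma> q (\<lambda>i j. \<kappa> (v i) (v j)) \<chi>"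
proof unfold_locales
  fix i j g assume "i \<noteq> j" "g \<in> carrier \<Gamma>" "\<kappa> (v i) (v j) g \<noteq> 0"
  then show "\<chi> g i = - q i j" using eigen_pair[of i j g] by (simp add: coord_scale coord_v del: V.scale_minus_left)
next
  fix i j k g assume "i \<noteq> j" "k \<noteq> i" "k \<noteq> j" "g \<in> carrier \<Gamma>" "\<kappa> (v i) (v j) g \<noteq> 0"
  then show "\<chi> g k = q k i * q k j" using eigen_other[of i j k g] by (simp add: coord_scale coord_v)
next
  fix i j a b g h
  assume "i \<noteq> j" "a \<noteq> b" "g \<in> carrier \<Gamma>" "h \<in> carrier \<Gamma>" "\<kappa> (v i) (v j) g \<noteq> 0" "\<kappa> (v a) (v b) h \<noteq> 0"
  then have *: "i \<noteq> j" "a \<noteq> b" "g \<in> G" "h \<in> G" "\<kappa> (v i) (v j) g \<noteq> 0" "\<kappa> (v a) (v b) h \<noteq> 0"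
    by simp_all
  show "g \<otimes>\<^bsub>\<Gamma>\<^esub> h = h \<otimes>\<^bsub>\<Gamma>\<^esub> g" unfolding mult_\<Gamma>
    by (rule eigen_commute[of g "\<chi> g" h "\<chi> h"]) (use eigen *  in \<open>blast+\<close>)
  show "\<chi> g a * \<chi> g b = 1" by (rule eigen_inv[OF *])
next
  fix i j :: 'i and g assume "i \<noteq> j" "g \<in> carrier \<Gamma>"
  then show "\<kappa> (v i) (v j) g = - q i j * \<kappa> (v j) (v i) g" by (intro \<kappa>_skew) simp_all
qed (simp_all add: finite_G q_inv)

sublocale PBW: pbw_data \<Gamma> q "\<lambda>i j. \<kappa> (v i) (v j)" \<chi>
  by (rule pbw_data)

section \<open>Tensors acting on normal forms, and the normal form map on the ideal\<close>

abbreviation vac :: "('v \<Rightarrow> 'v) \<Rightarrow> ('i list \<times> ('v \<Rightarrow> 'v) \<Rightarrow>\<^sub>0 'k)" where "vac g \<equiv> single ([], g) 1"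

definition opT :: "('i list \<Rightarrow>\<^sub>0 'k) \<Rightarrow> ('i list \<times> ('v \<Rightarrow> 'v) \<Rightarrow>\<^sub>0 'k) \<Rightarrow> ('i list \<times> ('v \<Rightarrow> 'v) \<Rightarrow>\<^sub>0 'k)" where
  "opT p x = lin (\<lambda>w. PBW.opw w x) p"

lemma linear_opT [simp]: "pm_linear (opT p)" "pm_linear (\<lambda>p. opT p x)"
  unfolding opT_def[abs_def] by (intro pm_linear_lin_param PBW.linear_opw) simp

lemmas opT_sum = pm_linear_sum[OF linear_opT(1)] pm_linear_sum[OF linear_opT(2)]
lemmas opT_scale = pm_linear_scale[OF linear_opT(1)] pm_linear_scale[OF linear_opT(2)]
lemmas opT_add = pm_linear_add[OF linear_opT(1)] pm_linear_add[OF linear_opT(2)]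
lemmas opT_diff = pm_linear_diff[OF linear_opT(1)] pm_linear_diff[OF linear_opT(2)]
lemmas opT_0 [simp] = pm_linear_0[OF linear_opT(1)] pm_linear_0[OF linear_opT(2)]

lemma opT_single [simp]: "opT (single w c) x = pm_scale c (PBW.opw w x)"
  by (simp add: opT_def)

lemma opT_mult: "opT (p \<star> r) x = opT p (opT r x)"
proof (rule pm_linear_eqI[of "\<lambda>p. opT (p \<star> r) x" "\<lambda>p. opT p (opT r x)" p];
    (intro linear_opT pm_linear_comp[OF linear_opT(2)] tensor_mult_linears)?)
  fix u
  show "opT (single u 1 \<star> r) x = opT (single u 1) (opT r x)"
    by (rule pm_linear_eqI[of "\<lambda>r. opT (single u 1 \<star> r) x" "\<lambda>r. opT (single u 1) (opT r x)" r];
        (intro linear_opT pm_linear_comp[OF linear_opT(1)] pm_linear_comp[OF linear_opT(2)] tensor_mult_linears)?;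
        simp add: PBW.opw_append)
qed

lemma keys_opT_vac: "g \<in> G \<Longrightarrow> keys (opT p (vac g)) \<subseteq> PBW.normal_words UNIV"
  unfolding opT_def by (intro keys_lin_subset PBW.keys_opw) (simp add: PBW.normal_words_def)

lemma tact_word_eigen:
  assumes "\<And>k. g (v k) = scale (\<chi> g k) (v k)"
  shows "tact g (single w 1) = single w (PBW.wt g w)"
  using arg_cong[OF assms, of vec] by (induction w) (simp_all add: tact_Cons vec_scale)

lemma \<kappa>_tact_word:
  assumes "i \<noteq> j" "g \<in> G"
  shows "pm_scale (\<kappa> (v i) (v j) g) (tact g (single w 1)) = single w (\<kappa> (v i) (v j) g * PBW.wt g w)"
proof (cases "\<kappa> (v i) (v j) g = 0")
  case False
  show ?thesis by (subst tact_word_eigen) (use eigen[OF assms False] in simp_all)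
qed simp

text \<open>The relation acts as left multiplication by \<kappa>(v_b, v_a). The vector is written as
  \<open>opT p (vac g)\<close> and \<open>l\<close> is made to act on \<open>p\<close>: unlike
  \<open>shift l\<close>, this makes sense for every \<open>l\<close> in G, as is needed when
  conjugating by arbitrary group elements. For \<open>l\<close> in the support the two agree,
  because \<open>tact l\<close> then scales each word.\<close>

lemma opT_qrel:
  assumes g: "g \<in> G" and ab: "a \<le> b"
  shows "opT (qrel q a b) (opT p (vac g)) = (\<Sum>l\<in>G. pm_scale (\<kappa> (v b) (v a) l) (opT (tact l p) (vac (l \<circ> g))))"
proof (rule pm_linear_eqI[of "\<lambda>p. opT (qrel q a b) (opT p (vac g))" _ p])
  fix w
  have n: "keys (PBW.opw w (vac g)) \<subseteq> PBW.normal_words UNIV"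
    by (intro PBW.keys_opw) (use g in \<open>simp add: PBW.normal_words_def\<close>)
  show "opT (qrel q a b) (opT (single w 1) (vac g)) =
    (\<Sum>l\<in>G. pm_scale (\<kappa> (v b) (v a) l) (opT (tact l (single w 1)) (vac (l \<circ> g))))"
  proof (cases "a = b")
    case True
    then show ?thesis by (simp add: qrel_def PBW.op_op_eq_0[OF n] \<kappa>_diag)
  next
    case False
    have "opT (qrel q a b) (opT (single w 1) (vac g)) = PBW.twist b a (PBW.opw w (vac g))"
      using False by (simp add: qrel_def opT_diff PBW.op_op[OF False n])
    also have "\<dots> = (\<Sum>l\<in>G. opT (pm_scale (\<kappa> (v b) (v a) l) (tact l (single w 1))) (vac (l \<circ> g)))"
      using False g by (simp add: PBW.twist_opw \<kappa>_tact_word)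
    finally show ?thesis by (simp add: opT_scale)
  qed
qed (intro linear_opT pm_linear_comp[OF linear_opT(1)] pm_linear_comp[OF linear_opT(2)] tact_linears)+

text \<open>The operators satisfy \<open>h (r - \<Sum>k(l) l) h\<^sup>-\<^sup>1 = 0\<close> for all \<open>h\<close> in \<open>G\<close>, where \<open>l\<close> acts on \<open>p g\<close> as \<open>(l p) l g\<close>.\<close>

definition op_relation :: "('i list \<Rightarrow>\<^sub>0 'k) \<Rightarrow> (('v \<Rightarrow> 'v) \<Rightarrow> 'k) \<Rightarrow> bool" where
  "op_relation r k \<longleftrightarrow> (\<forall>h\<in>G. \<forall>g\<in>G. \<forall>p. opT (tact h r) (opT p (vac g)) =
     (\<Sum>l\<in>G. pm_scale (k (inv\<^bsub>\<Gamma>\<^esub> h \<circ> l \<circ> h)) (opT (tact l p) (vac (l \<circ> g)))))"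

text \<open>The translate of the relation by \<open>h\<close> is expanded in the relations
  \<open>qrel q a b\<close>, each of which acts by \<open>opT_qrel\<close>. The coefficient
  collected at \<open>l\<close> is the conjugated value by
  \<open>\<kappa>_invariant\<close>.\<close>

lemma op_relation_qrel: "i \<le> j \<Longrightarrow> op_relation (qrel q i j) (\<kappa> (v j) (v i))"
  unfolding op_relation_def
proof (intro ballI allI)
  fix h g p assume ij: "i \<le> j" and h: "h \<in> G" and g: "g \<in> G"
  let ?F = "\<lambda>a b. lookup (tact h (qrel q i j)) [a, b]"
  have "opT (tact h (qrel q i j)) (opT p (vac g)) =
      (\<Sum>(a, b) | a \<le> b. pm_scale (?F a b) (opT (qrel q a b) (opT p (vac g))))"
    by (subst tact_qrel[OF h ij]) (simp add: opT_sum opT_scale case_prod_unfold)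
  also have "\<dots> = (\<Sum>(a, b) | a \<le> b. \<Sum>l\<in>G. pm_scale (?F a b * \<kappa> (v b) (v a) l) (opT (tact l p) (vac (l \<circ> g))))"
    by (intro sum.cong) (auto simp: opT_qrel[OF g] pm_scale_sum)
  also have "\<dots> = (\<Sum>l\<in>G. \<Sum>(a, b) | a \<le> b. pm_scale (?F a b * \<kappa> (v b) (v a) l) (opT (tact l p) (vac (l \<circ> g))))"
    unfolding case_prod_unfold by (rule sum.swap)
  also have "\<dots> = (\<Sum>l\<in>G. pm_scale (\<kappa> (v j) (v i) (inv\<^bsub>\<Gamma>\<^esub> h \<circ> l \<circ> h)) (opT (tact l p) (vac (l \<circ> g))))"
    by (intro sum.cong) (simp_all add: \<kappa>_invariant[OF h ij, symmetric] pm.scale_sum_left case_prod_unfold)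
  finally show "opT (tact h (qrel q i j)) (opT p (vac g)) =
    (\<Sum>l\<in>G. pm_scale (\<kappa> (v j) (v i) (inv\<^bsub>\<Gamma>\<^esub> h \<circ> l \<circ> h)) (opT (tact l p) (vac (l \<circ> g))))" .
qed

lemma op_relation_cong: "op_relation r k \<Longrightarrow> (\<And>g. g \<in> G \<Longrightarrow> k g = k' g) \<Longrightarrow> op_relation r k'"
  by (simp add: op_relation_def)

lemma op_relation_scale: "op_relation r k \<Longrightarrow> op_relation (pm_scale c r) (\<lambda>g. c * k g)"
  by (simp add: op_relation_def tact_scale opT_scale pm_scale_sum)

lemma op_relation_generators:
  shows "op_relation (word [j, i] - pm_scale (q i j) (word [i, j])) (\<kappa> (v i) (v j))"
    and "op_relation (word [i, i]) (\<lambda>_. 0)"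
proof -
  have r: "op_relation (word [i, i]) (\<lambda>_. 0)" for i
    by (rule op_relation_cong[OF op_relation_qrel[of i i, unfolded qrel_def, simplified, folded word_def]]) (simp add: \<kappa>_diag)
  then show "op_relation (word [i, i]) (\<lambda>_. 0)" .
  consider "i < j" | "i = j" | "j < i" by fastforce
  then show "op_relation (word [j, i] - pm_scale (q i j) (word [i, j])) (\<kappa> (v i) (v j))"
  proof cases
    case 1
    \<comment> \<open>Since q_ij q_ji = 1, rescaling turns v_i v_j - q_ji v_j v_i into the generator
      v_j v_i - q_ij v_i v_j; the same factor turns \<kappa>(v_j, v_i) into \<kappa>(v_i,
      v_j).\<close>
    have "pm_scale (- q i j) (qrel q i j) = word [j, i] - pm_scale (q i j) (word [i, j])"
      using 1 q_inv[of i j] by (intro poly_mapping_eqI) (auto simp: qrel_def word_def lookup_minus lookup_single when_def)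
    with op_relation_scale[OF op_relation_qrel[of i j], of "- q i j"] 1
    have "op_relation (word [j, i] - pm_scale (q i j) (word [i, j])) (\<lambda>g. - q i j * \<kappa> (v j) (v i) g)" by simp
    then show ?thesis by (rule op_relation_cong) (use 1 \<kappa>_skew[of i j] in auto)
  next
    case 2
    \<comment> \<open>No value of \<open>q i i\<close> is prescribed, so for \<open>i = j\<close>
      the generator is some multiple of v_i v_i.\<close>
    have "pm_scale (1 - q i i) (word [i, i]) = word [i, i] - pm_scale (q i i) (word [i, i])"
      by (simp add: pm.scale_left_diff_distrib)
    with op_relation_scale[OF r, of "1 - q i i" i] 2 show ?thesis
      by simp (erule op_relation_cong, simp add: \<kappa>_diag)
  next
    case 3
    then show ?thesis using op_relation_qrel[OF less_imp_le[OF 3]] by (simp add: qrel_def word_def less_imp_neq[OF 3])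
  qed
qed

text \<open>The vector obtained by letting \<open>x\<close> act on the symbol of 1: the group
  element acts on the empty word first, the tensor afterwards.\<close>

definition nf :: "(('v \<Rightarrow> 'v) \<Rightarrow> ('i list \<Rightarrow>\<^sub>0 'k)) \<Rightarrow> ('i list \<times> ('v \<Rightarrow> 'v) \<Rightarrow>\<^sub>0 'k)" where
  "nf x = (\<Sum>g\<in>G. opT (x g) (vac g))"

lemma nf_mult:
  "nf (x \<otimes>\<^bsub>S\<^esub> y) = (\<Sum>h\<in>G. opT (x h) (\<Sum>g\<in>G. opT (tact h (y g)) (vac (h \<circ> g))))"
proof -
  have "nf (x \<otimes>\<^bsub>S\<^esub> y) = (\<Sum>g\<in>G. \<Sum>h\<in>G. opT (x h) (opT (tact h (y (inv\<^bsub>\<Gamma>\<^esub> h \<circ> g))) (vac g)))"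
    by (simp add: nf_def S_mult opT_sum opT_mult)
  also have "\<dots> = (\<Sum>h\<in>G. \<Sum>g\<in>G. opT (x h) (opT (tact h (y (inv\<^bsub>\<Gamma>\<^esub> h \<circ> g))) (vac g)))"
    by (rule sum.swap)
  also have "\<dots> = (\<Sum>h\<in>G. \<Sum>g\<in>G. opT (x h) (opT (tact h (y g)) (vac (h \<circ> g))))"
  proof (rule sum.cong[OF refl])
    fix h assume h: "h \<in> G"
    show "(\<Sum>g\<in>G. opT (x h) (opT (tact h (y (inv\<^bsub>\<Gamma>\<^esub> h \<circ> g))) (vac g))) =
      (\<Sum>g\<in>G. opT (x h) (opT (tact h (y g)) (vac (h \<circ> g))))"
      by (subst sum_G_left[OF h, symmetric]) (simp add: h)
  qed
  finally show ?thesis by (simp add: opT_sum)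
qed

lemma sum_conj:
  assumes h: "h \<in> G"
  shows "(\<Sum>l\<in>G. f (inv\<^bsub>\<Gamma>\<^esub> h \<circ> l \<circ> h) l) = (\<Sum>l\<in>G. f l (h \<circ> l \<circ> inv\<^bsub>\<Gamma>\<^esub> h))"
  by (rule sum.reindex_bij_witness[of _ "\<lambda>l. h \<circ> l \<circ> inv\<^bsub>\<Gamma>\<^esub> h" "\<lambda>l. inv\<^bsub>\<Gamma>\<^esub> h \<circ> l \<circ> h"])
     (use h in \<open>auto simp: comp_assoc\<close>)

text \<open>By \<open>nf_mult\<close> the factor \<open>a\<close> enters through the operators
  \<open>opT (a h)\<close>, applied to the \<open>h\<close>-translate of the normal form of the
  product y b. This translate vanishes for each \<open>h\<close>: the part with \<open>r\<close>
  acts as the translate of \<open>r\<close> by \<open>h\<close>, which \<open>op_relation\<close>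
  replaces by the conjugate of \<open>k\<close>, and conjugating back yields the part with
  \<open>k\<close>.\<close>

lemma nf_relation:
  assumes r: "op_relation r k" and a: "a \<in> carrier S" and b: "b \<in> carrier S"
  shows "nf (a \<otimes>\<^bsub>S\<^esub> (\<lambda>g\<in>G. (if g = id then r else 0) - single [] (k g)) \<otimes>\<^bsub>S\<^esub> b) = 0"
proof -
  define y where "y = (\<lambda>g\<in>G. (if g = id then r else 0) - single [] (k g))"
  have yb: "(y \<otimes>\<^bsub>S\<^esub> b) g = r \<star> b g - (\<Sum>l\<in>G. pm_scale (k l) (tact l (b (inv\<^bsub>\<Gamma>\<^esub> l \<circ> g))))" if g: "g \<in> G" for g
  proof -
    have k: "single [] c \<star> p = pm_scale c p" for c p
      using tensor_mult_scale(1)[of c "single [] 1" p] by simp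
    have "(y \<otimes>\<^bsub>S\<^esub> b) g = (\<Sum>l\<in>G. (if l = id then r \<star> tact id (b (inv\<^bsub>\<Gamma>\<^esub> id \<circ> g)) else 0) -
        pm_scale (k l) (tact l (b (inv\<^bsub>\<Gamma>\<^esub> l \<circ> g))))"
      unfolding S_mult using g by (auto intro!: sum.cong simp: y_def tensor_mult_diff k)
    then show ?thesis using \<Gamma>.inv_one by (simp add: sum_subtractf finite_G del: \<Gamma>.inv_one)
  qed
  have zero: "(\<Sum>g\<in>G. opT (tact h ((y \<otimes>\<^bsub>S\<^esub> b) g)) (vac (h \<circ> g))) = 0" if h: "h \<in> G" for h
  proof -
    have "(\<Sum>g\<in>G. opT (tact h ((y \<otimes>\<^bsub>S\<^esub> b) g)) (vac (h \<circ> g))) =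
      (\<Sum>g\<in>G. opT (tact h r) (opT (tact h (b g)) (vac (h \<circ> g)))) -
      (\<Sum>g\<in>G. \<Sum>l\<in>G. pm_scale (k l) (opT (tact (h \<circ> l) (b (inv\<^bsub>\<Gamma>\<^esub> l \<circ> g))) (vac (h \<circ> g))))"
      by (simp add: yb tact_diff tact_mult tact_sum tact_scale opT_diff opT_mult opT_sum opT_scale
          sum_subtractf tact_comp h)
    also have "(\<Sum>g\<in>G. \<Sum>l\<in>G. pm_scale (k l) (opT (tact (h \<circ> l) (b (inv\<^bsub>\<Gamma>\<^esub> l \<circ> g))) (vac (h \<circ> g)))) =
      (\<Sum>l\<in>G. \<Sum>g\<in>G. pm_scale (k l) (opT (tact (h \<circ> l) (b (inv\<^bsub>\<Gamma>\<^esub> l \<circ> g))) (vac (h \<circ> g))))"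
      by (rule sum.swap)
    also have "\<dots> = (\<Sum>l\<in>G. \<Sum>g\<in>G. pm_scale (k l) (opT (tact (h \<circ> l) (b g)) (vac (h \<circ> (l \<circ> g)))))"
    proof (rule sum.cong[OF refl])
      fix l assume l: "l \<in> G"
      show "(\<Sum>g\<in>G. pm_scale (k l) (opT (tact (h \<circ> l) (b (inv\<^bsub>\<Gamma>\<^esub> l \<circ> g))) (vac (h \<circ> g)))) =
        (\<Sum>g\<in>G. pm_scale (k l) (opT (tact (h \<circ> l) (b g)) (vac (h \<circ> (l \<circ> g)))))"
        by (subst sum_G_left[OF l, symmetric]) (simp add: l)
    qed
    also have "\<dots> = (\<Sum>g\<in>G. \<Sum>l\<in>G. pm_scale (k l) (opT (tact (h \<circ> l) (b g)) (vac (h \<circ> (l \<circ> g)))))"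
      by (rule sum.swap)
    also have "(\<Sum>g\<in>G. opT (tact h r) (opT (tact h (b g)) (vac (h \<circ> g)))) = \<dots>"
    proof (rule sum.cong[OF refl])
      fix g assume g: "g \<in> G"
      have "opT (tact h r) (opT (tact h (b g)) (vac (h \<circ> g))) =
        (\<Sum>l\<in>G. pm_scale (k (inv\<^bsub>\<Gamma>\<^esub> h \<circ> l \<circ> h)) (opT (tact l (tact h (b g))) (vac (l \<circ> (h \<circ> g)))))"
        using r h g by (auto simp: op_relation_def)
      also have "\<dots> = (\<Sum>l\<in>G. pm_scale (k l) (opT (tact (h \<circ> l \<circ> inv\<^bsub>\<Gamma>\<^esub> h) (tact h (b g))) (vac (h \<circ> l \<circ> inv\<^bsub>\<Gamma>\<^esub> h \<circ> (h \<circ> g)))))"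
        by (rule sum_conj[OF h])
      also have "\<dots> = (\<Sum>l\<in>G. pm_scale (k l) (opT (tact (h \<circ> l) (b g)) (vac (h \<circ> (l \<circ> g)))))"
        by (intro sum.cong refl) (simp add: h comp_assoc flip: tact_comp)
      finally show "opT (tact h r) (opT (tact h (b g)) (vac (h \<circ> g))) =
        (\<Sum>l\<in>G. pm_scale (k l) (opT (tact (h \<circ> l) (b g)) (vac (h \<circ> (l \<circ> g)))))" .
    qed
    finally show ?thesis by (simp only: diff_self)
  qed
  have "a \<otimes>\<^bsub>S\<^esub> y \<otimes>\<^bsub>S\<^esub> b = a \<otimes>\<^bsub>S\<^esub> (y \<otimes>\<^bsub>S\<^esub> b)"
    using a b by (intro S_mult_assoc) (simp_all add: y_def)
  then show ?thesis unfolding y_def[symmetric] by (simp add: nf_mult zero)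
qed

lemma nf_add: "nf (x \<oplus>\<^bsub>S\<^esub> y) = nf x + nf y"
  by (simp add: nf_def opT_add sum.distrib)

lemma S_minus: "x \<in> carrier S \<Longrightarrow> y \<in> carrier S \<Longrightarrow> x \<ominus>\<^bsub>S\<^esub> y = (\<lambda>g\<in>G. x g - y g)"
proof -
  assume xy: "x \<in> carrier S" "y \<in> carrier S"
  interpret S: ring S by (rule ring_S)
  have "\<ominus>\<^bsub>S\<^esub> y = (\<lambda>g\<in>G. - y g)"
    by (rule S.minus_equality) (use xy in \<open>auto simp: fun_eq_iff\<close>)
  then show ?thesis by (auto simp: a_minus_def fun_eq_iff)
qed

lemma nf_minus: "x \<in> carrier S \<Longrightarrow> y \<in> carrier S \<Longrightarrow> nf (x \<ominus>\<^bsub>S\<^esub> y) = nf x - nf y"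
  by (simp add: S_minus nf_def opT_diff sum_subtractf)

abbreviation "I \<equiv> hecke_ideal scale v q G \<kappa>"

text \<open>The generators of the ideal as functions on the group, in the shape expected by
  \<open>nf_relation\<close>; the squares are the case of zero \<open>k\<close>.\<close>

definition gens :: "(('v \<Rightarrow> 'v) \<Rightarrow> ('i list \<Rightarrow>\<^sub>0 'k)) set" where
  "gens = {\<lambda>g\<in>G. (if g = id then word [j, i] - pm_scale (q i j) (word [i, j]) else 0) - single [] (\<kappa> (v i) (v j) g) | i j. True}
     \<union> {\<lambda>g\<in>G. if g = id then word [i, i] else 0 | i. True}"

lemma gens_closed: "gens \<subseteq> carrier S"
  by (auto simp: gens_def)

lemma hecke_ideal_eq: "I = Idl\<^bsub>S\<^esub> gens"
proof -
  have "skew_elt tensor_alg \<Gamma> (word [j, i] - pm_scale (q i j) (word [i, j])) \<one>\<^bsub>\<Gamma>\<^esub>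
      \<ominus>\<^bsub>S\<^esub> group_alg_elt tensor_alg \<Gamma> (\<kappa> (v i) (v j)) =
    (\<lambda>g\<in>G. (if g = id then word [j, i] - pm_scale (q i j) (word [i, j]) else 0) - single [] (\<kappa> (v i) (v j) g))" for i j
    by (subst S_minus) (auto simp: welt_skew_elt group_alg_elt_def welt_def fun_eq_iff)
  moreover have "skew_elt tensor_alg \<Gamma> (word [i, i] :: 'i list \<Rightarrow>\<^sub>0 'k) \<one>\<^bsub>\<Gamma>\<^esub> = (\<lambda>g\<in>G. if g = id then word [i, i] else 0)" for i
    by (simp add: welt_skew_elt welt_def)
  ultimately show ?thesis by (simp add: hecke_ideal_def gens_def Let_def)
qed

lemma ideal_I: "ideal I S"
  unfolding hecke_ideal_eq by (rule ring.genideal_ideal[OF ring_S gens_closed])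

lemma gens_in_I: "gens \<subseteq> I"
  unfolding hecke_ideal_eq by (rule ring.genideal_self[OF ring_S gens_closed])

text \<open>The kernel of \<open>nf\<close> is not visibly a two-sided ideal, so the proof works
  with the largest such ideal \<open>J\<close> inside it. This is why \<open>nf_relation\<close>
  carries factors on both sides.\<close>

lemma nf_I:
  assumes "x \<in> I" shows "nf x = 0"
proof -
  interpret S: ring S by (rule ring_S)
  define J where "J = {y \<in> carrier S. \<forall>a\<in>carrier S. \<forall>b\<in>carrier S. nf (a \<otimes>\<^bsub>S\<^esub> y \<otimes>\<^bsub>S\<^esub> b) = 0}"
  have nf0: "nf \<zero>\<^bsub>S\<^esub> = 0" by (simp add: nf_def)
  have "ideal J S"
  proof (rule idealI[OF ring_S])
    show "subgroup J (add_monoid S)"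
    proof (rule S.add.subgroupI)
      have "\<zero>\<^bsub>S\<^esub> \<in> J" unfolding J_def using nf0 S.zero_closed by (auto simp del: S_simps)
      then show "J \<noteq> {}" by blast
    next
      fix y assume y: "y \<in> J"
      then have yc: "y \<in> carrier S" by (simp add: J_def)
      have "nf (a \<otimes>\<^bsub>S\<^esub> (\<ominus>\<^bsub>S\<^esub> y) \<otimes>\<^bsub>S\<^esub> b) = 0" if ab: "a \<in> carrier S" "b \<in> carrier S" for a b
      proof -
        have "a \<otimes>\<^bsub>S\<^esub> (\<ominus>\<^bsub>S\<^esub> y) \<otimes>\<^bsub>S\<^esub> b = \<zero>\<^bsub>S\<^esub> \<ominus>\<^bsub>S\<^esub> (a \<otimes>\<^bsub>S\<^esub> y \<otimes>\<^bsub>S\<^esub> b)"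
          using ab yc by (simp add: S.r_minus S.l_minus a_minus_def del: S_simps)
        moreover have "nf \<dots> = 0 - nf (a \<otimes>\<^bsub>S\<^esub> y \<otimes>\<^bsub>S\<^esub> b)"
          using ab yc nf0 by (subst nf_minus) (simp_all del: S_simps)
        ultimately show ?thesis using y ab by (simp add: J_def del: S_simps)
      qed
      then show "\<ominus>\<^bsub>S\<^esub> y \<in> J" using yc by (simp add: J_def del: S_simps)
    next
      fix x y assume "x \<in> J" "y \<in> J"
      then show "x \<oplus>\<^bsub>S\<^esub> y \<in> J"
        by (simp add: J_def S.r_distr S.l_distr nf_add del: S_simps)
    qed (auto simp: J_def simp del: S_simps)
  next
    fix y x assume y: "y \<in> J" and x: "x \<in> carrier S"
    then have yc: "y \<in> carrier S" by (simp add: J_def del: S_simps)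
    have "a \<otimes>\<^bsub>S\<^esub> (x \<otimes>\<^bsub>S\<^esub> y) \<otimes>\<^bsub>S\<^esub> b = (a \<otimes>\<^bsub>S\<^esub> x) \<otimes>\<^bsub>S\<^esub> y \<otimes>\<^bsub>S\<^esub> b"
      "a \<otimes>\<^bsub>S\<^esub> (y \<otimes>\<^bsub>S\<^esub> x) \<otimes>\<^bsub>S\<^esub> b = a \<otimes>\<^bsub>S\<^esub> y \<otimes>\<^bsub>S\<^esub> (x \<otimes>\<^bsub>S\<^esub> b)"
      if "a \<in> carrier S" "b \<in> carrier S" for a b
      using that x yc by (simp_all add: S.m_assoc del: S_simps)
    then show "x \<otimes>\<^bsub>S\<^esub> y \<in> J" "y \<otimes>\<^bsub>S\<^esub> x \<in> J"
      using y x yc by (simp_all add: J_def del: S_simps)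
  qed
  moreover have "gens \<subseteq> J"
  proof -
    have "nf (a \<otimes>\<^bsub>S\<^esub> (\<lambda>g\<in>G. if g = id then word [i, i] else 0) \<otimes>\<^bsub>S\<^esub> b) = 0"
      if "a \<in> carrier S" "b \<in> carrier S" for a b i
      using nf_relation[OF op_relation_generators(2) that, of i] by simp
    then have "nf (a \<otimes>\<^bsub>S\<^esub> y \<otimes>\<^bsub>S\<^esub> b) = 0"
      if "y \<in> gens" "a \<in> carrier S" "b \<in> carrier S" for y a b
      using that nf_relation[OF op_relation_generators(1)] by (auto simp: gens_def simp del: S_simps)
    then show ?thesis
      using gens_closed by (auto simp: J_def simp del: S_simps)
  qed
  ultimately have "I \<subseteq> J" unfolding hecke_ideal_eq by (rule S.genideal_minimal)
  then have "nf (\<one>\<^bsub>S\<^esub> \<otimes>\<^bsub>S\<^esub> x \<otimes>\<^bsub>S\<^esub> \<one>\<^bsub>S\<^esub>) = 0" and "x \<in> carrier S"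
    using assms S.one_closed by (auto simp: J_def simp del: S_simps)
  then show ?thesis by (simp del: S_simps)
qed

end

section \<open>Congruence to the normal form, and the basis\<close>

context hecke_data begin

text \<open>Reads a normal form back as an element of the skew group algebra. It is a right inverse
  of \<open>nf\<close> on normal words and a left inverse modulo the ideal.\<close>

definition emb :: "('i list \<times> ('v \<Rightarrow> 'v) \<Rightarrow>\<^sub>0 'k) \<Rightarrow> (('v \<Rightarrow> 'v) \<Rightarrow> ('i list \<Rightarrow>\<^sub>0 'k))" where
  "emb m = (\<lambda>g\<in>G. lin (\<lambda>(l, h). if h = g then single l 1 else 0) m)"

lemma emb_closed [simp]: "emb m \<in> G \<rightarrow>\<^sub>E UNIV"
  by (simp add: emb_def)

lemma emb_linear: "g \<in> G \<Longrightarrow> pm_linear (\<lambda>m. emb m g)"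
  by (simp add: emb_def)

lemma emb_single: "emb (single (l, g) 1) = welt (single l 1) g"
  by (auto simp: emb_def welt_def fun_eq_iff)

lemma I_lmult: "x \<in> I \<Longrightarrow> a \<in> carrier S \<Longrightarrow> a \<otimes>\<^bsub>S\<^esub> x \<in> I"
  and I_rmult: "x \<in> I \<Longrightarrow> a \<in> carrier S \<Longrightarrow> x \<otimes>\<^bsub>S\<^esub> a \<in> I"
  using ideal.I_l_closed[OF ideal_I] ideal.I_r_closed[OF ideal_I] by blast+

lemma I_zero: "(\<lambda>g\<in>G. 0) \<in> I"
  and I_add: "x \<in> I \<Longrightarrow> y \<in> I \<Longrightarrow> (\<lambda>g\<in>G. x g + y g) \<in> I"
  using additive_subgroup.zero_closed[OF ideal.axioms(1)[OF ideal_I]]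
    additive_subgroup.a_closed[OF ideal.axioms(1)[OF ideal_I], of x y] by simp_all

lemma I_scale:
  assumes "x \<in> I" shows "(\<lambda>g\<in>G. pm_scale c (x g)) \<in> I"
proof -
  have k: "single [] c \<star> p = pm_scale c p" for p
    using tensor_mult_scale(1)[of c "single [] 1" p] by simp
  have "welt (single [] c) id \<otimes>\<^bsub>S\<^esub> x = (\<lambda>g\<in>G. \<Sum>h\<in>G. if h = id then pm_scale c (x g) else 0)"
    unfolding S_mult by (intro restrict_ext sum.cong) (use \<Gamma>.inv_one in \<open>auto simp: welt_def k\<close>)
  then have "welt (single [] c) id \<otimes>\<^bsub>S\<^esub> x = (\<lambda>g\<in>G. pm_scale c (x g))"
    by (simp add: finite_G)
  then show ?thesis using I_lmult[OF assms, of "welt (single [] c) id"] by simp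
qed

lemma I_sum:
  assumes "\<And>b. b \<in> B \<Longrightarrow> f b \<in> I"
  shows "(\<lambda>g\<in>G. \<Sum>b\<in>B. f b g) \<in> I"
  using assms
proof (induction B rule: infinite_finite_induct)
  case (insert b B)
  then have "(\<lambda>g\<in>G. f b g + (\<lambda>g\<in>G. \<Sum>b\<in>B. f b g) g) \<in> I" by (intro I_add) auto
  moreover have "(\<lambda>g\<in>G. f b g + (\<lambda>g\<in>G. \<Sum>b\<in>B. f b g) g) = (\<lambda>g\<in>G. \<Sum>b\<in>insert b B. f b g)"
    using insert by (intro restrict_ext) simp
  ultimately show ?case by (simp only:)
qed (simp_all add: I_zero)

definition cng :: "(('v \<Rightarrow> 'v) \<Rightarrow> ('i list \<Rightarrow>\<^sub>0 'k)) \<Rightarrow> (('v \<Rightarrow> 'v) \<Rightarrow> ('i list \<Rightarrow>\<^sub>0 'k)) \<Rightarrow> bool" (infix "\<approx>" 50) where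
  "x \<approx> y \<longleftrightarrow> x \<in> carrier S \<and> y \<in> carrier S \<and> (\<lambda>g\<in>G. x g - y g) \<in> I"

lemma cng_refl: "x \<in> carrier S \<Longrightarrow> x \<approx> x"
  by (simp add: cng_def I_zero)

lemma cng_trans: "x \<approx> y \<Longrightarrow> y \<approx> z \<Longrightarrow> x \<approx> z"
  using I_add[of "\<lambda>g\<in>G. x g - y g" "\<lambda>g\<in>G. y g - z g"] by (simp add: cng_def cong: restrict_cong)

lemma cng_sym: "x \<approx> y \<Longrightarrow> y \<approx> x"
  using I_scale[of "\<lambda>g\<in>G. x g - y g" "- 1"] by (simp add: cng_def cong: restrict_cong)

lemma cng_lmult:
  assumes "x \<approx> y" "a \<in> carrier S"
  shows "a \<otimes>\<^bsub>S\<^esub> x \<approx> a \<otimes>\<^bsub>S\<^esub> y"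
proof -
  interpret S: ring S by (rule ring_S)
  have xy: "x \<in> carrier S" "y \<in> carrier S" "x \<ominus>\<^bsub>S\<^esub> y \<in> I"
    using assms by (auto simp: cng_def S_minus simp del: S_simps)
  have c: "a \<otimes>\<^bsub>S\<^esub> x \<in> carrier S" "a \<otimes>\<^bsub>S\<^esub> y \<in> carrier S"
    using xy assms by (intro S.m_closed; simp del: S_simps)+
  have "a \<otimes>\<^bsub>S\<^esub> (x \<ominus>\<^bsub>S\<^esub> y) = a \<otimes>\<^bsub>S\<^esub> x \<ominus>\<^bsub>S\<^esub> a \<otimes>\<^bsub>S\<^esub> y"
    using xy assms by (simp add: a_minus_def S.r_distr S.r_minus del: S_simps)
  then show ?thesis using I_lmult[OF xy(3) assms(2)] c by (simp add: cng_def S_minus del: S_simps)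
qed

lemma cng_sum:
  assumes "\<And>b. b \<in> B \<Longrightarrow> x b \<approx> y b"
  shows "(\<lambda>g\<in>G. \<Sum>b\<in>B. pm_scale (c b) (x b g)) \<approx> (\<lambda>g\<in>G. \<Sum>b\<in>B. pm_scale (c b) (y b g))"
proof -
  have "(\<lambda>g\<in>G. \<Sum>b\<in>B. (\<lambda>g\<in>G. pm_scale (c b) ((\<lambda>g\<in>G. x b g - y b g) g)) g) \<in> I"
    by (intro I_sum I_scale) (use assms in \<open>unfold cng_def, blast\<close>)
  then show ?thesis
    by (simp add: cng_def pm.scale_right_diff_distrib sum_subtractf cong: restrict_cong sum.cong)
qed

lemma cng_linear:
  assumes F: "\<And>g. g \<in> G \<Longrightarrow> pm_linear (\<lambda>m. F m g)" "\<And>m. F m \<in> carrier S"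
    and H: "\<And>g. g \<in> G \<Longrightarrow> pm_linear (\<lambda>m. H m g)" "\<And>m. H m \<in> carrier S"
    and eq: "\<And>y. y \<in> keys m \<Longrightarrow> F (single y 1) \<approx> H (single y 1)"
  shows "F m \<approx> H m"
proof -
  have "(\<lambda>g\<in>G. \<Sum>y\<in>keys m. pm_scale (lookup m y) (F (single y 1) g)) = F m"
    using F(2)[of m] pm_linear_eq_lin[OF F(1), of _ m] by (auto simp: fun_eq_iff lin_def PiE_def extensional_def)
  moreover have "(\<lambda>g\<in>G. \<Sum>y\<in>keys m. pm_scale (lookup m y) (H (single y 1) g)) = H m"
    using H(2)[of m] pm_linear_eq_lin[OF H(1), of _ m] by (auto simp: fun_eq_iff lin_def PiE_def extensional_def)
  ultimately show ?thesis using cng_sum[OF eq, of "keys m" "\<lambda>y. y" "lookup m"] by simp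
qed

lemma S_mult_linear: "g \<in> G \<Longrightarrow> pm_linear (\<lambda>m. (a \<otimes>\<^bsub>S\<^esub> emb m) g)"
  unfolding S_mult using finite_G
  by (simp, intro pm_linear_sum_comp pm_linear_comp[OF pm_linear_mult_right] pm_linear_comp[OF linear_tact] emb_linear) auto

lemma letter_mult: "welt (single [i] 1) id \<otimes>\<^bsub>S\<^esub> x = (\<lambda>g\<in>G. single [i] 1 \<star> x g)"
proof -
  have "welt (single [i] 1) id \<otimes>\<^bsub>S\<^esub> x = (\<lambda>g\<in>G. \<Sum>h\<in>G. if h = id then single [i] 1 \<star> x g else 0)"
    unfolding S_mult by (intro restrict_ext sum.cong) (use \<Gamma>.inv_one in \<open>auto simp: welt_def\<close>)
  then show ?thesis by (simp add: finite_G)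
qed

lemma letter_mult_closed: "welt (single [i] 1) id \<otimes>\<^bsub>S\<^esub> x \<in> carrier S"
  by (simp add: letter_mult)

lemma emb_prep: "emb (PBW.prep a m) = welt (single [a] 1) id \<otimes>\<^bsub>S\<^esub> emb m"
proof (rule S_ext)
  fix g assume g: "g \<in> G"
  show "emb (PBW.prep a m) g = (welt (single [a] 1) id \<otimes>\<^bsub>S\<^esub> emb m) g"
    by (rule pm_linear_eqI[of "\<lambda>m. emb (PBW.prep a m) g" "\<lambda>m. (welt (single [a] 1) id \<otimes>\<^bsub>S\<^esub> emb m) g" m];
       (intro pm_linear_comp[OF emb_linear[OF g]] S_mult_linear[OF g] PBW.linear_ops)?)
       (use g in \<open>auto simp: emb_def letter_mult\<close>)
qed (simp_all add: letter_mult)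

text \<open>The generator is multiplied from the right by the word \<open>l\<close> times
  \<open>h\<close>. Pushing an element \<open>k\<close> of the support of \<kappa>(v_i, v_j) past
  \<open>l\<close> gives the factor \<open>wt k l\<close>, since \<open>k\<close> is diagonal, and
  this is the term that \<open>twist\<close> records.\<close>

lemma cng_gen:
  assumes "i \<noteq> j" "h \<in> G"
  shows "welt (single (j # i # l) 1) h \<approx>
    (\<lambda>g\<in>G. pm_scale (q i j) (welt (single (i # j # l) 1) h g) + emb (PBW.twist i j (single (l, h) 1)) g)"
proof -
  let ?y = "\<lambda>g\<in>G. (if g = id then word [j, i] - pm_scale (q i j) (word [i, j]) else 0) - single [] (\<kappa> (v i) (v j) g)"
  have "?y \<in> I" using gens_in_I by (auto simp: gens_def)
  then have yI: "?y \<otimes>\<^bsub>S\<^esub> welt (single l 1) h \<in> I" by (rule I_rmult) simp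
  have tw: "emb (PBW.twist i j (single (l, h) 1)) g = (\<Sum>k\<in>G. pm_scale (\<kappa> (v i) (v j) k) (tact k (welt (single l 1) h (inv\<^bsub>\<Gamma>\<^esub> k \<circ> g))))"
    if g: "g \<in> G" for g
  proof -
    have "emb (PBW.twist i j (single (l, h) 1)) g =
      (\<Sum>k\<in>G. pm_scale (\<kappa> (v i) (v j) k) (if k \<circ> h = g then single l (PBW.wt k l) else 0))"
      using g by (simp add: PBW.twist_def emb_def lin_sum lin_scale if_distrib cong: if_cong sum.cong)
    also have "\<dots> = (\<Sum>k\<in>G. pm_scale (\<kappa> (v i) (v j) k) (tact k (welt (single l 1) h (inv\<^bsub>\<Gamma>\<^esub> k \<circ> g))))"
    proof (rule sum.cong[OF refl])
      fix k assume k: "k \<in> G"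
      have "k \<circ> h = g \<longleftrightarrow> inv\<^bsub>\<Gamma>\<^esub> k \<circ> g = h" using g k assms(2) by (metis G_inv_comp_assoc)
      then show "pm_scale (\<kappa> (v i) (v j) k) (if k \<circ> h = g then single l (PBW.wt k l) else 0) =
          pm_scale (\<kappa> (v i) (v j) k) (tact k (welt (single l 1) h (inv\<^bsub>\<Gamma>\<^esub> k \<circ> g)))"
        using \<kappa>_tact_word[OF assms(1) k, of l] assms(2) g k by (simp add: welt_def del: pm.scale_cancel_left)
    qed
    finally show ?thesis .
  qed
  have k: "single [] c \<star> p = pm_scale c p" for c p
    using tensor_mult_scale(1)[of c "single [] 1" p] by simp
  have "(?y \<otimes>\<^bsub>S\<^esub> welt (single l 1) h) g = welt (single (j # i # l) 1) h g -
    (pm_scale (q i j) (welt (single (i # j # l) 1) h g) + emb (PBW.twist i j (single (l, h) 1)) g)" if g: "g \<in> G" for g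
  proof -
    have "(?y \<otimes>\<^bsub>S\<^esub> welt (single l 1) h) g = (\<Sum>k\<in>G.
       (if k = id then (word [j, i] - pm_scale (q i j) (word [i, j])) \<star> welt (single l 1) h g else 0) -
        pm_scale (\<kappa> (v i) (v j) k) (tact k (welt (single l 1) h (inv\<^bsub>\<Gamma>\<^esub> k \<circ> g))))"
      unfolding S_mult using g \<Gamma>.inv_one by (auto intro!: sum.cong simp: tensor_mult_diff k simp del: \<Gamma>.inv_one)
    also have "\<dots> = (word [j, i] - pm_scale (q i j) (word [i, j])) \<star> welt (single l 1) h g - emb (PBW.twist i j (single (l, h) 1)) g"
      by (simp add: sum_subtractf finite_G tw[OF g])
    finally show ?thesis using g by (simp add: welt_def word_def tensor_mult_diff)
  qed
  then have "?y \<otimes>\<^bsub>S\<^esub> welt (single l 1) h = (\<lambda>g\<in>G. welt (single (j # i # l) 1) h g -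
    (pm_scale (q i j) (welt (single (i # j # l) 1) h g) + emb (PBW.twist i j (single (l, h) 1)) g))"
    by (intro S_ext) (simp_all add: S_mult)
  with yI show ?thesis by (simp add: cng_def cong: restrict_cong)
qed

lemma cng_square: "h \<in> G \<Longrightarrow> welt (single (i # i # l) 1) h \<approx> (\<lambda>g\<in>G. 0)"
proof -
  assume h: "h \<in> G"
  have "(\<lambda>g\<in>G. if g = id then word [i, i] else 0) = welt (word [i, i]) id" by (simp add: welt_def)
  moreover have "(\<lambda>g\<in>G. if g = id then word [i, i] else 0) \<in> gens" unfolding gens_def by blast
  ultimately have "welt (word [i, i]) id \<in> I" using gens_in_I by auto
  then have "welt (word [i, i]) id \<otimes>\<^bsub>S\<^esub> welt (single l 1) h \<in> I" by (rule I_rmult) simp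
  then have "welt (single (i # i # l) 1) h \<in> I" using h by (simp add: welt_mult word_def)
  then show ?thesis using I_add[OF _ I_zero, of "welt (single (i # i # l) 1) h"] by (simp add: cng_def cong: restrict_cong)
qed

text \<open>Each clause of \<open>ins\<close> either does nothing or applies a generator of the
  ideal, so reordering does not leave the residue class.\<close>

lemma cng_op_single:
  "(l, g) \<in> PBW.normal_words UNIV \<Longrightarrow>
    emb (PBW.op i (single (l, g) 1)) \<approx> welt (single (i # l) 1) g"
proof (induction l)
  case Nil
  then show ?case by (simp add: emb_single cng_refl)
next
  case (Cons a l)
  then have g: "g \<in> G" and lg: "(l, g) \<in> PBW.normal_words UNIV" by (auto simp: PBW.normal_words_def)
  note letters = welt_mult[OF G_id g, of "single [_] 1" "single _ 1", simplified]
  consider "i < a" | "i = a" | "a < i" by fastforce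
  then show ?case
  proof cases
    case 1
    then show ?thesis by (simp add: emb_single cng_refl)
  next
    case 2
    then have "emb (PBW.op i (single (a # l, g) 1)) = (\<lambda>g\<in>G. 0)" by (simp add: emb_def)
    then show ?thesis using cng_sym[OF cng_square[OF g, of a l]] 2 by metis
  next
    case 3
    let ?x = "single (l, g) 1"
    have c1: "emb (PBW.op i (single (a # l, g) 1)) =
      (\<lambda>h\<in>G. pm_scale (q a i) (emb (PBW.prep a (PBW.op i ?x)) h) + emb (PBW.twist a i ?x) h)"
      using 3 by (auto simp: emb_def lin_add lin_scale fun_eq_iff)
    have "emb (PBW.prep a (PBW.op i ?x)) \<approx> welt (single (a # i # l) 1) g"
      unfolding emb_prep using cng_lmult[OF Cons.IH[OF lg], of "welt (single [a] 1) id"]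
      by (simp add: letters)
    then have c2: "(\<lambda>h\<in>G. pm_scale (q a i) (emb (PBW.prep a (PBW.op i ?x)) h) + emb (PBW.twist a i ?x) h) \<approx>
       (\<lambda>h\<in>G. pm_scale (q a i) (welt (single (a # i # l) 1) g h) + emb (PBW.twist a i ?x) h)"
      using I_scale[of "\<lambda>h\<in>G. emb (PBW.prep a (PBW.op i ?x)) h - welt (single (a # i # l) 1) g h" "q a i"]
      by (simp add: cng_def pm.scale_right_diff_distrib cong: restrict_cong)
    have "\<dots> \<approx> welt (single (i # a # l) 1) g"
      using 3 by (intro cng_sym[OF cng_gen] g) auto
    with c2 show ?thesis unfolding c1 by (rule cng_trans)
  qed
qed

lemma cng_op:
  assumes "keys m \<subseteq> PBW.normal_words UNIV"
  shows "emb (PBW.op i m) \<approx> welt (single [i] 1) id \<otimes>\<^bsub>S\<^esub> emb m"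
proof (rule cng_linear)
  fix y assume "y \<in> keys m"
  then obtain l g where y: "y = (l, g)" "(l, g) \<in> PBW.normal_words UNIV" using assms by (cases y) auto
  have "g \<in> G" using y by (simp add: PBW.normal_words_def)
  then show "emb (PBW.op i (single y 1)) \<approx> welt (single [i] 1) id \<otimes>\<^bsub>S\<^esub> emb (single y 1)"
    using cng_op_single[OF y(2), of i] by (simp add: y(1) emb_single welt_mult del: PBW.op_single)
qed (rule pm_linear_comp[OF emb_linear] S_mult_linear letter_mult_closed PBW.linear_ops | simp; fail)+

lemma cng_opw: "g \<in> G \<Longrightarrow> emb (PBW.opw w (vac g)) \<approx> welt (single w 1) g"
proof (induction w)
  case Nil
  then show ?case by (simp add: emb_single cng_refl)
next
  case (Cons i w)
  have "keys (PBW.opw w (vac g)) \<subseteq> PBW.normal_words UNIV"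
    by (intro PBW.keys_opw) (use Cons.prems in \<open>simp add: PBW.normal_words_def\<close>)
  from cng_op[OF this, of i] cng_lmult[OF Cons.IH[OF Cons.prems], of "welt (single [i] 1) id"]
  have "emb (PBW.op i (PBW.opw w (vac g))) \<approx> welt (single [i] 1) id \<otimes>\<^bsub>S\<^esub> welt (single w 1) g"
    by (auto intro: cng_trans)
  then show ?case using Cons.prems by (simp add: welt_mult)
qed

lemma cng_nf:
  assumes x: "x \<in> carrier S"
  shows "emb (nf x) \<approx> x"
proof -
  have 1: "emb (opT p (vac g)) \<approx> welt p g" if g: "g \<in> G" for p g
  proof (rule cng_linear[of "\<lambda>p. emb (opT p (vac g))" "\<lambda>p. welt p g"])
    fix h assume h: "h \<in> G"
    then show "pm_linear (\<lambda>p. welt p g h)" by (cases "h = g") (simp_all add: welt_def)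
    show "pm_linear (\<lambda>p. emb (opT p (vac g)) h)"
      by (rule pm_linear_comp[OF emb_linear[OF h] linear_opT(2)])
  qed (use cng_opw[OF g] in simp_all)
  have "(\<lambda>h\<in>G. \<Sum>g\<in>G. pm_scale 1 (emb (opT (x g) (vac g)) h)) \<approx> (\<lambda>h\<in>G. \<Sum>g\<in>G. pm_scale 1 (welt (x g) g h))"
    by (rule cng_sum) (rule 1)
  moreover have "(\<lambda>h\<in>G. \<Sum>g\<in>G. pm_scale 1 (emb (opT (x g) (vac g)) h)) = emb (nf x)"
    by (simp add: emb_def nf_def lin_sum cong: restrict_cong)
  moreover have "(\<lambda>h\<in>G. \<Sum>g\<in>G. pm_scale 1 (welt (x g) g h)) = x"
    using S_expand[OF x] by (simp add: S_finsum finite_G cong: restrict_cong)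
  ultimately show ?thesis by simp
qed

lemma nf_emb:
  assumes "keys m \<subseteq> PBW.normal_words UNIV"
  shows "nf (emb m) = m"
proof (rule pm_linear_eqI[of "\<lambda>m. nf (emb m)" "\<lambda>m. m" m])
  have "pm_linear (\<lambda>m. \<Sum>g\<in>G. opT (emb m g) (vac g))"
    by (intro pm_linear_sum_comp pm_linear_comp[OF linear_opT(2)] emb_linear)
  then show "pm_linear (\<lambda>m. nf (emb m))" by (simp add: nf_def)
  fix y assume "y \<in> keys m"
  then obtain l g where y: "y = (l, g)" "(l, g) \<in> PBW.normal_words UNIV" using assms by (cases y) auto
  then have g: "g \<in> G" by (simp add: PBW.normal_words_def)
  have "nf (emb (single y 1)) = (\<Sum>h\<in>G. if h = g then single (l, g) 1 else 0)"
    unfolding nf_def y(1) emb_single using PBW.opw_normal[OF y(2)] by (intro sum.cong) (auto simp: welt_def)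
  then show "nf (emb (single y 1)) = single y 1" using g by (simp add: finite_G y(1))
qed simp

lemma keys_nf: "keys (nf x) \<subseteq> PBW.normal_words UNIV"
  unfolding nf_def by (intro keys_sum_subset keys_opT_vac)

text \<open>Existence and uniqueness of normal forms. Existence is \<open>cng_nf\<close>; for
  uniqueness, \<open>nf\<close> is constant on residue classes and recovers \<open>m\<close> from
  \<open>emb m\<close>.\<close>

lemma cng_emb_iff:
  assumes "x \<in> carrier S" "keys m \<subseteq> PBW.normal_words UNIV"
  shows "x \<approx> emb m \<longleftrightarrow> m = nf x"
proof
  assume a: "x \<approx> emb m"
  then have "nf (x \<ominus>\<^bsub>S\<^esub> emb m) = 0" by (intro nf_I) (simp add: S_minus cng_def)
  then have "nf x = nf (emb m)" using assms by (subst (asm) nf_minus) (auto simp del: S_simps, simp)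
  then show "m = nf x" using nf_emb[OF assms(2)] by simp
qed (use cng_sym[OF cng_nf[OF assms(1)]] in simp)

lemma quotient_space_I: "quotient_space I S"
proof -
  interpret S: ring S by (rule ring_S)
  show ?thesis
  proof (intro quotient_space.intro quotient_space_axioms.intro)
    show "abelian_subgroup I S"
      by (rule abelian_subgroupI3[OF ideal.axioms(1)[OF ideal_I] S.is_abelian_group])
  qed (auto simp: pm.scale_right_distrib fun_eq_iff I_scale)
qed

lemma ordered_word_01:
  assumes "\<forall>i. \<alpha> i \<in> {0, 1}"
  shows "ordered_word \<alpha> = filter (\<lambda>i. \<alpha> i = 1) (sorted_list_of_set UNIV)"
proof -
  have "concat (map (\<lambda>i. replicate (\<alpha> i) i) l) = filter (\<lambda>i. \<alpha> i = 1) l" for l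
    by (induction l) (use assms in auto)
  then show ?thesis by (simp add: ordered_word_def)
qed

text \<open>An increasing word is determined by its set of letters; the inverse map takes the
  characteristic function of that set.\<close>

lemma bij_ordered_word:
  "bij_betw (\<lambda>(\<alpha>, g). (ordered_word \<alpha>, g)) ({\<alpha> :: 'i \<Rightarrow> nat. \<forall>i. \<alpha> i \<in> {0, 1}} \<times> G) (PBW.normal_words UNIV)"
proof (rule bij_betwI[where g = "\<lambda>(l, g). (\<lambda>i. if i \<in> set l then 1 else 0, g)"])
  show "(\<lambda>(\<alpha>, g). (ordered_word \<alpha>, g)) \<in> {\<alpha>. \<forall>i. \<alpha> i \<in> {0, 1}} \<times> G \<rightarrow> PBW.normal_words UNIV"
    by (auto simp: ordered_word_01 PBW.normal_words_def intro!: sorted_wrt_filter)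
next
  fix x :: "('i \<Rightarrow> nat) \<times> ('v \<Rightarrow> 'v)" assume "x \<in> {\<alpha>. \<forall>i. \<alpha> i \<in> {0, 1}} \<times> G"
  then show "(case case x of (\<alpha>, g) \<Rightarrow> (ordered_word \<alpha>, g) of (l, g) \<Rightarrow> (\<lambda>i. if i \<in> set l then 1 else 0, g)) = x"
    by (cases x) (force simp: ordered_word_01)
next
  fix y assume "y \<in> PBW.normal_words UNIV"
  then obtain l g where y: "y = (l, g)" "sorted_wrt (<) l" by (cases y) (auto simp: PBW.normal_words_def)
  have "ordered_word (\<lambda>i. if i \<in> set l then 1 else 0) = filter (\<lambda>i. i \<in> set l) (sorted_list_of_set UNIV)"
    by (subst ordered_word_01) (auto intro: filter_cong)
  also have "\<dots> = l"
    by (rule strict_sorted_equal) (auto simp: y intro!: sorted_wrt_filter)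
  finally show "(case case y of (l, g) \<Rightarrow> (\<lambda>i. if i \<in> set l then 1 else 0, g) of (\<alpha>, g) \<Rightarrow> (ordered_word \<alpha>, g)) = y"
    by (simp add: y)
qed (auto simp: PBW.normal_words_def)

theorem pbw: "truncated_quantum_DHA scale v q G \<kappa>"
proof -
  interpret S: ring S by (rule ring_S)
  interpret Q: quotient_space I S by (rule quotient_space_I)
  interpret QA: abelian_group "quot S I" by (rule Q.quot_abelian_group)
  define B where "B = {\<alpha> :: 'i \<Rightarrow> nat. \<forall>i. \<alpha> i \<in> {0, 1}} \<times> G"
  define b where "b = (\<lambda>(\<alpha>, g). I +>\<^bsub>S\<^esub> welt (single (ordered_word \<alpha>) 1) g)"
  define e :: "('i \<Rightarrow> nat) \<times> ('v \<Rightarrow> 'v) \<Rightarrow> 'i list \<times> ('v \<Rightarrow> 'v)" where "e = (\<lambda>(\<alpha>, g). (ordered_word \<alpha>, g))"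
  define mk where "mk c = (\<Sum>x\<in>B. single (e x) (c x))" for c :: "('i \<Rightarrow> nat) \<times> ('v \<Rightarrow> 'v) \<Rightarrow> 'k"
  have e: "bij_betw e B (PBW.normal_words UNIV)"
    unfolding e_def B_def by (rule bij_ordered_word)
  have "finite ({\<alpha> :: 'i \<Rightarrow> nat. \<forall>i. \<alpha> i \<in> {0, 1}})"
    using finite_PiE[of "UNIV :: 'i set" "\<lambda>_. {0, 1::nat}"] by (simp add: PiE_def Pi_def)
  then have finB: "finite B" using finite_G by (simp add: B_def)
  have mk_keys: "keys (mk c) \<subseteq> PBW.normal_words UNIV" for c
    unfolding mk_def by (intro keys_sum_subset) (use bij_betwE[OF e] in auto)
  have mk_lookup: "lookup (mk c) (e x) = c x" if "x \<in> B" for c x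
  proof -
    have "lookup (mk c) (e x) = (\<Sum>y\<in>B. if y = x then c x else 0)"
      unfolding mk_def lookup_sum
      by (intro sum.cong) (use that bij_betw_imp_inj_on[OF e] in \<open>auto simp: lookup_single when_def inj_on_def\<close>)
    then show ?thesis using that finB by simp
  qed
  have mk_eq: "mk c = m \<longleftrightarrow> (\<forall>x\<in>B. c x = lookup m (e x))" if "keys m \<subseteq> PBW.normal_words UNIV" for c m
  proof
    assume r: "\<forall>x\<in>B. c x = lookup m (e x)"
    show "mk c = m"
    proof (rule poly_mapping_eqI)
      fix y
      show "lookup (mk c) y = lookup m y"
      proof (cases "y \<in> PBW.normal_words UNIV")
        case True
        then obtain x where "x \<in> B" "y = e x" using e by (metis bij_betw_imp_surj_on imageE)
        then show ?thesis using r mk_lookup by simp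
      next
        case False
        then have "y \<notin> keys (mk c)" "y \<notin> keys m" using mk_keys that by auto
        then show ?thesis by (simp add: in_keys_iff)
      qed
    qed
  qed (use mk_lookup in auto)
  have comb: "(\<Oplus>\<^bsub>quot S I\<^esub>x\<in>B. c x \<odot>\<^bsub>quot S I\<^esub> b x) = I +>\<^bsub>S\<^esub> emb (mk c)" for c
  proof -
    have "c x \<odot>\<^bsub>quot S I\<^esub> b x = I +>\<^bsub>S\<^esub> welt (single (ordered_word (fst x)) (c x)) (snd x)" for x
      unfolding b_def case_prod_unfold by (subst Q.quot_smult) (simp, simp only: welt_smult pm_scale_single mult_1_right)
    then have "(\<Oplus>\<^bsub>quot S I\<^esub>x\<in>B. c x \<odot>\<^bsub>quot S I\<^esub> b x) =
      I +>\<^bsub>S\<^esub> finsum S (\<lambda>x. welt (single (ordered_word (fst x)) (c x)) (snd x)) B"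
      by (simp add: Q.quot_finsum[OF finB])
    also have "finsum S (\<lambda>x. welt (single (ordered_word (fst x)) (c x)) (snd x)) B = emb (mk c)"
      by (subst S_finsum[OF finB])
         (auto simp: emb_def mk_def lin_sum e_def welt_def fun_eq_iff case_prod_unfold if_distrib intro!: sum.cong cong: if_cong)
    finally show ?thesis .
  qed
  have main: "\<exists>!c. c \<in> B \<rightarrow>\<^sub>E UNIV \<and> X = (\<Oplus>\<^bsub>quot S I\<^esub>x\<in>B. c x \<odot>\<^bsub>quot S I\<^esub> b x)"
    if X: "X \<in> carrier (quot S I)" for X
  proof -
    obtain y where y: "y \<in> carrier S" "X = I +>\<^bsub>S\<^esub> y" using X by (rule Q.quot_carrier_cases)
    \<comment> \<open>The class of \<open>y\<close> equals the combination with coefficients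
      \<open>c\<close> exactly if the normal form of \<open>y\<close> has these coefficients, which
      settles existence and uniqueness at once.\<close>
    have "X = (\<Oplus>\<^bsub>quot S I\<^esub>x\<in>B. c x \<odot>\<^bsub>quot S I\<^esub> b x) \<longleftrightarrow> (\<forall>x\<in>B. c x = lookup (nf y) (e x))" for c
    proof -
      have "X = (\<Oplus>\<^bsub>quot S I\<^esub>x\<in>B. c x \<odot>\<^bsub>quot S I\<^esub> b x) \<longleftrightarrow> y \<approx> emb (mk c)"
        unfolding comb y(2) using y(1) emb_closed
        by (subst Q.quot_eq_iff) (simp_all add: cng_def S_minus)
      also have "\<dots> \<longleftrightarrow> mk c = nf y" by (rule cng_emb_iff[OF y(1) mk_keys])
      finally show ?thesis using mk_eq[OF keys_nf] by simp
    qed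
    then show ?thesis
      by (intro ex1I[of _ "\<lambda>x\<in>B. lookup (nf y) (e x)"]) (auto simp: PiE_def extensional_def fun_eq_iff)
  qed
  have bc: "b \<in> B \<rightarrow> carrier (quot S I)"
    by (auto simp: b_def intro!: Q.quot_class_closed)
  have "finite_family_basis (quot S I) B b"
    unfolding finite_family_basis_def using finB bc main by blast
  then show ?thesis
    unfolding truncated_quantum_DHA_def hecke_alg_def B_def b_def welt_skew_elt word_def .
qed

end

section \<open>Tensor powers\<close>

locale tensor_space = abelian_group A for A :: "('k::field, 'a) module" (structure) +
  assumes smult_closed [simp]: "x \<in> carrier A \<Longrightarrow> c \<odot> x \<in> carrier A"
begin

abbreviation "F \<equiv> free_tensors A"
abbreviation "R \<equiv> tensor_relations A"
abbreviation "T \<equiv> tensor_power A"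

lemma F_simps [simp]:
  "p \<in> carrier (F m) \<longleftrightarrow> (\<forall>xs\<in>keys p. length xs = m \<and> set xs \<subseteq> carrier A)"
  "\<zero>\<^bsub>F m\<^esub> = 0" "p \<oplus>\<^bsub>F m\<^esub> r = p + r" "c \<odot>\<^bsub>F m\<^esub> p = pm_scale c p"
  by (simp_all add: free_tensors_def)

lemma F_iff: "p \<in> carrier (F m) \<longleftrightarrow> keys p \<subseteq> {xs. length xs = m \<and> set xs \<subseteq> carrier A}"
  by auto

lemma F_add: "p \<in> carrier (F m) \<Longrightarrow> r \<in> carrier (F m) \<Longrightarrow> p + r \<in> carrier (F m)"
  and F_scale: "p \<in> carrier (F m) \<Longrightarrow> pm_scale c p \<in> carrier (F m)"
  and F_lin: "(\<And>x. x \<in> keys s \<Longrightarrow> f x \<in> carrier (F m)) \<Longrightarrow> lin f s \<in> carrier (F m)"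
  and F_sum: "(\<And>x. x \<in> B \<Longrightarrow> p' x \<in> carrier (F m)) \<Longrightarrow> (\<Sum>x\<in>B. p' x) \<in> carrier (F m)"
  unfolding F_iff by (intro keys_add_subset keys_scale_subset keys_lin_subset keys_sum_subset; simp)+

lemma F_single: "length xs = m \<Longrightarrow> set xs \<subseteq> carrier A \<Longrightarrow> single xs c \<in> carrier (F m)"
  by (simp split: if_splits)

lemma F_zero: "0 \<in> carrier (F m)"
  by simp

lemma F_uminus: "p \<in> carrier (F m) \<Longrightarrow> - p \<in> carrier (F m)"
  by simp

lemma F_diff: "p \<in> carrier (F m) \<Longrightarrow> r \<in> carrier (F m) \<Longrightarrow> p - r \<in> carrier (F m)"
  using F_add[OF _ F_uminus, of p m r] by (simp del: F_simps(1))

lemma F_abelian_group: "abelian_group (F m)"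
proof (rule abelian_groupI)
  fix x assume "x \<in> carrier (F m)"
  then show "\<exists>y\<in>carrier (F m). y \<oplus>\<^bsub>F m\<^esub> x = \<zero>\<^bsub>F m\<^esub>" by (intro bexI[of _ "- x"]) auto
qed (simp_all add: F_add F_zero add_ac del: F_simps(1))

lemma R_add: "p \<in> R m \<Longrightarrow> r \<in> R m \<Longrightarrow> p + r \<in> R m"
  and R_diff: "p \<in> R m \<Longrightarrow> r \<in> R m \<Longrightarrow> p - r \<in> R m"
  and R_scale: "p \<in> R m \<Longrightarrow> pm_scale c p \<in> R m"
  and R_zero: "0 \<in> R m"
  and R_sum: "(\<And>x. x \<in> B \<Longrightarrow> p' x \<in> R m) \<Longrightarrow> (\<Sum>x\<in>B. p' x) \<in> R m"
  unfolding tensor_relations_def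
  by (simp_all add: pm.span_add pm.span_diff pm.span_scale pm.span_zero pm.span_sum)

lemma R_lin: "(\<And>x. x \<in> keys s \<Longrightarrow> f x \<in> R m) \<Longrightarrow> lin f s \<in> R m"
  unfolding lin_def by (intro R_sum R_scale)

lemma R_slot_add:
  assumes "{x, y} \<union> set xs \<union> set ys \<subseteq> carrier A" "length xs + length ys + 1 = m"
  shows "single (xs @ (x \<oplus> y) # ys) 1 - single (xs @ x # ys) 1 - single (xs @ y # ys) 1 \<in> R m"
  unfolding tensor_relations_def by (rule pm.span_base) (use assms in blast)

lemma R_slot_smult:
  assumes "{x} \<union> set xs \<union> set ys \<subseteq> carrier A" "length xs + length ys + 1 = m"
  shows "single (xs @ (c \<odot> x) # ys) 1 - single (xs @ x # ys) c \<in> R m"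
  unfolding tensor_relations_def by (rule pm.span_base) (use assms in blast)

lemma R_induct [consumes 1, case_names zero add scale slot_add slot_smult]:
  assumes "p \<in> R m" and "P 0" and "\<And>p r. P p \<Longrightarrow> P r \<Longrightarrow> P (p + r)" and "\<And>c p. P p \<Longrightarrow> P (pm_scale c p)"
    and "\<And>xs x y ys. {x, y} \<union> set xs \<union> set ys \<subseteq> carrier A \<Longrightarrow> length xs + length ys + 1 = m \<Longrightarrow>
      P (single (xs @ (x \<oplus> y) # ys) 1 - single (xs @ x # ys) 1 - single (xs @ y # ys) 1)"
    and "\<And>c xs x ys. {x} \<union> set xs \<union> set ys \<subseteq> carrier A \<Longrightarrow> length xs + length ys + 1 = m \<Longrightarrow>
      P (single (xs @ (c \<odot> x) # ys) 1 - single (xs @ x # ys) c)"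
  shows "P p"
  using assms(1) unfolding tensor_relations_def
proof (rule pm.span_induct_alt)
  fix c x y assume "x \<in> {single (xs @ (x \<oplus> y) # ys) 1 - single (xs @ x # ys) 1 - single (xs @ y # ys) 1 | xs x y ys.
         {x, y} \<union> set xs \<union> set ys \<subseteq> carrier A \<and> length xs + length ys + 1 = m} \<union>
      {single (xs @ (c \<odot> x) # ys) 1 - single (xs @ x # ys) c | c xs x ys.
         {x} \<union> set xs \<union> set ys \<subseteq> carrier A \<and> length xs + length ys + 1 = m}" and y: "P y"
  then have "P x" using assms(5,6) by blast
  then show "P (pm_scale c x + y)" using y assms(3,4) by blast
qed (rule assms(2))

lemma R_subset: "p \<in> R m \<Longrightarrow> p \<in> carrier (F m)"
proof (induction rule: R_induct)
  case (slot_add xs x y ys)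
  then show ?case by (intro F_diff F_single) auto
next
  case (slot_smult c xs x ys)
  then show ?case by (intro F_diff F_single) auto
qed (simp_all add: F_add F_scale F_zero del: F_simps(1))

lemma quotient_space_R: "quotient_space (R m) (F m)"
proof (intro quotient_space.intro quotient_space_axioms.intro)
  interpret F: abelian_group "F m" by (rule F_abelian_group)
  have neg: "\<ominus>\<^bsub>F m\<^esub> p = - p" if "p \<in> carrier (F m)" for p
    by (rule F.minus_equality) (use that in auto)
  have "subgroup (R m) (add_monoid (F m))"
  proof (rule F.add.subgroupI)
    fix p assume "p \<in> R m"
    then show "\<ominus>\<^bsub>F m\<^esub> p \<in> R m" using neg[OF R_subset] R_diff[OF R_zero, of p] by simp
  next
    show "R m \<noteq> {}" using R_zero by blast
  qed (use R_subset R_add in \<open>auto simp del: F_simps(1)\<close>)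
  then show "abelian_subgroup (R m) (F m)"
    by (intro abelian_subgroupI3 additive_subgroup.intro F_abelian_group)
qed (use F_scale R_scale in \<open>auto simp: pm.scale_right_distrib simp del: F_simps(1)\<close>)

sublocale TQ: quotient_space "R m" "F m" for m
  by (rule quotient_space_R)

definition tcls :: "nat \<Rightarrow> ('a list \<Rightarrow>\<^sub>0 'k) \<Rightarrow> ('a list \<Rightarrow>\<^sub>0 'k) set" where
  "tcls m p = R m +>\<^bsub>F m\<^esub> p"

lemma tcls_closed: "p \<in> carrier (F m) \<Longrightarrow> tcls m p \<in> carrier (T m)"
  unfolding tcls_def tensor_power_def by (rule TQ.quot_class_closed)

lemma T_add: "p \<in> carrier (F m) \<Longrightarrow> r \<in> carrier (F m) \<Longrightarrow> tcls m p \<oplus>\<^bsub>T m\<^esub> tcls m r = tcls m (p + r)"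
  unfolding tcls_def tensor_power_def by (simp add: TQ.quot_add del: F_simps(1))

lemma T_smult: "p \<in> carrier (F m) \<Longrightarrow> c \<odot>\<^bsub>T m\<^esub> tcls m p = tcls m (pm_scale c p)"
  unfolding tcls_def tensor_power_def by (simp add: TQ.quot_smult del: F_simps(1))

lemma T_zero: "\<zero>\<^bsub>T m\<^esub> = tcls m 0"
  unfolding tcls_def tensor_power_def using TQ.quot_zero[of m] by simp

lemma tcls_eqI:
  assumes "p \<in> carrier (F m)" "r \<in> carrier (F m)" "p - r \<in> R m"
  shows "tcls m p = tcls m r"
proof -
  have "\<ominus>\<^bsub>F m\<^esub> r = - r" by (rule TQ.minus_equality) (use assms in auto)
  then show ?thesis unfolding tcls_def using assms
    by (subst TQ.quot_eq_iff) (simp_all add: a_minus_def del: F_simps(1))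
qed

lemma finsum_F: "finite B \<Longrightarrow> (\<And>b. b \<in> B \<Longrightarrow> f b \<in> carrier (F m)) \<Longrightarrow> finsum (F m) f B = sum f B"
proof (induction B rule: finite_induct)
  case empty
  show ?case using TQ.finsum_empty[of m f] by simp
next
  case (insert b B)
  show ?case using insert by (subst TQ.finsum_insert) (auto simp del: F_simps(1))
qed

lemma T_finsum:
  assumes "finite B" "\<And>b. b \<in> B \<Longrightarrow> f b \<in> carrier (F m)"
  shows "finsum (T m) (\<lambda>b. tcls m (f b)) B = tcls m (sum f B)"
  using TQ.quot_finsum[of B f m] finsum_F[of B f m] assms
  unfolding tcls_def tensor_power_def by auto

lemma T_finsum_cong:
  assumes "finite B" "\<And>b. b \<in> B \<Longrightarrow> f b \<in> carrier (F m)" "\<And>b. b \<in> B \<Longrightarrow> x b = tcls m (f b)"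
  shows "finsum (T m) x B = tcls m (sum f B)"
proof -
  interpret T: abelian_group "T m" unfolding tensor_power_def by (rule TQ.quot_abelian_group)
  have "finsum (T m) x B = finsum (T m) (\<lambda>b. tcls m (f b)) B"
    by (rule T.finsum_cong') (use assms in \<open>auto intro!: tcls_closed simp del: F_simps(1)\<close>)
  then show ?thesis using T_finsum[of B f m] assms by simp
qed

lemma pure_tensor_tcls: "pure_tensor A xs = tcls (length xs) (single xs 1)"
  by (simp add: pure_tensor_def tcls_def)

definition slot_linear :: "('a \<Rightarrow> 'a) \<Rightarrow> bool" where
  "slot_linear f \<longleftrightarrow> (\<forall>x\<in>carrier A. f x \<in> carrier A \<and> (\<forall>c. f (c \<odot> x) = c \<odot> f x) \<and>
     (\<forall>y\<in>carrier A. f (x \<oplus> y) = f x \<oplus> f y))"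

text \<open>A workable form of multilinearity: varying the entry of one slot varies the value in one
  slot, through a linear map. The map and the other entries of the value may depend on the fixed
  arguments. This suffices for the generators of the multilinearity relations to be sent to
  generators of the same kind.\<close>

definition slotwise :: "nat \<Rightarrow> ('a list \<Rightarrow> 'a list) \<Rightarrow> bool" where
  "slotwise m \<phi> \<longleftrightarrow> m > 0 \<and> (\<forall>xs ys. set xs \<union> set ys \<subseteq> carrier A \<longrightarrow> length xs + length ys + 1 = m \<longrightarrow>
     (\<exists>f xs' ys'. slot_linear f \<and> set xs' \<union> set ys' \<subseteq> carrier A \<and> length xs' + length ys' + 1 = m \<and>
        (\<forall>x\<in>carrier A. \<phi> (xs @ x # ys) = xs' @ f x # ys')))"

lemma slotwise_closed:
  assumes "slotwise m \<phi>" "length xs = m" "set xs \<subseteq> carrier A"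
  shows "length (\<phi> xs) = m \<and> set (\<phi> xs) \<subseteq> carrier A"
proof -
  obtain x ys where xs: "xs = x # ys" using assms by (cases xs) (auto simp: slotwise_def)
  obtain f xs' ys' where "slot_linear f" "set xs' \<union> set ys' \<subseteq> carrier A" "length xs' + length ys' + 1 = m"
    "\<forall>x\<in>carrier A. \<phi> ([] @ x # ys) = xs' @ f x # ys'"
    using assms(1)[unfolded slotwise_def, THEN conjunct2, rule_format, of "[]" ys] assms(2,3) xs by auto
  then show ?thesis using assms xs by (auto simp: slot_linear_def)
qed

lemma slotwise_F:
  assumes "slotwise m \<phi>" "p \<in> carrier (F m)"
  shows "lin (\<lambda>xs. single (\<phi> xs) 1) p \<in> carrier (F m)"
  by (intro F_lin F_single) (use assms slotwise_closed[OF assms(1)] in auto)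

lemma slotwise_R:
  assumes s: "slotwise m \<phi>" and p: "p \<in> R m"
  shows "lin (\<lambda>xs. single (\<phi> xs) 1) p \<in> R m"
  using p
proof (induction rule: R_induct)
  case (slot_add xs x y ys)
  then obtain f xs' ys' where f: "slot_linear f" "set xs' \<union> set ys' \<subseteq> carrier A" "length xs' + length ys' + 1 = m"
    "\<forall>x\<in>carrier A. \<phi> (xs @ x # ys) = xs' @ f x # ys'"
    using s[unfolded slotwise_def, THEN conjunct2, rule_format, of xs ys] by auto
  have "single (xs' @ (f x \<oplus> f y) # ys') 1 - single (xs' @ f x # ys') 1 - single (xs' @ f y # ys') 1 \<in> R m"
    by (rule R_slot_add) (use f slot_add in \<open>auto simp: slot_linear_def\<close>)
  then show ?case using f slot_add by (simp add: lin_diff slot_linear_def)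
next
  case (slot_smult c xs x ys)
  then obtain f xs' ys' where f: "slot_linear f" "set xs' \<union> set ys' \<subseteq> carrier A" "length xs' + length ys' + 1 = m"
    "\<forall>x\<in>carrier A. \<phi> (xs @ x # ys) = xs' @ f x # ys'"
    using s[unfolded slotwise_def, THEN conjunct2, rule_format, of xs ys] by auto
  have "single (xs' @ (c \<odot> f x) # ys') 1 - single (xs' @ f x # ys') c \<in> R m"
    by (rule R_slot_smult) (use f slot_smult in \<open>auto simp: slot_linear_def\<close>)
  then show ?case using f slot_smult by (simp add: lin_diff slot_linear_def)
qed (simp_all add: R_zero R_add R_scale lin_add lin_scale)

text \<open>Since \<open>\<phi>\<close> preserves the relations, all representatives of the class
  have images in one class, and the union in \<open>tensor_map\<close> is that class.\<close>

lemma tensor_map_tcls: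
  assumes s: "slotwise m \<phi>" and p: "p \<in> carrier (F m)"
  shows "tensor_map A m \<phi> (tcls m p) = tcls m (lin (\<lambda>xs. single (\<phi> xs) 1) p)"
proof -
  have L: "(\<Sum>xs\<in>keys r. single (\<phi> xs) (lookup r xs)) = lin (\<lambda>xs. single (\<phi> xs) 1) r" for r :: "'a list \<Rightarrow>\<^sub>0 'k"
    by (simp add: lin_def)
  have "R m +>\<^bsub>F m\<^esub> lin (\<lambda>xs. single (\<phi> xs) 1) r = tcls m (lin (\<lambda>xs. single (\<phi> xs) 1) p)" if r: "r \<in> tcls m p" for r
  proof -
    obtain i where i: "i \<in> R m" "r = i + p" using r by (auto simp: tcls_def a_r_coset_def')
    have rF: "r \<in> carrier (F m)" unfolding i(2) by (rule F_add[OF R_subset[OF i(1)] p])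
    show ?thesis unfolding tcls_def[symmetric]
    proof (rule tcls_eqI[OF slotwise_F[OF s rF] slotwise_F[OF s p]])
      show "lin (\<lambda>xs. single (\<phi> xs) 1) r - lin (\<lambda>xs. single (\<phi> xs) 1) p \<in> R m"
        using slotwise_R[OF s i(1)] by (simp add: i(2) lin_add)
    qed
  qed
  moreover have "p \<in> tcls m p" unfolding tcls_def by (rule TQ.a_rcos_self[OF p])
  ultimately show ?thesis unfolding tensor_map_def L by blast
qed

lemma slotwise_map:
  assumes "slot_linear f" "m > 0"
  shows "slotwise m (map f)"
  unfolding slotwise_def
proof (intro conjI allI impI)
  fix xs ys assume "set xs \<union> set ys \<subseteq> carrier A" "length xs + length ys + 1 = m"
  then show "\<exists>f' xs' ys'. slot_linear f' \<and> set xs' \<union> set ys' \<subseteq> carrier A \<and> length xs' + length ys' + 1 = m \<and>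
        (\<forall>x\<in>carrier A. map f (xs @ x # ys) = xs' @ f' x # ys')"
    using assms by (intro exI[of _ f] exI[of _ "map f xs"] exI[of _ "map f ys"]) (auto simp: slot_linear_def)
qed (rule assms)

lemma slot_linear_id: "slot_linear (\<lambda>x. x)"
  by (simp add: slot_linear_def)

lemma slotwise_hd:
  assumes "slot_linear f" "m > 0"
  shows "slotwise m (\<lambda>xs. f (hd xs) # tl xs)"
  unfolding slotwise_def
proof (intro conjI allI impI)
  fix xs ys assume a: "set xs \<union> set ys \<subseteq> carrier A" "length xs + length ys + 1 = m"
  show "\<exists>f' xs' ys'. slot_linear f' \<and> set xs' \<union> set ys' \<subseteq> carrier A \<and> length xs' + length ys' + 1 = m \<and>
        (\<forall>x\<in>carrier A. f (hd (xs @ x # ys)) # tl (xs @ x # ys) = xs' @ f' x # ys')"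
  proof (cases xs)
    case Nil
    then show ?thesis using a assms by (intro exI[of _ f] exI[of _ "[]"] exI[of _ ys]) auto
  next
    case (Cons z zs)
    \<comment> \<open>The varied slot is not the head, so \<open>f\<close> acts on the fixed entry
      \<open>z\<close> and the slot map is the identity.\<close>
    then show ?thesis using a assms slot_linear_id
      by (intro exI[of _ "\<lambda>x. x"] exI[of _ "f z # zs"] exI[of _ ys]) (auto simp: slot_linear_def)
  qed
qed (rule assms)

lemma slotwise_last:
  assumes "slot_linear f" "m > 0"
  shows "slotwise m (\<lambda>xs. butlast xs @ [f (last xs)])"
  unfolding slotwise_def
proof (intro conjI allI impI)
  fix xs ys assume a: "set xs \<union> set ys \<subseteq> carrier A" "length xs + length ys + 1 = m"
  show "\<exists>f' xs' ys'. slot_linear f' \<and> set xs' \<union> set ys' \<subseteq> carrier A \<and> length xs' + length ys' + 1 = m \<and>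
        (\<forall>x\<in>carrier A. butlast (xs @ x # ys) @ [f (last (xs @ x # ys))] = xs' @ f' x # ys')"
  proof (cases ys rule: rev_cases)
    case Nil
    then show ?thesis using a assms by (intro exI[of _ f] exI[of _ xs] exI[of _ "[]"]) auto
  next
    case (snoc zs z)
    then show ?thesis using a assms slot_linear_id
      by (intro exI[of _ "\<lambda>x. x"] exI[of _ xs] exI[of _ "zs @ [f z]"]) (auto simp: slot_linear_def butlast_append)
  qed
qed (rule assms)

end

section \<open>Classes in the quantum exterior algebra\<close>

context
  fixes q :: "'i \<Rightarrow> 'i \<Rightarrow> 'k::field"
begin

lemma quotient_space_qext: "quotient_space (qext_ideal q) tensor_alg"
proof (intro quotient_space.intro quotient_space_axioms.intro)
  interpret T: ring "tensor_alg :: ('k, 'i list \<Rightarrow>\<^sub>0 'k) module" by (rule ring_tensor_alg)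
  show "abelian_subgroup (qext_ideal q) tensor_alg"
    by (rule abelian_subgroupI3[OF ideal.axioms(1)[OF ideal_qext_ideal] T.is_abelian_group])
next
  fix x c assume "x \<in> qext_ideal q"
  then have "single [] c \<star> x \<in> qext_ideal q"
    by (intro ideal.I_l_closed[OF ideal_qext_ideal]) auto
  then show "c \<odot>\<^bsub>tensor_alg\<^esub> x \<in> qext_ideal q"
    using tensor_mult_scale(1)[of c "single [] 1" x] by simp
qed (simp_all add: pm.scale_right_distrib)

interpretation Q: quotient_space "qext_ideal q" tensor_alg
  by (rule quotient_space_qext)

abbreviation "cls \<equiv> qext_class q"

lemma cls_carrier: "carrier (qext q) = range cls"
proof -
  have "cls p \<in> carrier (qext q)" for p
    using Q.quot_class_closed[of p] by (simp add: qext_def qext_class_def)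
  moreover have "\<exists>p. X = cls p" if X: "X \<in> carrier (qext q)" for X
    using X[unfolded qext_def] by (rule Q.quot_carrier_cases) (auto simp: qext_class_def)
  ultimately show ?thesis by blast
qed

lemma cls_closed [simp]: "cls p \<in> carrier (qext q)"
  by (simp add: cls_carrier)

lemma cls_add: "cls p \<oplus>\<^bsub>qext q\<^esub> cls r = cls (p + r)"
  using Q.quot_add[of p r] by (simp add: qext_def qext_class_def)

lemma cls_smult: "c \<odot>\<^bsub>qext q\<^esub> cls p = cls (pm_scale c p)"
  using Q.quot_smult[of p c] by (simp add: qext_def qext_class_def)

lemma cls_zero: "\<zero>\<^bsub>qext q\<^esub> = cls 0"
  using Q.quot_zero by (simp add: qext_def qext_class_def)

lemma cls_one: "\<one>\<^bsub>qext q\<^esub> = cls (single [] 1)"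
  using Q.quot_simps(5) by (simp add: qext_def qext_class_def)

lemma cls_mult: "cls p \<otimes>\<^bsub>qext q\<^esub> cls r = cls (p \<star> r)"
  using Q.quot_simps(4) ideal.rcoset_mult_add[OF ideal_qext_ideal, of p r]
  by (simp add: qext_def qext_class_def)

lemma cls_eq_iff: "cls p = cls r \<longleftrightarrow> p - r \<in> qext_ideal q"
proof -
  have "\<ominus>\<^bsub>tensor_alg\<^esub> r = - r" by (rule Q.minus_equality) auto
  then show ?thesis using Q.quot_eq_iff[of p r] by (simp add: qext_class_def a_minus_def)
qed

lemma cls_finsum: "finite B \<Longrightarrow> finsum (qext q) (\<lambda>b. cls (f b)) B = cls (sum f B)"
  using Q.quot_finsum[of B f] finsum_tensor_alg[of B f] by (simp add: qext_def qext_class_def)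

lemma abelian_group_qext: "abelian_group (qext q)"
  unfolding qext_def by (rule Q.quot_abelian_group)

lemma tensor_space_qext: "tensor_space (qext q)"
  by (intro tensor_space.intro tensor_space_axioms.intro abelian_group_qext) (auto simp: cls_carrier cls_smult)

end

section \<open>Evaluation of a constant cocycle\<close>

lemma koszul_f_0: "koszul_f q (\<lambda>_. 0) = single [] 1"
  by (simp add: koszul_f.simps[of q "\<lambda>_. 0"])

lemma koszul_f_rec:
  "\<not> (\<forall>i. \<beta> i = 0) \<Longrightarrow> koszul_f q \<beta> = (\<Sum>j\<in>{j. \<beta> j > 0}.
     pm_scale (\<Prod>k\<in>{k. k > j}. (- q k j) ^ \<beta> k) (koszul_f q (idx_dec \<beta> j) \<star> word [j]))"
  by (subst koszul_f.simps) (simp only: if_False)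

lemma keys_koszul_f: "keys (koszul_f q \<beta>) \<subseteq> {w. length w = msize \<beta>}"
proof (induction \<beta> rule: measure_induct_rule[of msize])
  case (less \<beta>)
  show ?case
  proof (cases "\<forall>i. \<beta> i = 0")
    case True
    then have "\<beta> = (\<lambda>_. 0)" by auto
    then show ?thesis by (simp add: koszul_f_0 msize_def)
  next
    case False
    have "keys (koszul_f q (idx_dec \<beta> j) \<star> word [j]) \<subseteq> {w. length w = msize \<beta>}" if j: "\<beta> j > 0" for j
    proof -
      have "msize (idx_dec \<beta> j) + 1 = msize \<beta>"
        using j sum.remove[of UNIV j \<beta>] sum.remove[of UNIV j "idx_dec \<beta> j"] by (simp add: msize_def)
      moreover define \<beta>' where "\<beta>' = idx_dec \<beta> j"
      ultimately show ?thesis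
        using less.IH[OF msize_idx_dec[of \<beta> j, OF j]] unfolding tensor_mult_eq_lin word_def \<beta>'_def[symmetric]
        by (intro keys_lin_subset) auto
    qed
    then show ?thesis
      unfolding koszul_f_rec[OF False] by (intro keys_sum_subset keys_scale_subset) simp
  qed
qed

lemma koszul_f_unit: "koszul_f q (unit_idx i) = single [i] 1"
proof -
  have "{j. 0 < unit_idx i j} = {i}" "idx_dec (unit_idx i) i = (\<lambda>_. 0)" 
    and n: "\<not> (\<forall>j. unit_idx i j = 0)"
    by (auto simp: unit_idx_def fun_eq_iff split: if_splits)
  moreover have "(\<Prod>k | i < k. (- q k i) ^ unit_idx i k) = 1"
    by (rule prod.neutral) (auto simp: unit_idx_def)
  ultimately show ?thesis
    unfolding koszul_f_rec[OF n] by (simp add: koszul_f_0 word_def)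
qed

text \<open>In the recursion the removed index becomes the last letter. Removing the larger index
  \<open>j\<close> costs nothing; removing a smaller \<open>i\<close> picks up
  \<open>- q j i\<close> from the larger index that remains.\<close>

lemma koszul_f_pair:
  assumes "i \<le> j"
  shows "koszul_f q (idx_add (unit_idx i) (unit_idx j)) = qrel q i j"
proof -
  let ?\<beta> = "idx_add (unit_idx i) (unit_idx j)"
  have s: "{k. 0 < ?\<beta> k} = {i, j}" "\<not> (\<forall>k. ?\<beta> k = 0)" by (auto simp: unit_idx_def)
  have d: "idx_dec ?\<beta> i = unit_idx j" "idx_dec ?\<beta> j = unit_idx i"
    by (auto simp: unit_idx_def fun_eq_iff)
  have p: "(\<Prod>k | j < k. (- q k j) ^ ?\<beta> k) = 1"
    by (rule prod.neutral) (use assms in \<open>auto simp: unit_idx_def\<close>)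
  show ?thesis
  proof (cases "i = j")
    case True
    show ?thesis unfolding koszul_f_rec[OF s(2)] s(1) using p d True
      by (simp add: koszul_f_unit word_def qrel_def)
  next
    case False
    have "(\<Prod>k | i < k. (- q k i) ^ ?\<beta> k) = (\<Prod>k | i < k. if k = j then - q j i else 1)"
      by (rule prod.cong) (use False in \<open>auto simp: unit_idx_def\<close>)
    also have "\<dots> = - q j i" using assms False by simp
    finally have p': "(\<Prod>k | i < k. (- q k i) ^ ?\<beta> k) = - q j i" .
    have "koszul_f q ?\<beta> = pm_scale (- q j i) (single [j] 1 \<star> word [i]) + pm_scale 1 (single [i] 1 \<star> word [j])"
      unfolding koszul_f_rec[OF s(2)] s(1) using p p' d False by (simp add: koszul_f_unit)
    then show ?thesis using False by (simp add: word_def qrel_def single_uminus[symmetric])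
  qed
qed

text \<open>Three units that may coincide, to cover both 2[i] + [j] and [a] + [b] + [c].\<close>

lemma unit_prod:
  fixes f :: "'i::finite \<Rightarrow> 'k::field"
  shows "(\<Prod>l\<in>A. f l ^ (unit_idx a l + unit_idx b l + unit_idx c l)) =
    (if a \<in> A then f a else 1) * (if b \<in> A then f b else 1) * (if c \<in> A then f c else 1)"
proof -
  have "(\<Prod>l\<in>A. f l ^ unit_idx a l) = (if a \<in> A then f a else 1)" for a
  proof -
    have "(\<Prod>l\<in>A. f l ^ unit_idx a l) = (\<Prod>l\<in>A. if l = a then f a else 1)"
      by (rule prod.cong) (auto simp: unit_idx_def)
    then show ?thesis by simp
  qed
  then show ?thesis by (simp add: power_add prod.distrib)
qed

lemma unit_sum:
  fixes A :: "'i::finite set"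
  shows "(\<Sum>l\<in>A. unit_idx a l + unit_idx b l + unit_idx c l) =
    (if a \<in> A then 1 else 0) + (if b \<in> A then 1 else 0) + (if c \<in> A then 1 else 0)"
proof -
  have "(\<Sum>l\<in>A. unit_idx a l) = (if a \<in> A then 1 else 0)" for a
  proof -
    have "(\<Sum>l\<in>A. unit_idx a l) = (\<Sum>l\<in>A. if l = a then 1 else 0)"
      by (rule sum.cong) (auto simp: unit_idx_def)
    then show ?thesis by simp
  qed
  then show ?thesis by (simp add: sum.distrib)
qed

locale cocycle_data = linear_group_data scale v G
  for scale :: "'k::field \<Rightarrow> 'v::ab_group_add \<Rightarrow> 'v" and v :: "'i::{finite,linorder} \<Rightarrow> 'v" and G +
  fixes q :: "'i \<Rightarrow> 'i \<Rightarrow> 'k"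
    and act :: "('v \<Rightarrow> 'v) \<Rightarrow> ('i list \<Rightarrow>\<^sub>0 'k) set \<Rightarrow> ('i list \<Rightarrow>\<^sub>0 'k) set"
    and \<eta> :: "(('i list \<Rightarrow>\<^sub>0 'k) set list \<Rightarrow>\<^sub>0 'k) set \<Rightarrow> ('v \<Rightarrow> 'v) \<Rightarrow> ('i list \<Rightarrow>\<^sub>0 'k) set"
  assumes q_inv: "i \<noteq> j \<Longrightarrow> q i j * q j i = 1"
    and extends: "extends_action scale v q G act"
    and cocycle: "constant_2_cocycle q \<Gamma> act \<eta>"
begin

abbreviation "\<Lambda> \<equiv> qext q"
abbreviation "cl \<equiv> qext_class q"
abbreviation "SK \<equiv> skew \<Lambda> \<Gamma> act"

sublocale TS: tensor_space \<Lambda>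
  by (rule tensor_space_qext)

lemma carrier_cases:
  assumes "a \<in> carrier \<Lambda>" obtains p where "a = cl p"
  using assms by (auto simp: cls_carrier)

lemma cl_eq_low_degree:
  assumes "cl p = cl r"
  shows "lookup p [] = lookup r []" "lookup p [i] = lookup r [i]"
proof -
  have "p - r \<in> qext_ideal q" using assms by (simp add: cls_eq_iff)
  from qext_ideal_low_degree(1)[of q, OF q_inv this] qext_ideal_low_degree(2)[of q, OF q_inv this, of i]
  show "lookup p [] = lookup r []" "lookup p [i] = lookup r [i]" by (simp_all add: lookup_minus)
qed

lemma cl_scalar_inj: "cl (single [] c) = cl (single [] c') \<Longrightarrow> c = c'"
  using cl_eq_low_degree(1)[of "single [] c" "single [] c'"] by simp

lemma act_hom:
  assumes "g \<in> G"
  shows "act g (cl p \<oplus>\<^bsub>\<Lambda>\<^esub> cl r) = act g (cl p) \<oplus>\<^bsub>\<Lambda>\<^esub> act g (cl r)"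
    "act g (cl p \<otimes>\<^bsub>\<Lambda>\<^esub> cl r) = act g (cl p) \<otimes>\<^bsub>\<Lambda>\<^esub> act g (cl r)"
    "act g \<one>\<^bsub>\<Lambda>\<^esub> = \<one>\<^bsub>\<Lambda>\<^esub>" "act g (c \<odot>\<^bsub>\<Lambda>\<^esub> cl p) = c \<odot>\<^bsub>\<Lambda>\<^esub> act g (cl p)"
    "act g (cl (vec x)) = cl (vec (g x))" "act g (cl p) \<in> carrier \<Lambda>"
proof -
  have "act g \<in> ring_iso \<Lambda> \<Lambda>" and 1: "\<forall>c. \<forall>a\<in>carrier \<Lambda>. act g (c \<odot>\<^bsub>\<Lambda>\<^esub> a) = c \<odot>\<^bsub>\<Lambda>\<^esub> act g a"
    and 2: "\<forall>x. act g (cl (vec x)) = cl (vec (g x))"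
    using extends assms by (simp_all add: extends_action_def)
  then have h: "act g \<in> ring_hom \<Lambda> \<Lambda>" by (simp add: ring_iso_def)
  show "act g (cl p \<oplus>\<^bsub>\<Lambda>\<^esub> cl r) = act g (cl p) \<oplus>\<^bsub>\<Lambda>\<^esub> act g (cl r)"
    "act g (cl p \<otimes>\<^bsub>\<Lambda>\<^esub> cl r) = act g (cl p) \<otimes>\<^bsub>\<Lambda>\<^esub> act g (cl r)"
    "act g \<one>\<^bsub>\<Lambda>\<^esub> = \<one>\<^bsub>\<Lambda>\<^esub>" "act g (cl p) \<in> carrier \<Lambda>"
    using ring_hom_add[OF h cls_closed cls_closed] ring_hom_mult[OF h cls_closed cls_closed] ring_hom_one[OF h]
      ring_hom_closed[OF h cls_closed] by blast+
  show "act g (c \<odot>\<^bsub>\<Lambda>\<^esub> cl p) = c \<odot>\<^bsub>\<Lambda>\<^esub> act g (cl p)" "act g (cl (vec x)) = cl (vec (g x))"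
    using 1 2 cls_closed by blast+
qed

text \<open>The action on the exterior algebra is linear, multiplicative and prescribed on letters,
  so it is induced by the action on tensors. Further computations with \<open>act\<close> are made
  on representatives.\<close>

lemma act_cl:
  assumes g: "g \<in> G"
  shows "act g (cl p) = cl (tact g p)"
proof -
  have w: "act g (cl (single w 1)) = cl (tact g (single w 1))" for w
  proof (induction w)
    case Nil
    then show ?case using act_hom(3)[OF g] by (simp add: cls_one)
  next
    case (Cons i w)
    have "act g (cl (single (i # w) 1)) = act g (cl (vec (v i)) \<otimes>\<^bsub>\<Lambda>\<^esub> cl (single w 1))"
      by (simp add: cls_mult)
    also have "\<dots> = cl (vec (g (v i))) \<otimes>\<^bsub>\<Lambda>\<^esub> cl (tact g (single w 1))"
      by (simp only: act_hom(2,5)[OF g] Cons.IH)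
    finally show ?case by (simp add: cls_mult tact_Cons)
  qed
  have "act g (cl (\<Sum>w\<in>A. pm_scale (lookup p w) (single w 1))) =
     cl (\<Sum>w\<in>A. pm_scale (lookup p w) (tact g (single w 1)))" if "finite A" for A
    using that
  proof (induction A rule: finite_induct)
    case empty
    \<comment> \<open>That zero goes to zero follows from compatibility with the scalar 0.\<close>
    obtain r where "act g (cl 0) = cl r" using act_hom(6)[OF g] by (rule carrier_cases)
    then show ?case using act_hom(4)[OF g, of 0 0] by (simp add: cls_smult)
  next
    case (insert w A)
    have "act g (cl (pm_scale (lookup p w) (single w 1))) = cl (pm_scale (lookup p w) (tact g (single w 1)))"
      unfolding cls_smult[symmetric] act_hom(4)[OF g] w ..
    then show ?case using insert by (simp add: act_hom(1)[OF g] flip: cls_add del: pm_scale_single)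
  qed
  from this[of "keys p"] show ?thesis
    using lin_singles[of p] pm_linear_eq_lin[OF linear_tact, of g p] by (simp add: lin_def del: lin_singles)
qed

text \<open>Reduction of coefficients from tensors to the exterior algebra. It is multiplicative
  (\<open>skcl_mult\<close>), so products in the target can be computed in \<open>S\<close>.\<close>

definition skcl :: "(('v \<Rightarrow> 'v) \<Rightarrow> ('i list \<Rightarrow>\<^sub>0 'k)) \<Rightarrow> (('v \<Rightarrow> 'v) \<Rightarrow> ('i list \<Rightarrow>\<^sub>0 'k) set)" where
  "skcl x = (\<lambda>g\<in>G. cl (x g))"

lemma skcl_apply [simp]: "g \<in> G \<Longrightarrow> skcl x g = cl (x g)"
  by (simp add: skcl_def)

lemma skcl_mult: "skcl x \<otimes>\<^bsub>SK\<^esub> skcl y = skcl (x \<otimes>\<^bsub>S\<^esub> y)"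
proof -
  have "(\<Oplus>\<^bsub>\<Lambda>\<^esub>h\<in>G. skcl x h \<otimes>\<^bsub>\<Lambda>\<^esub> act h (skcl y (inv\<^bsub>\<Gamma>\<^esub> h \<circ> g))) =
     cl (\<Sum>h\<in>G. x h \<star> tact h (y (inv\<^bsub>\<Gamma>\<^esub> h \<circ> g)))" if g: "g \<in> G" for g
  proof -
    have "(\<Oplus>\<^bsub>\<Lambda>\<^esub>h\<in>G. skcl x h \<otimes>\<^bsub>\<Lambda>\<^esub> act h (skcl y (inv\<^bsub>\<Gamma>\<^esub> h \<circ> g))) =
      (\<Oplus>\<^bsub>\<Lambda>\<^esub>h\<in>G. cl (x h \<star> tact h (y (inv\<^bsub>\<Gamma>\<^esub> h \<circ> g))))"
      by (rule TS.finsum_cong') (use g in \<open>auto simp: act_cl cls_mult\<close>)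
    then show ?thesis by (simp add: cls_finsum finite_G)
  qed
  then show ?thesis
    unfolding S_mult skew_def skcl_def[of "restrict _ _"] by (auto intro!: restrict_ext)
qed

lemma skew_elt_skcl: "skew_elt \<Lambda> \<Gamma> (cl p) g = skcl (welt p g)"
  by (rule ext) (simp add: skew_elt_def skcl_def welt_def cls_zero)

lemma group_alg_elt_skcl: "group_alg_elt \<Lambda> \<Gamma> c = skcl (\<lambda>g\<in>G. single [] (c g))"
  by (rule ext) (simp add: group_alg_elt_def skcl_def cls_one cls_smult)

text \<open>A representative of a \<otimes> p \<otimes> b in the free space on tuples:
  \<open>p\<close> is read letter by letter, while \<open>a\<close> and \<open>b\<close> matter only
  through their classes.\<close>

definition tens :: "('i list \<Rightarrow>\<^sub>0 'k) \<Rightarrow> ('i list \<Rightarrow>\<^sub>0 'k) \<Rightarrow> ('i list \<Rightarrow>\<^sub>0 'k) \<Rightarrow> (('i list \<Rightarrow>\<^sub>0 'k) set list \<Rightarrow>\<^sub>0 'k)" where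
  "tens a b p = lin (\<lambda>w. single ([cl a] @ map (\<lambda>i. cl (single [i] 1)) w @ [cl b]) 1) p"

lemma tens_closed: "keys p \<subseteq> {w. length w = m} \<Longrightarrow> tens a b p \<in> carrier (TS.F (m + 2))"
  unfolding tens_def by (intro TS.F_lin TS.F_single) auto

lemma koszul_eps_tens: "koszul_eps q \<beta> = TS.tcls (msize \<beta> + 2) (tens (single [] 1) (single [] 1) (koszul_f q \<beta>))"
proof -
  let ?m = "msize \<beta> + 2" and ?f = "koszul_f q \<beta>"
  let ?t = "\<lambda>w. single ([cl (single [] 1)] @ map (\<lambda>i. cl (single [i] 1)) w @ [cl (single [] 1)]) (1::'k)"
  have c: "?t w \<in> carrier (TS.F ?m)" if "w \<in> keys ?f" for w
    by (rule TS.F_single) (use that keys_koszul_f[of q \<beta>] in auto)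
  have "koszul_eps q \<beta> = (\<Oplus>\<^bsub>TS.T ?m\<^esub>w\<in>keys ?f. lookup ?f w \<odot>\<^bsub>TS.T ?m\<^esub> pure_tensor \<Lambda>
      ([\<one>\<^bsub>\<Lambda>\<^esub>] @ map (\<lambda>i. cl (word [i])) w @ [\<one>\<^bsub>\<Lambda>\<^esub>]))"
    by (simp add: koszul_eps_def Let_def)
  also have "\<dots> = TS.tcls ?m (\<Sum>w\<in>keys ?f. pm_scale (lookup ?f w) (?t w))"
  proof (rule TS.T_finsum_cong)
    fix w assume w: "w \<in> keys ?f"
    then have l: "length w = msize \<beta>" using keys_koszul_f[of q \<beta>] by blast
    show "pm_scale (lookup ?f w) (?t w) \<in> carrier (TS.F ?m)" by (intro TS.F_scale c w)
    show "lookup ?f w \<odot>\<^bsub>TS.T ?m\<^esub> pure_tensor \<Lambda> ([\<one>\<^bsub>\<Lambda>\<^esub>] @ map (\<lambda>i. cl (word [i])) w @ [\<one>\<^bsub>\<Lambda>\<^esub>]) =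
        TS.tcls ?m (pm_scale (lookup ?f w) (?t w))"
      using TS.T_smult[OF c[OF w], of "lookup ?f w"] l
      by (simp add: TS.pure_tensor_tcls word_def cls_one del: pm_scale_single)
  qed simp
  finally show ?thesis by (simp add: tens_def lin_def)
qed

lemma slot_linear_mult: "TS.slot_linear (\<lambda>x. cl a \<otimes>\<^bsub>\<Lambda>\<^esub> x)" "TS.slot_linear (\<lambda>x. x \<otimes>\<^bsub>\<Lambda>\<^esub> cl a)"
  by (auto simp: TS.slot_linear_def cls_carrier cls_mult cls_smult cls_add tensor_mult_add tensor_mult_scale)

lemma slot_linear_act: "g \<in> G \<Longrightarrow> TS.slot_linear (act g)"
  by (auto simp: TS.slot_linear_def cls_carrier cls_smult cls_add act_cl tact_add tact_scale)

lemma lact_tens: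
  assumes "keys p \<subseteq> {w. length w = m}"
  shows "tensor_lact \<Lambda> (m + 2) (cl a') (TS.tcls (m + 2) (tens a b p)) = TS.tcls (m + 2) (tens (a' \<star> a) b p)"
proof -
  have "tensor_lact \<Lambda> (m + 2) (cl a') (TS.tcls (m + 2) (tens a b p)) =
    TS.tcls (m + 2) (lin (\<lambda>xs. single ((cl a' \<otimes>\<^bsub>\<Lambda>\<^esub> hd xs) # tl xs) 1) (tens a b p))"
    unfolding tensor_lact_def
    by (rule TS.tensor_map_tcls[OF TS.slotwise_hd[OF slot_linear_mult(1)] tens_closed[OF assms]]) simp
  then show ?thesis by (simp add: tens_def pm_linear_lin_eq[OF pm_linear_lin] cls_mult)
qed

lemma ract_tens:
  assumes "keys p \<subseteq> {w. length w = m}"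
  shows "tensor_ract \<Lambda> (m + 2) (TS.tcls (m + 2) (tens a b p)) (cl b') = TS.tcls (m + 2) (tens a (b \<star> b') p)"
proof -
  have "tensor_ract \<Lambda> (m + 2) (TS.tcls (m + 2) (tens a b p)) (cl b') =
    TS.tcls (m + 2) (lin (\<lambda>xs. single (butlast xs @ [last xs \<otimes>\<^bsub>\<Lambda>\<^esub> cl b']) 1) (tens a b p))"
    unfolding tensor_ract_def
    by (rule TS.tensor_map_tcls[OF TS.slotwise_last[OF slot_linear_mult(2)] tens_closed[OF assms]]) simp
  then show ?thesis by (simp add: tens_def pm_linear_lin_eq[OF pm_linear_lin] cls_mult butlast_append)
qed

text \<open>\<open>bimodule_hom\<close> speaks of sums and of the two actions, so a scalar reaches a
  homomorphism through an outer factor, into which it is moved here.\<close>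

lemma tens_scale:
  assumes p: "keys p \<subseteq> {w. length w = m}"
  shows "TS.tcls (m + 2) (pm_scale c (tens a b p)) = TS.tcls (m + 2) (tens (pm_scale c a) b p)"
    "TS.tcls (m + 2) (pm_scale c (tens a b p)) = TS.tcls (m + 2) (tens a (pm_scale c b) p)"
proof -
  let ?l = "\<lambda>w. map (\<lambda>i. cl (single [i] 1)) w"
  have 1: "tens (pm_scale c a) b p - pm_scale c (tens a b p) =
    lin (\<lambda>w. single ([] @ (c \<odot>\<^bsub>\<Lambda>\<^esub> cl a) # (?l w @ [cl b])) 1 - single ([] @ cl a # (?l w @ [cl b])) c) p"
    by (simp add: tens_def lin_def cls_smult sum_subtractf pm.scale_right_diff_distrib pm_scale_sum mult.commute)
  have 2: "tens a (pm_scale c b) p - pm_scale c (tens a b p) =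
    lin (\<lambda>w. single ((cl a # ?l w) @ (c \<odot>\<^bsub>\<Lambda>\<^esub> cl b) # []) 1 - single ((cl a # ?l w) @ cl b # []) c) p"
    by (simp add: tens_def lin_def cls_smult sum_subtractf pm.scale_right_diff_distrib pm_scale_sum mult.commute)
  have r1: "tens (pm_scale c a) b p - pm_scale c (tens a b p) \<in> TS.R (m + 2)"
    unfolding 1 by (intro TS.R_lin TS.R_slot_smult) (use p in auto)
  have r2: "tens a (pm_scale c b) p - pm_scale c (tens a b p) \<in> TS.R (m + 2)"
    unfolding 2 by (intro TS.R_lin TS.R_slot_smult) (use p in auto)
  note cl = tens_closed[OF p]
  show "TS.tcls (m + 2) (pm_scale c (tens a b p)) = TS.tcls (m + 2) (tens (pm_scale c a) b p)"
    by (rule sym, rule TS.tcls_eqI[OF cl TS.F_scale[OF cl] r1])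
  show "TS.tcls (m + 2) (pm_scale c (tens a b p)) = TS.tcls (m + 2) (tens a (pm_scale c b) p)"
    by (rule sym, rule TS.tcls_eqI[OF cl TS.F_scale[OF cl] r2])
qed

lemma tens_in_koszul:
  assumes "msize \<beta> = m"
  shows "TS.tcls (m + 2) (tens a b (koszul_f q \<beta>)) \<in> carrier (koszul q m)"
proof -
  have k: "keys (koszul_f q \<beta>) \<subseteq> {w. length w = m}" using keys_koszul_f assms by blast
  have "TS.tcls (m + 2) (tens a b (koszul_f q \<beta>)) =
    tensor_ract \<Lambda> (m + 2) (tensor_lact \<Lambda> (m + 2) (cl a) (koszul_eps q \<beta>)) (cl b)"
    using assms lact_tens[OF k, of a "single [] 1"] ract_tens[OF k, of _ "single [] 1" b] by (simp add: koszul_eps_tens)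
  then show ?thesis unfolding koszul_def partial_object.simps
    by (intro generate.incl) (use assms cls_closed in blast)
qed

lemma \<eta>_hom: "\<eta> \<in> bimodule_hom \<Lambda> (koszul q 2) (skew_bimodule \<Lambda> \<Gamma> act)"
  by (rule cocycle[unfolded constant_2_cocycle_def Let_def, THEN conjunct1])

lemma \<eta>_add: "x \<in> carrier (koszul q 2) \<Longrightarrow> y \<in> carrier (koszul q 2) \<Longrightarrow> \<eta> (x \<oplus>\<^bsub>TS.T 4\<^esub> y) = \<eta> x \<oplus>\<^bsub>SK\<^esub> \<eta> y"
  and \<eta>_closed: "x \<in> carrier (koszul q 2) \<Longrightarrow> \<eta> x \<in> carrier SK"
  and \<eta>_lact: "a \<in> carrier \<Lambda> \<Longrightarrow> x \<in> carrier (koszul q 2) \<Longrightarrow>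
    \<eta> (tensor_lact \<Lambda> 4 a x) = skew_elt \<Lambda> \<Gamma> a \<one>\<^bsub>\<Gamma>\<^esub> \<otimes>\<^bsub>SK\<^esub> \<eta> x"
  and \<eta>_ract: "a \<in> carrier \<Lambda> \<Longrightarrow> x \<in> carrier (koszul q 2) \<Longrightarrow>
    \<eta> (tensor_ract \<Lambda> 4 x a) = \<eta> x \<otimes>\<^bsub>SK\<^esub> skew_elt \<Lambda> \<Gamma> a \<one>\<^bsub>\<Gamma>\<^esub>"
  using \<eta>_hom by (simp_all add: bimodule_hom_def koszul_def skew_bimodule_def Pi_iff)

text \<open>The coefficients are chosen, but on G they are determined by the value of
  \<open>\<eta>\<close>, because distinct scalars stay distinct in the exterior algebra
  (\<open>ev_eqI\<close>).\<close>

definition ev :: "('i \<Rightarrow> nat) \<Rightarrow> ('v \<Rightarrow> 'v) \<Rightarrow> 'k" where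
  "ev \<beta> = (SOME c. \<eta> (koszul_eps q \<beta>) = group_alg_elt \<Lambda> \<Gamma> c)"

lemma \<eta>_eps: "msize \<beta> = 2 \<Longrightarrow> \<eta> (koszul_eps q \<beta>) = group_alg_elt \<Lambda> \<Gamma> (ev \<beta>)"
proof -
  assume b: "msize \<beta> = 2"
  have "\<eta> (koszul_eps q \<beta>) \<in> range (group_alg_elt \<Lambda> \<Gamma>)"
    by (rule cocycle[unfolded constant_2_cocycle_def Let_def, THEN conjunct2, THEN conjunct2, THEN conjunct1,
          rule_format, OF b])
  then have "\<exists>c. \<eta> (koszul_eps q \<beta>) = group_alg_elt \<Lambda> \<Gamma> c" by (simp add: image_iff)
  then show ?thesis unfolding ev_def by (rule someI_ex)
qed

lemma ev_eqI:
  assumes "msize \<beta> = 2" "\<eta> (koszul_eps q \<beta>) = group_alg_elt \<Lambda> \<Gamma> c" "g \<in> G"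
  shows "ev \<beta> g = c g"
proof -
  have "skcl (\<lambda>g\<in>G. single [] (ev \<beta> g)) g = skcl (\<lambda>g\<in>G. single [] (c g)) g"
    using \<eta>_eps[OF assms(1)] assms(2) by (simp only: group_alg_elt_skcl)
  then have "cl (single [] (ev \<beta> g)) = cl (single [] (c g))" using assms(3) by (simp only: skcl_apply restrict_apply')
  then show ?thesis by (rule cl_scalar_inj)
qed

lemma welt_id_mult:
  "g \<in> G \<Longrightarrow> (welt a id \<otimes>\<^bsub>S\<^esub> x) g = a \<star> x g"
  "g \<in> G \<Longrightarrow> (x \<otimes>\<^bsub>S\<^esub> welt a id) g = x g \<star> tact g a"
proof -
  assume g: "g \<in> G"
  have "(welt a id \<otimes>\<^bsub>S\<^esub> x) g = (\<Sum>h\<in>G. if h = id then a \<star> x g else 0)"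
    unfolding S_mult using g \<Gamma>.inv_one by (auto simp: welt_def intro!: sum.cong simp del: \<Gamma>.inv_one)
  then show "(welt a id \<otimes>\<^bsub>S\<^esub> x) g = a \<star> x g" by (simp add: finite_G)
  have eq: "inv\<^bsub>\<Gamma>\<^esub> h \<circ> g = id \<longleftrightarrow> h = g" if "h \<in> G" for h
    by (metis that g G_inv_comp(2) G_inv_comp_assoc(1) comp_id)
  have "(x \<otimes>\<^bsub>S\<^esub> welt a id) g = (\<Sum>h\<in>G. if h = g then x g \<star> tact g a else 0)"
    unfolding S_mult using g by (auto simp: welt_def eq intro!: sum.cong)
  then show "(x \<otimes>\<^bsub>S\<^esub> welt a id) g = x g \<star> tact g a" using g by (simp add: finite_G)
qed

lemma welt_one_mult:
  assumes "h \<in> G" "g \<in> G"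
  shows "(welt (single [] 1) h \<otimes>\<^bsub>S\<^esub> x) g = tact h (x (inv\<^bsub>\<Gamma>\<^esub> h \<circ> g))"
    "(x \<otimes>\<^bsub>S\<^esub> welt (single [] 1) (inv\<^bsub>\<Gamma>\<^esub> h)) g = x (g \<circ> h)"
proof -
  have "(welt (single [] 1) h \<otimes>\<^bsub>S\<^esub> x) g = (\<Sum>l\<in>G. if l = h then tact h (x (inv\<^bsub>\<Gamma>\<^esub> h \<circ> g)) else 0)"
    unfolding S_mult using assms by (auto simp: welt_def intro!: sum.cong)
  then show "(welt (single [] 1) h \<otimes>\<^bsub>S\<^esub> x) g = tact h (x (inv\<^bsub>\<Gamma>\<^esub> h \<circ> g))" using assms by (simp add: finite_G)
  have eq: "inv\<^bsub>\<Gamma>\<^esub> l \<circ> g = inv\<^bsub>\<Gamma>\<^esub> h \<longleftrightarrow> l = g \<circ> h" if l: "l \<in> G" for l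
  proof
    assume "inv\<^bsub>\<Gamma>\<^esub> l \<circ> g = inv\<^bsub>\<Gamma>\<^esub> h"
    then have "g = l \<circ> inv\<^bsub>\<Gamma>\<^esub> h" using l by (metis G_inv_comp_assoc(1))
    then show "l = g \<circ> h" using assms by (simp add: comp_assoc)
  next
    assume "l = g \<circ> h"
    then have "g = l \<circ> inv\<^bsub>\<Gamma>\<^esub> h" using assms by (simp add: comp_assoc)
    then show "inv\<^bsub>\<Gamma>\<^esub> l \<circ> g = inv\<^bsub>\<Gamma>\<^esub> h" using l by simp
  qed
  have "(x \<otimes>\<^bsub>S\<^esub> welt (single [] 1) (inv\<^bsub>\<Gamma>\<^esub> h)) g = (\<Sum>l\<in>G. if l = g \<circ> h then x (g \<circ> h) else 0)"
    unfolding S_mult using assms by (auto simp: welt_def eq intro!: sum.cong)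
  then show "(x \<otimes>\<^bsub>S\<^esub> welt (single [] 1) (inv\<^bsub>\<Gamma>\<^esub> h)) g = x (g \<circ> h)" using assms by (simp add: finite_G)
qed

text \<open>By the bimodule property the value is a c b with c in KG. Moving \<open>b\<close> to the
  left of \<open>g\<close> replaces it by its translate under \<open>g\<close>.\<close>

lemma \<eta>_tens:
  assumes \<beta>: "msize \<beta> = 2" and g: "g \<in> G"
  shows "\<eta> (TS.tcls 4 (tens a b (koszul_f q \<beta>))) g = cl (pm_scale (ev \<beta> g) (a \<star> tact g b))"
proof -
  have k: "keys (koszul_f q \<beta>) \<subseteq> {w. length w = 2}" using keys_koszul_f \<beta> by metis
  have cl: "TS.tcls 4 (tens a b (koszul_f q \<beta>)) \<in> carrier (koszul q 2)" for a b
    using tens_in_koszul[OF \<beta>] by simp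
  have "TS.tcls 4 (tens a b (koszul_f q \<beta>)) = tensor_ract \<Lambda> 4 (tensor_lact \<Lambda> 4 (cl a) (koszul_eps q \<beta>)) (cl b)"
    using \<beta> lact_tens[OF k, of a "single [] 1"] ract_tens[OF k, of _ "single [] 1" b] by (simp add: koszul_eps_tens)
  moreover have "tensor_lact \<Lambda> 4 (cl a) (koszul_eps q \<beta>) \<in> carrier (koszul q 2)" "koszul_eps q \<beta> \<in> carrier (koszul q 2)"
    using \<beta> lact_tens[OF k, of a "single [] 1"] cl by (simp_all add: koszul_eps_tens)
  ultimately have "\<eta> (TS.tcls 4 (tens a b (koszul_f q \<beta>))) =
     skew_elt \<Lambda> \<Gamma> (cl a) \<one>\<^bsub>\<Gamma>\<^esub> \<otimes>\<^bsub>SK\<^esub> \<eta> (koszul_eps q \<beta>) \<otimes>\<^bsub>SK\<^esub> skew_elt \<Lambda> \<Gamma> (cl b) \<one>\<^bsub>\<Gamma>\<^esub>"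
    by (simp add: \<eta>_ract \<eta>_lact)
  also have "\<dots> = skcl (welt a id \<otimes>\<^bsub>S\<^esub> (\<lambda>g\<in>G. single [] (ev \<beta> g)) \<otimes>\<^bsub>S\<^esub> welt b id)"
    by (simp add: \<eta>_eps[OF \<beta>] skew_elt_skcl group_alg_elt_skcl skcl_mult)
  finally have "\<eta> (TS.tcls 4 (tens a b (koszul_f q \<beta>))) g = cl ((a \<star> single [] (ev \<beta> g)) \<star> tact g b)"
    using g by (simp add: welt_id_mult)
  moreover have "a \<star> single [] (ev \<beta> g) = pm_scale (ev \<beta> g) a"
    using tensor_mult_scale(2)[of a "ev \<beta> g" "single [] 1"] by simp
  ultimately show ?thesis by (simp add: tensor_mult_scale)
qed

lemma SK_add: "g \<in> G \<Longrightarrow> (x \<oplus>\<^bsub>SK\<^esub> y) g = x g \<oplus>\<^bsub>\<Lambda>\<^esub> y g"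
  by (simp add: skew_def)

text \<open>Membership in the resolution is carried through the induction because additivity of
  \<open>\<eta>\<close> is given only there.\<close>

lemma \<eta>_sum:
  assumes "finite B" "\<And>x. x \<in> B \<Longrightarrow> p x \<in> carrier (TS.F 4)" "\<And>x. x \<in> B \<Longrightarrow> TS.tcls 4 (p x) \<in> carrier (koszul q 2)"
    and "\<And>x g. x \<in> B \<Longrightarrow> g \<in> G \<Longrightarrow> \<eta> (TS.tcls 4 (p x)) g = cl (r x g)"
  shows "TS.tcls 4 (\<Sum>x\<in>B. p x) \<in> carrier (koszul q 2) \<and> (\<forall>g\<in>G. \<eta> (TS.tcls 4 (\<Sum>x\<in>B. p x)) g = cl (\<Sum>x\<in>B. r x g))"
  using assms
proof (induction B rule: finite_induct)
  case empty
  have z: "TS.tcls 4 0 \<in> carrier (koszul q 2)"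
    using generate.one[of "add_monoid (TS.T 4)"] by (simp add: koszul_def TS.T_zero)
  have "\<eta> (TS.tcls 4 0) g = cl 0" if g: "g \<in> G" for g
  proof -
    \<comment> \<open>The value at zero equals its own double, hence it is the class of 0.\<close>
    have "TS.tcls 4 0 \<oplus>\<^bsub>TS.T 4\<^esub> TS.tcls 4 0 = TS.tcls 4 0"
      using TS.T_add[OF TS.F_zero TS.F_zero] by simp
    then have "\<eta> (TS.tcls 4 0) g = \<eta> (TS.tcls 4 0) g \<oplus>\<^bsub>\<Lambda>\<^esub> \<eta> (TS.tcls 4 0) g"
      using arg_cong[OF \<eta>_add[OF z z], of "\<lambda>x. x g"] unfolding SK_add[OF g] by (simp only:)
    moreover have "\<eta> (TS.tcls 4 0) g \<in> carrier \<Lambda>" using \<eta>_closed[OF z] g by (auto simp: skew_def)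
    then obtain s where "\<eta> (TS.tcls 4 0) g = cl s" by (rule carrier_cases)
    ultimately have "cl s = cl (s + s)" "\<eta> (TS.tcls 4 0) g = cl s" by (simp_all add: cls_add)
    then have "- s \<in> qext_ideal q" by (simp add: cls_eq_iff)
    then have "cl 0 = cl s" by (simp add: cls_eq_iff)
    then show ?thesis using \<open>\<eta> (TS.tcls 4 0) g = cl s\<close> by simp
  qed
  then show ?case using z by simp
next
  case (insert x B)
  have IH: "TS.tcls 4 (\<Sum>x\<in>B. p x) \<in> carrier (koszul q 2)" "\<forall>g\<in>G. \<eta> (TS.tcls 4 (\<Sum>x\<in>B. p x)) g = cl (\<Sum>x\<in>B. r x g)"
    using insert by auto
  have px: "p x \<in> carrier (TS.F 4)" "TS.tcls 4 (p x) \<in> carrier (koszul q 2)" using insert.prems by auto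
  have s: "TS.tcls 4 (\<Sum>x\<in>insert x B. p x) = TS.tcls 4 (p x) \<oplus>\<^bsub>TS.T 4\<^esub> TS.tcls 4 (\<Sum>x\<in>B. p x)"
    using insert.hyps by (subst TS.T_add[OF px(1) TS.F_sum]) (use insert.prems in auto)
  have 1: "TS.tcls 4 (\<Sum>x\<in>insert x B. p x) \<in> carrier (koszul q 2)"
    unfolding s using IH(1) px(2) generate.eng[of _ "add_monoid (TS.T 4)"] by (simp add: koszul_def)
  have "\<eta> (TS.tcls 4 (\<Sum>x\<in>insert x B. p x)) g = cl (\<Sum>x\<in>insert x B. r x g)" if g: "g \<in> G" for g
  proof -
    have "\<eta> (TS.tcls 4 (\<Sum>x\<in>insert x B. p x)) g = \<eta> (TS.tcls 4 (p x)) g \<oplus>\<^bsub>\<Lambda>\<^esub> \<eta> (TS.tcls 4 (\<Sum>x\<in>B. p x)) g"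
      unfolding s \<eta>_add[OF px(2) IH(1)] using g by (simp add: skew_def)
    then show ?thesis using IH(2) insert.prems(3)[of x g] g insert.hyps by (simp add: cls_add)
  qed
  with 1 show ?case by blast
qed

end

section \<open>The cocycle condition in coordinates\<close>

context cocycle_data begin

lemma \<eta>_koszul_d:
  assumes \<beta>: "msize \<beta> = 3"
  shows "\<eta> (koszul_d_eps q \<beta>) = \<zero>\<^bsub>SK\<^esub>"
proof -
  obtain d where d: "koszul_differential q 3 d" "\<forall>x\<in>carrier (koszul q 3). \<eta> (d x) = \<zero>\<^bsub>SK\<^esub>"
    using cocycle[unfolded constant_2_cocycle_def Let_def, THEN conjunct2, THEN conjunct1] by blast
  have "koszul_eps q \<beta> \<in> carrier (koszul q 3)"
    using tens_in_koszul[OF \<beta>] \<beta> by (simp add: koszul_eps_tens)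
  moreover have "d (koszul_eps q \<beta>) = koszul_d_eps q \<beta>"
    using d(1) \<beta> by (simp add: koszul_differential_def)
  ultimately show ?thesis using d(2) by metis
qed

definition dsign :: "('i \<Rightarrow> nat) \<Rightarrow> 'i \<Rightarrow> 'k" where
  "dsign \<beta> j = (-1) ^ (\<Sum>l\<in>{l. l < j}. \<beta> l)"

definition dleft :: "('i \<Rightarrow> nat) \<Rightarrow> 'i \<Rightarrow> 'k" where
  "dleft \<beta> j = (\<Prod>l\<in>{l. l < j}. q j l ^ \<beta> l)"

definition dright :: "('i \<Rightarrow> nat) \<Rightarrow> 'i \<Rightarrow> 'k" where
  "dright \<beta> j = (-1) ^ \<beta> j * (\<Prod>l\<in>{l. l > j}. q l j ^ \<beta> l)"

lemma msize_idx_dec_Suc: "\<beta> j > 0 \<Longrightarrow> msize (idx_dec \<beta> j) + 1 = msize \<beta>"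
  for \<beta> :: "'i \<Rightarrow> nat"
  using sum.remove[of UNIV j \<beta>] sum.remove[of UNIV j "idx_dec \<beta> j"] by (simp add: msize_def)

text \<open>The cocycle condition, evaluated at the coefficient of \<open>v\<^sub>k g\<close>.\<close>

lemma cocycle_coefficient:
  assumes \<beta>: "msize \<beta> = 3" and g: "g \<in> G"
  shows "(\<Sum>j | \<beta> j > 0. dsign \<beta> j * ev (idx_dec \<beta> j) g *
    (dleft \<beta> j * (if k = j then 1 else 0) + dright \<beta> j * crd (g (v j)) k)) = 0"
proof -
  let ?J = "{j. \<beta> j > 0}"
  let ?f = "\<lambda>j. koszul_f q (idx_dec \<beta> j)"
  let ?x = "\<lambda>j. single [j] (1::'k)"
  let ?u = "single [] (1::'k)"
  define a where "a j = tens (pm_scale (dsign \<beta> j * dleft \<beta> j) (?x j)) ?u (?f j)" for j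
  define b where "b j = tens ?u (pm_scale (dsign \<beta> j * dright \<beta> j) (?x j)) (?f j)" for j
  have m: "msize (idx_dec \<beta> j) = 2" if "j \<in> ?J" for j
    using msize_idx_dec_Suc[of \<beta> j] that \<beta> by simp
  have kf: "keys (?f j) \<subseteq> {w. length w = 2}" if "j \<in> ?J" for j
    using keys_koszul_f[of q "idx_dec \<beta> j"] m[OF that] by simp
  have c4: "tens p r (?f j) \<in> carrier (TS.F 4)" if "j \<in> ?J" for p r j
    using tens_closed[OF kf[OF that]] by simp
  have ab: "a j \<in> carrier (TS.F 4)" "b j \<in> carrier (TS.F 4)" if "j \<in> ?J" for j
    unfolding a_def b_def by (intro c4 that)+
  have D: "koszul_d_eps q \<beta> = TS.tcls 4 (\<Sum>j\<in>?J. a j + b j)"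
  proof -
    have "koszul_d_eps q \<beta> = (\<Oplus>\<^bsub>TS.T 4\<^esub>j\<in>?J. dsign \<beta> j \<odot>\<^bsub>TS.T 4\<^esub>
        ((dleft \<beta> j \<odot>\<^bsub>TS.T 4\<^esub> tensor_lact \<Lambda> 4 (cl (word [j])) (koszul_eps q (idx_dec \<beta> j))) \<oplus>\<^bsub>TS.T 4\<^esub>
         (dright \<beta> j \<odot>\<^bsub>TS.T 4\<^esub> tensor_ract \<Lambda> 4 (koszul_eps q (idx_dec \<beta> j)) (cl (word [j])))))"
      by (simp add: koszul_d_eps_def Let_def \<beta> dsign_def dleft_def dright_def)
    also have "\<dots> = TS.tcls 4 (\<Sum>j\<in>?J. a j + b j)"
    proof (rule TS.T_finsum_cong)
      fix j assume j: "j \<in> ?J"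
      have e: "koszul_eps q (idx_dec \<beta> j) = TS.tcls 4 (tens ?u ?u (?f j))"
        using koszul_eps_tens[of "idx_dec \<beta> j"] m[OF j] by simp
      have l: "tensor_lact \<Lambda> 4 (cl (word [j])) (koszul_eps q (idx_dec \<beta> j)) = TS.tcls 4 (tens (?x j) ?u (?f j))"
        unfolding e using lact_tens[OF kf[OF j], of "?x j" ?u ?u] by (simp add: word_def)
      have r: "tensor_ract \<Lambda> 4 (koszul_eps q (idx_dec \<beta> j)) (cl (word [j])) = TS.tcls 4 (tens ?u (?x j) (?f j))"
        unfolding e using ract_tens[OF kf[OF j], of ?u ?u "?x j"] by (simp add: word_def)
      have s1: "TS.tcls 4 (pm_scale c (tens (?x j) ?u (?f j))) = TS.tcls 4 (tens (pm_scale c (?x j)) ?u (?f j))" for c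
        using tens_scale(1)[OF kf[OF j]] by simp
      have s2: "TS.tcls 4 (pm_scale c (tens ?u (?x j) (?f j))) = TS.tcls 4 (tens ?u (pm_scale c (?x j)) (?f j))" for c
        using tens_scale(2)[OF kf[OF j]] by simp
      note F = c4[OF j] TS.F_scale[OF c4[OF j]]
      have "dsign \<beta> j \<odot>\<^bsub>TS.T 4\<^esub> ((dleft \<beta> j \<odot>\<^bsub>TS.T 4\<^esub> TS.tcls 4 (tens (?x j) ?u (?f j))) \<oplus>\<^bsub>TS.T 4\<^esub>
         (dright \<beta> j \<odot>\<^bsub>TS.T 4\<^esub> TS.tcls 4 (tens ?u (?x j) (?f j)))) =
        TS.tcls 4 (pm_scale (dsign \<beta> j) (pm_scale (dleft \<beta> j) (tens (?x j) ?u (?f j)) + pm_scale (dright \<beta> j) (tens ?u (?x j) (?f j))))"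
        using F by (simp add: TS.T_smult TS.T_add TS.F_add del: TS.F_simps(1))
      also have "\<dots> = TS.tcls 4 (pm_scale (dsign \<beta> j * dleft \<beta> j) (tens (?x j) ?u (?f j))) \<oplus>\<^bsub>TS.T 4\<^esub>
          TS.tcls 4 (pm_scale (dsign \<beta> j * dright \<beta> j) (tens ?u (?x j) (?f j)))"
        using F by (simp add: TS.T_add pm.scale_right_distrib del: TS.F_simps(1))
      also have "\<dots> = TS.tcls 4 (a j + b j)"
        unfolding s1 s2 a_def[symmetric] b_def[symmetric] by (rule TS.T_add[OF ab[OF j]])
      finally show "dsign \<beta> j \<odot>\<^bsub>TS.T 4\<^esub>
        ((dleft \<beta> j \<odot>\<^bsub>TS.T 4\<^esub> tensor_lact \<Lambda> 4 (cl (word [j])) (koszul_eps q (idx_dec \<beta> j))) \<oplus>\<^bsub>TS.T 4\<^esub>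
         (dright \<beta> j \<odot>\<^bsub>TS.T 4\<^esub> tensor_ract \<Lambda> 4 (koszul_eps q (idx_dec \<beta> j)) (cl (word [j])))) = TS.tcls 4 (a j + b j)"
        unfolding l r .
      show "a j + b j \<in> carrier (TS.F 4)" by (rule TS.F_add[OF ab[OF j]])
    qed simp
    finally show ?thesis .
  qed
  \<comment> \<open>The contribution of \<open>j\<close> at \<open>h\<close>: in \<epsilon> v_j the
    letter has to cross \<open>h\<close>, which makes the image of v_j under \<open>h\<close>
    appear, while in v_j \<epsilon> it already stands on the left.\<close>
  define r where "r j h = pm_scale (ev (idx_dec \<beta> j) h * dsign \<beta> j)
     (pm_scale (dleft \<beta> j) (?x j) + pm_scale (dright \<beta> j) (vec (h (v j))))" for j h
  have "TS.tcls 4 (\<Sum>j\<in>?J. a j + b j) \<in> carrier (koszul q 2) \<and>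
      (\<forall>h\<in>G. \<eta> (TS.tcls 4 (\<Sum>j\<in>?J. a j + b j)) h = cl (\<Sum>j\<in>?J. r j h))"
  proof (rule \<eta>_sum)
    fix j assume j: "j \<in> ?J"
    show "a j + b j \<in> carrier (TS.F 4)" by (rule TS.F_add[OF ab[OF j]])
    have s: "TS.tcls 4 (a j + b j) = TS.tcls 4 (a j) \<oplus>\<^bsub>TS.T 4\<^esub> TS.tcls 4 (b j)" by (rule TS.T_add[OF ab[OF j], symmetric])
    have ka: "TS.tcls 4 (a j) \<in> carrier (koszul q 2)" and kb: "TS.tcls 4 (b j) \<in> carrier (koszul q 2)"
      unfolding a_def b_def using tens_in_koszul[OF m[OF j]] by simp_all
    show "TS.tcls 4 (a j + b j) \<in> carrier (koszul q 2)"
      unfolding s using ka kb generate.eng[of _ "add_monoid (TS.T 4)"] by (simp add: koszul_def)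
    fix h assume h: "h \<in> G"
    show "\<eta> (TS.tcls 4 (a j + b j)) h = cl (r j h)"
      unfolding s \<eta>_add[OF ka kb] SK_add[OF h] unfolding a_def b_def \<eta>_tens[OF m[OF j] h] cls_add
      by (simp add: r_def tensor_mult_scale tact_scale pm.scale_right_distrib mult_ac del: pm_scale_single)
  qed simp
  then have "cl (\<Sum>j\<in>?J. r j g) = \<zero>\<^bsub>SK\<^esub> g" using \<eta>_koszul_d[OF \<beta>] D g by simp
  then have "cl (\<Sum>j\<in>?J. r j g) = cl 0" using g by (simp add: skew_def cls_zero)
  \<comment> \<open>An equation in the exterior algebra may be compared at the letter
    \<open>k\<close>, since members of the defining ideal have no terms of degree one.\<close>
  then have "lookup (\<Sum>j\<in>?J. r j g) [k] = 0" using cl_eq_low_degree(2)[of "\<Sum>j\<in>?J. r j g" 0 k] by simp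
  moreover have "lookup (vec x) [k] = crd x k" for x
    by (simp add: vec_expand lookup_sum lookup_single when_def if_distrib cong: if_cong)
  then have "lookup (r j g) [k] = dsign \<beta> j * ev (idx_dec \<beta> j) g *
      (dleft \<beta> j * (if k = j then 1 else 0) + dright \<beta> j * crd (g (v j)) k)" for j
    by (simp add: r_def lookup_add lookup_single when_def mult_ac eq_commute[of k])
  ultimately show ?thesis by (simp add: lookup_sum)
qed

lemma msize_units: "msize (\<lambda>l. unit_idx a l + unit_idx b l) = 2" "msize (\<lambda>l. unit_idx a l + unit_idx b l + unit_idx c l) = 3"
  for a b c :: 'i
proof -
  have "msize (unit_idx a) = 1" for a :: 'i by (simp add: msize_def unit_idx_def)
  then show "msize (\<lambda>l. unit_idx a l + unit_idx b l) = 2" "msize (\<lambda>l. unit_idx a l + unit_idx b l + unit_idx c l) = 3"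
    unfolding msize_def by (simp_all add: sum.distrib)
qed

end

section \<open>Eigenvalues of the group elements in the supports\<close>

locale cocycle_kappa = cocycle_data scale v G q act \<eta>
  for scale :: "'k::field \<Rightarrow> 'v::ab_group_add \<Rightarrow> 'v" and v :: "'i::{finite,linorder} \<Rightarrow> 'v" and G q act \<eta> +
  fixes \<kappa> :: "'v \<Rightarrow> 'v \<Rightarrow> ('v \<Rightarrow> 'v) \<Rightarrow> 'k"
  assumes \<eta>_square: "\<eta> (koszul_eps q (idx_add (unit_idx i) (unit_idx i))) = \<zero>\<^bsub>SK\<^esub>"
    and \<kappa>_diag: "g \<in> G \<Longrightarrow> \<kappa> (v i) (v i) g = 0"
    and \<kappa>_\<eta>: "i < j \<Longrightarrow> group_alg_elt \<Lambda> \<Gamma> (\<kappa> (v j) (v i)) = \<eta> (koszul_eps q (idx_add (unit_idx i) (unit_idx j)))"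
    and \<kappa>_\<eta>': "i < j \<Longrightarrow> group_alg_elt \<Lambda> \<Gamma> (\<kappa> (v i) (v j)) =
      (- q i j) \<odot>\<^bsub>SK\<^esub> \<eta> (koszul_eps q (idx_add (unit_idx i) (unit_idx j)))"
begin

text \<open>The case \<open>i = j\<close> is where the vanishing of the cocycle on \<epsilon>_{2[i]}
  meets the convention \<kappa>(v_i, v_i) = 0.\<close>

lemma ev_pair:
  assumes "i \<le> j" "g \<in> G"
  shows "ev (idx_add (unit_idx i) (unit_idx j)) g = \<kappa> (v j) (v i) g"
proof (rule ev_eqI[OF msize_units(1) _ assms(2)])
  show "\<eta> (koszul_eps q (idx_add (unit_idx i) (unit_idx j))) = group_alg_elt \<Lambda> \<Gamma> (\<kappa> (v j) (v i))"
  proof (cases "i = j")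
    case True
    have "group_alg_elt \<Lambda> \<Gamma> (\<kappa> (v j) (v j)) = \<zero>\<^bsub>SK\<^esub>"
      by (rule ext) (simp add: group_alg_elt_def skew_def \<kappa>_diag cls_one cls_smult cls_zero)
    then show ?thesis using \<eta>_square[of j] True by simp
  qed (use \<kappa>_\<eta>[of i j] assms in simp)
qed

lemma \<kappa>_skew_less:
  assumes "i < j" "g \<in> G"
  shows "\<kappa> (v i) (v j) g = - q i j * \<kappa> (v j) (v i) g"
proof -
  have "group_alg_elt \<Lambda> \<Gamma> (\<kappa> (v i) (v j)) g = ((- q i j) \<odot>\<^bsub>SK\<^esub> group_alg_elt \<Lambda> \<Gamma> (\<kappa> (v j) (v i))) g"
    unfolding \<kappa>_\<eta>[OF assms(1)] \<kappa>_\<eta>'[OF assms(1)] ..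
  then have "cl (single [] (\<kappa> (v i) (v j) g)) = cl (single [] (- q i j * \<kappa> (v j) (v i) g))"
    using assms(2) by (simp add: group_alg_elt_def skew_def cls_one cls_smult)
  then show ?thesis by (rule cl_scalar_inj)
qed

lemma \<kappa>_skew:
  assumes "i \<noteq> j" "g \<in> G"
  shows "\<kappa> (v i) (v j) g = - q i j * \<kappa> (v j) (v i) g"
proof (cases "i < j")
  case False
  then have "\<kappa> (v j) (v i) g = - q j i * \<kappa> (v i) (v j) g" using assms by (intro \<kappa>_skew_less) auto
  then have "- q i j * \<kappa> (v j) (v i) g = (q i j * q j i) * \<kappa> (v i) (v j) g" by (simp add: mult.assoc)
  then show ?thesis using q_inv[OF assms(1)] by simp
qed (rule \<kappa>_skew_less[OF _ assms(2)])

lemma ev_dec: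
  assumes g: "g \<in> G"
  shows "a \<le> b \<Longrightarrow> ev (\<lambda>l. unit_idx a l + unit_idx b l) g = \<kappa> (v b) (v a) g"
    "b \<le> a \<Longrightarrow> ev (\<lambda>l. unit_idx a l + unit_idx b l) g = \<kappa> (v a) (v b) g"
proof -
  show "a \<le> b \<Longrightarrow> ev (\<lambda>l. unit_idx a l + unit_idx b l) g = \<kappa> (v b) (v a) g" by (rule ev_pair[OF _ g])
  have c: "(\<lambda>l. unit_idx a l + unit_idx b l) = (\<lambda>l. unit_idx b l + unit_idx a l)" by auto
  show "b \<le> a \<Longrightarrow> ev (\<lambda>l. unit_idx a l + unit_idx b l) g = \<kappa> (v a) (v b) g" unfolding c by (rule ev_pair[OF _ g])
qed

lemma idx_dec_units:
  "idx_dec (\<lambda>l. unit_idx a l + unit_idx b l + unit_idx c l) a = (\<lambda>l. unit_idx b l + unit_idx c l)"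
  "idx_dec (\<lambda>l. unit_idx a l + unit_idx b l + unit_idx c l) b = (\<lambda>l. unit_idx a l + unit_idx c l)"
  "idx_dec (\<lambda>l. unit_idx a l + unit_idx b l + unit_idx c l) c = (\<lambda>l. unit_idx a l + unit_idx b l)"
  by (auto simp: fun_eq_iff unit_idx_def)

abbreviation mat :: "('v \<Rightarrow> 'v) \<Rightarrow> 'i \<Rightarrow> 'i \<Rightarrow> 'k" where "mat g j k \<equiv> crd (g (v j)) k"
abbreviation \<delta> :: "'i \<Rightarrow> 'i \<Rightarrow> 'k" where "\<delta> k j \<equiv> (if k = j then 1 else 0)"

text \<open>Taken at \<beta> = 2[i] + [j]. Removing \<open>j\<close> leaves the value at 2[i], which
  is zero; removing \<open>i\<close> leaves \<kappa>(v_i, v_j) up to a unit, which is nonzero at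
  \<open>g\<close> and can be cancelled. What remains determines the coordinates of the image of v_i
  under \<open>g\<close>, and both orders of \<open>i\<close> and \<open>j\<close> lead to the same
  eigenvalue.\<close>

lemma cocycle_square:
  assumes ij: "i \<noteq> j" and g: "g \<in> G" and k: "\<kappa> (v i) (v j) g \<noteq> 0"
  shows "mat g i t = - q i j * \<delta> t i"
proof -
  define \<beta> where "\<beta> = (\<lambda>l. unit_idx i l + unit_idx i l + unit_idx j l)"
  have s: "{l. \<beta> l > 0} = {i, j}" by (auto simp: unit_idx_def \<beta>_def)
  have bi: "\<beta> i = 2" using ij by (auto simp: unit_idx_def \<beta>_def)
  have m: "msize \<beta> = 3" unfolding \<beta>_def by (rule msize_units)
  have dec: "idx_dec \<beta> i = (\<lambda>l. unit_idx i l + unit_idx j l)" "idx_dec \<beta> j = (\<lambda>l. unit_idx i l + unit_idx i l)"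
    unfolding \<beta>_def by (rule idx_dec_units)+
  have k': "\<kappa> (v j) (v i) g \<noteq> 0" using \<kappa>_skew[OF ij g] k by auto
  have e: "ev (\<lambda>l. unit_idx i l + unit_idx i l) g = 0" using ev_dec(1)[OF g, of i i] \<kappa>_diag[OF g] by simp
  have sum: "dsign \<beta> i * ev (\<lambda>l. unit_idx i l + unit_idx j l) g * (dleft \<beta> i * \<delta> t i + dright \<beta> i * mat g i t) = 0"
    using cocycle_coefficient[OF m g, of t] ij unfolding s by (simp add: dec e del: One_nat_def)
  have d: "dsign \<beta> i \<noteq> 0" by (simp add: dsign_def)
  have dl: "dleft \<beta> i = (if j < i then q i j else 1)" "dright \<beta> i = (if i < j then q j i else 1)"
    unfolding dleft_def dright_def bi by (simp_all add: \<beta>_def unit_prod)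
  have ev: "ev (\<lambda>l. unit_idx i l + unit_idx j l) g \<noteq> 0"
    using ev_dec(1)[OF g, of i j] ev_dec(2)[OF g, of j i] k k' linear[of i j] by auto
  have 0: "(if j < i then q i j else 1) * \<delta> t i + (if i < j then q j i else 1) * mat g i t = 0"
    using sum d ev unfolding dl by simp
  show ?thesis
  proof (cases "i < j")
    case True
    then have "\<not> j < i" by simp
    with 0 True have "\<delta> t i + q j i * mat g i t = 0" by (simp only: if_True if_False mult_1_left)
    then have 1: "q j i * mat g i t = - \<delta> t i" by (rule minus_unique[symmetric])
    have "mat g i t = q i j * (q j i * mat g i t)" using q_inv[OF ij] by (simp add: mult.assoc[symmetric])
    then show ?thesis unfolding 1 by simp
  next
    case False
    then have "j < i" using ij by simp
    with 0 False have "q i j * \<delta> t i + mat g i t = 0" by (simp only: if_True if_False mult_1_left)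
    then show ?thesis using minus_unique by (metis mult_minus_left)
  qed
qed

text \<open>Taken at \<beta> = [a] + [b] + [c]: one summand for each removed letter, whose sign
  counts the smaller letters. The minus sign inside each bracket is the factor (-1)^1 that the
  differential attaches to right multiplication.\<close>

lemma cocycle_triple:
  assumes abc: "a < b" "b < c" and g: "g \<in> G"
  shows "\<kappa> (v c) (v b) g * (\<delta> t a - q b a * q c a * mat g a t)
    - \<kappa> (v c) (v a) g * (q b a * \<delta> t b - q c b * mat g b t)
    + \<kappa> (v b) (v a) g * (q c a * q c b * \<delta> t c - mat g c t) = 0"
proof -
  define \<beta> where "\<beta> = (\<lambda>l. unit_idx a l + unit_idx b l + unit_idx c l)"
  have lt: "a < c" "a \<noteq> b" "b \<noteq> c" "a \<noteq> c" "\<not> b < a" "\<not> c < b" "\<not> c < a" using abc by auto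
  have s: "{l. \<beta> l > 0} = {a, b, c}" by (auto simp: unit_idx_def \<beta>_def)
  have m: "msize \<beta> = 3" unfolding \<beta>_def by (rule msize_units)
  have bi: "\<beta> a = 1" "\<beta> b = 1" "\<beta> c = 1" using lt by (auto simp: unit_idx_def \<beta>_def)
  have sg: "dsign \<beta> a = 1" "dsign \<beta> b = -1" "dsign \<beta> c = 1"
    unfolding dsign_def \<beta>_def unit_sum using abc lt by simp_all
  have l: "dleft \<beta> a = 1" "dleft \<beta> b = q b a" "dleft \<beta> c = q c a * q c b"
    unfolding dleft_def \<beta>_def unit_prod using abc lt by simp_all
  have r: "dright \<beta> a = - (q b a * q c a)" "dright \<beta> b = - q c b" "dright \<beta> c = - 1"
    unfolding dright_def bi using abc lt by (simp_all add: \<beta>_def unit_prod)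
  have e: "ev (idx_dec \<beta> a) g = \<kappa> (v c) (v b) g" "ev (idx_dec \<beta> b) g = \<kappa> (v c) (v a) g"
    "ev (idx_dec \<beta> c) g = \<kappa> (v b) (v a) g"
    unfolding \<beta>_def idx_dec_units using ev_dec(1)[OF g] abc lt by auto
  have "1 * \<kappa> (v c) (v b) g * (1 * \<delta> t a + - (q b a * q c a) * mat g a t) +
     (- 1 * \<kappa> (v c) (v a) g * (q b a * \<delta> t b + - q c b * mat g b t) +
      1 * \<kappa> (v b) (v a) g * (q c a * q c b * \<delta> t c + - 1 * mat g c t)) = 0"
    using cocycle_coefficient[OF m g, of t] lt unfolding s
    by (simp only: sum.insert finite.intros insert_iff empty_iff sg l r e sum.empty add_0_right simp_thms not_False_eq_True)
  then show ?thesis by (simp only: mult_1_left mult_minus_left mult_minus1 diff_conv_add_uminus add.assoc)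
qed

text \<open>Besides \<kappa>(v_j, v_i), the triple relation contains the values on the pairs with
  \<open>c\<close>, which may be nonzero at \<open>g\<close>. By \<open>cocycle_square\<close>, v_i
  and v_j are eigenvectors of \<open>g\<close>, so at coordinate \<open>t\<close> these values
  matter only if \<open>t = i\<close> with \<kappa>(v_c, v_j) nonzero or \<open>t = j\<close> with
  \<kappa>(v_c, v_i) nonzero. Then \<open>cocycle_square\<close> for that pair shows that v_c is an
  eigenvector too, and both sides are zero as \<open>t\<close> differs from \<open>c\<close>. In all
  other cases only the summand with \<kappa>(v_j, v_i) is left.\<close>

lemma cocycle_other:
  assumes ij: "i \<noteq> j" "c \<noteq> i" "c \<noteq> j" and g: "g \<in> G" and k: "\<kappa> (v i) (v j) g \<noteq> 0"
  shows "mat g c t = q c i * q c j * \<delta> t c"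
proof -
  have sq: "mat g x t = - q x y * \<delta> t x" "mat g y t = - q y x * \<delta> t y" if "x \<noteq> y" "\<kappa> (v x) (v y) g \<noteq> 0" for x y t
    using cocycle_square[OF _ g] \<kappa>_skew[OF _ g, of x y] that by auto
  have sym: "mat g c t = q c i * q c j * \<delta> t c" if less: "i < j" and c: "c \<noteq> i" "c \<noteq> j" and k: "\<kappa> (v j) (v i) g \<noteq> 0" for i j
  proof (cases "t = i \<and> \<kappa> (v c) (v j) g \<noteq> 0 \<or> t = j \<and> \<kappa> (v c) (v i) g \<noteq> 0")
    case True
    then show ?thesis using sq(1)[OF c(1), of t] sq(1)[OF c(2), of t] c by auto
  next
    case False
    have qq: "q i c * q c i = 1" "q j c * q c j = 1" using q_inv c by metis+
    have kc: "\<kappa> (v i) (v c) g = - q i c * \<kappa> (v c) (v i) g" "\<kappa> (v j) (v c) g = - q j c * \<kappa> (v c) (v j) g"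
      using \<kappa>_skew[OF _ g] c by metis+
    have mi: "mat g i t = - q i j * \<delta> t i" and mj: "mat g j t = - q j i * \<delta> t j"
      using sq[of j i t] less k by auto
    have z1: "\<kappa> (v c) (v j) g * \<delta> t i = 0" and z2: "\<kappa> (v c) (v i) g * \<delta> t j = 0"
      using False by auto
    \<comment> \<open>The coefficients stay arbitrary, as they differ with the position of
      \<open>c\<close> relative to \<open>i\<close> and \<open>j\<close>.\<close>
    have w1: "\<kappa> (v c) (v j) g * (x * \<delta> t i - y * mat g i t) = 0" for x y
    proof -
      have "\<kappa> (v c) (v j) g * (x * \<delta> t i - y * mat g i t) = (\<kappa> (v c) (v j) g * \<delta> t i) * (x + y * q i j)"
        unfolding mi by (cases "t = i") (simp_all add: algebra_simps)
      then show ?thesis unfolding z1 by simp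
    qed
    have w2: "\<kappa> (v c) (v i) g * (x * \<delta> t j - y * mat g j t) = 0" for x y
    proof -
      have "\<kappa> (v c) (v i) g * (x * \<delta> t j - y * mat g j t) = (\<kappa> (v c) (v i) g * \<delta> t j) * (x + y * q j i)"
        unfolding mj by (cases "t = j") (simp_all add: algebra_simps)
      then show ?thesis unfolding z2 by simp
    qed
    have w1': "\<kappa> (v j) (v c) g * (x * \<delta> t i - y * mat g i t) = 0" for x y
      unfolding kc using w1[of x y] by (simp only: mult.assoc mult_zero_right)
    have w2': "\<kappa> (v i) (v c) g * (x * \<delta> t j - y * mat g j t) = 0" for x y
      unfolding kc using w2[of x y] by (simp only: mult.assoc mult_zero_right)
    consider "c < i" | "i < c" "c < j" | "j < c" using c by fastforce
    then show ?thesis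
    proof cases
      case 1
      have "\<kappa> (v j) (v i) g * (\<delta> t c - q i c * q j c * mat g c t) = 0"
        using cocycle_triple[OF 1 less g, of t] w1'[of "q i c" "q j i"] w2'[of "q j c * q j i" 1]
        by (simp only: mult_1_left diff_zero add_0_right)
      then have "\<delta> t c = q i c * q j c * mat g c t" using k by simp
      then have "q c i * q c j * \<delta> t c = (q i c * q c i) * (q j c * q c j) * mat g c t" by (simp only: mult_ac)
      then show ?thesis unfolding qq by simp
    next
      case 2
      have "\<kappa> (v j) (v i) g * (q c i * \<delta> t c - q j c * mat g c t) = 0"
        using cocycle_triple[OF 2 g, of t] w1'[of 1 "q c i * q j i"] w2[of "q j i * q j c" 1]
        by (simp only: mult_1_left diff_0 add_0_right neg_equal_0_iff_equal)
      then have *: "q c i * \<delta> t c = q j c * mat g c t" using k by simp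
      have "q c i * q c j * \<delta> t c = q c j * (q c i * \<delta> t c)" by (simp only: mult_ac)
      also have "\<dots> = (q j c * q c j) * mat g c t" unfolding * by (simp only: mult_ac)
      finally have "q c i * q c j * \<delta> t c = (q j c * q c j) * mat g c t" .
      then show ?thesis unfolding qq by simp
    next
      case 3
      have "\<kappa> (v j) (v i) g * (q c i * q c j * \<delta> t c - mat g c t) = 0"
        using cocycle_triple[OF less 3 g, of t] w1[of 1 "q j i * q c i"] w2[of "q j i" "q c j"]
        by (simp only: mult_1_left diff_zero add_0_left)
      then show ?thesis using k by simp
    qed
  qed
  show ?thesis
  proof (cases "i < j")
    case True
    then show ?thesis using sym[of i j] ij k \<kappa>_skew[OF ij(1) g] by auto
  next
    case False
    then show ?thesis using sym[of j i] ij k by (auto simp: mult.commute)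
  qed
qed

lemma expand_rows:
  assumes "\<And>t. mat g c t = a * \<delta> t c"
  shows "g (v c) = scale a (v c)"
proof -
  have "g (v c) = (\<Sum>t\<in>UNIV. if t = c then scale a (v c) else 0)"
    by (subst coord_expand) (intro sum.cong, auto simp: assms)
  then show ?thesis by simp
qed

section \<open>The group action on quantum relations and on Koszul generators\<close>

lemma qrel_in_ideal:
  "qrel q i j \<in> qext_ideal q"
proof -
  let ?g = "{word [j, i] - pm_scale (q i j) (word [i, j]) | i j. i \<noteq> j} \<union> {word [i, i] | i. True}"
  have "?g \<subseteq> qext_ideal q" unfolding qext_ideal_def by (rule ring.genideal_self[OF ring_tensor_alg]) simp
  moreover have "qrel q i j = word [i, i]" if "i = j"
    using that by (simp add: qrel_def word_def)
  moreover have "qrel q i j = word [i, j] - pm_scale (q j i) (word [j, i])" if "i \<noteq> j"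
    using that by (simp add: qrel_def word_def)
  ultimately show ?thesis by (cases "i = j") blast+
qed

lemma keys_tact_pair:
  assumes "keys p \<subseteq> {w. length w = 2}"
  shows "keys (tact g p) \<subseteq> {w. length w = 2}"
proof -
  have vk: "keys (vec x) \<subseteq> {w. length w = 1}" for x
    unfolding vec_expand by (intro keys_sum_subset keys_scale_subset) simp
  have mult: "keys (p \<star> r) \<subseteq> {w. length w = m + n}" if "keys p \<subseteq> {w. length w = m}" "keys r \<subseteq> {w. length w = n}"
    for p r :: "'i list \<Rightarrow>\<^sub>0 'k" and m n
    unfolding tensor_mult_eq_lin by (intro keys_lin_subset) (use that in auto)
  have "keys (tact g (single w 1)) \<subseteq> {u. length u = length w}" for w
  proof (induction w)
    case (Cons i w)
    then show ?case using mult[OF vk Cons.IH] by (simp add: tact_Cons)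
  qed simp
  then show ?thesis unfolding pm_linear_eq_lin[OF linear_tact, of g p]
    by (intro keys_lin_subset) (use assms in fastforce)
qed

lemma lookup_qrel:
  "lookup (qrel q a b) [c, d] = (if a = c \<and> b = d then 1 else 0) - (if a \<noteq> b \<and> b = c \<and> a = d then q b a else 0)"
  by (auto simp: qrel_def lookup_minus lookup_single when_def)

text \<open>The coefficients at \<open>[a, b]\<close> with \<open>a \<le> b\<close> agree by
  construction. Those at decreasing words are forced: on both sides they are determined by the
  reversed word, on the left through the antisymmetry of the ideal in degree two.\<close>

lemma qrel_expansion:
  assumes k: "keys p \<subseteq> {w. length w = 2}" and i: "p \<in> qext_ideal q"
  shows "p = (\<Sum>(a, b) | a \<le> b. pm_scale (lookup p [a, b]) (qrel q a b))"
proof (rule poly_mapping_eqI)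
  fix w
  let ?R = "\<Sum>(a, b) | a \<le> b. pm_scale (lookup p [a, b]) (qrel q a b)"
  have R: "lookup ?R w = (\<Sum>x | fst x \<le> snd x. lookup p [fst x, snd x] * lookup (qrel q (fst x) (snd x)) w)"
    by (simp add: lookup_sum case_prod_unfold)
  show "lookup p w = lookup ?R w"
  proof (cases "length w = 2")
    case True
    then obtain c d where w: "w = [c, d]" by (auto simp: length_Suc_conv numeral_2_eq_2)
    \<comment> \<open>The sorted version of \<open>w\<close> is the only index pair that can
      contribute.\<close>
    have "lookup p [fst x, snd x] * lookup (qrel q (fst x) (snd x)) w = (if x = (min c d, max c d) then lookup p w else 0)"
      if x: "fst x \<le> snd x" for x :: "'i \<times> 'i"
    proof -
      obtain a b where ab: "x = (a, b)" "a \<le> b" using x by (cases x) auto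
      show ?thesis
      proof (cases "c \<le> d")
        case True
        then have "lookup (qrel q a b) w = (if a = c \<and> b = d then 1 else 0)" and m: "min c d = c" "max c d = d"
          using ab(2) unfolding w lookup_qrel by auto
        then show ?thesis unfolding m using ab(1) by (simp add: w)
      next
        case False
        then have cd: "c \<noteq> d" and m: "min c d = d" "max c d = c" by auto
        have "lookup p [c, d] + q c d * lookup p [d, c] = 0"
          by (rule qext_ideal_low_degree(3)[of q, OF q_inv i cd])
        then have p: "lookup p w = - (q c d * lookup p [d, c])"
          unfolding w eq_neg_iff_add_eq_0 .
        have "lookup (qrel q a b) w = (if a = d \<and> b = c then - q c d else 0)"
        proof (cases "a = d \<and> b = c")
          case True
          then show ?thesis using cd unfolding w lookup_qrel by simp
        next
          case no: False
          have "\<not> (a = c \<and> b = d)"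
          proof
            assume "a = c \<and> b = d"
            then have "c \<le> d" using ab(2) by simp
            with False show "False" by contradiction
          qed
          moreover have "\<not> (a \<noteq> b \<and> b = c \<and> a = d)" using no by iprover
          ultimately show ?thesis using no unfolding w lookup_qrel by (simp only: if_False diff_0_right)
        qed
        then show ?thesis unfolding p m using ab(1) by simp
      qed
    qed
    then have "lookup ?R w = (\<Sum>x | fst x \<le> snd x. if x = (min c d, max c d) then lookup p w else 0)"
      unfolding R by (intro sum.cong) auto
    also have "\<dots> = lookup p w" by (simp add: min.coboundedI1 le_max_iff_disj)
    finally show ?thesis by simp
  next
    case False
    then have "lookup p w = 0" using k by (auto simp: in_keys_iff)
    moreover have "lookup (qrel q a b) w = 0" for a b
      using False by (auto simp: qrel_def lookup_minus lookup_single when_def)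
    ultimately show ?thesis unfolding R by simp
  qed
qed

text \<open>\<open>h\<close> preserves the degree, and it keeps the relation in the ideal because it
  acts on the quotient: the class of the relation is zero, hence so is the class of its
  image.\<close>

lemma tact_qrel:
  assumes h: "h \<in> G"
  shows "tact h (qrel q i j) = (\<Sum>(a, b) | a \<le> b. pm_scale (lookup (tact h (qrel q i j)) [a, b]) (qrel q a b))"
proof (rule qrel_expansion)
  show "keys (tact h (qrel q i j)) \<subseteq> {w. length w = 2}"
    by (rule keys_tact_pair) (auto simp: qrel_def in_keys_iff lookup_minus lookup_single when_def split: if_splits)
  have "cl (qrel q i j) = cl 0" using qrel_in_ideal[of i j] by (simp add: cls_eq_iff)
  then have "cl (tact h (qrel q i j)) = cl (tact h 0)" using act_cl[OF h] by metis
  then show "tact h (qrel q i j) \<in> qext_ideal q" by (simp add: cls_eq_iff)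
qed

text \<open>Multilinearity in one slot, iterated over the words of \<open>p\<close>. The claim is
  about a difference in \<open>TS.R\<close> because both terms are representatives in the free
  space.\<close>

lemma slot_expand:
  assumes s: "set xs \<union> set ys \<subseteq> carrier \<Lambda>" and l: "length xs + length ys + 1 = m"
  shows "single (xs @ cl p # ys) 1 - lin (\<lambda>w. single (xs @ cl (single w 1) # ys) 1) p \<in> TS.R m"
proof -
  let ?t = "\<lambda>p. single (xs @ cl p # ys) (1::'k)"
  have sc: "?t (pm_scale c p) - pm_scale c (?t p) \<in> TS.R m" for c p
    using TS.R_slot_smult[of "cl p" xs ys m c] s l by (simp add: cls_smult)
  have "?t (\<Sum>w\<in>A. pm_scale (lookup p w) (single w 1)) - (\<Sum>w\<in>A. pm_scale (lookup p w) (?t (single w 1))) \<in> TS.R m"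
    if "finite A" for A
    using that
  proof (induction A rule: finite_induct)
    case empty
    show ?case using sc[of 0 0] by simp
  next
    case (insert w A)
    let ?s = "\<Sum>w\<in>A. pm_scale (lookup p w) (single w 1)"
    have "?t (pm_scale (lookup p w) (single w 1) + ?s) - ?t (pm_scale (lookup p w) (single w 1)) - ?t ?s \<in> TS.R m"
      using TS.R_slot_add[of "cl (pm_scale (lookup p w) (single w 1))" "cl ?s" xs ys m] s l by (simp add: cls_add del: pm_scale_single)
    from TS.R_add[OF TS.R_add[OF this sc[of "lookup p w" "single w 1"]] insert.IH]
    show ?case using insert.hyps by (simp add: algebra_simps del: pm_scale_single)
  qed
  from this[of "keys p"] show ?thesis
    using lin_singles[of p] by (simp add: lin_def del: lin_singles pm_scale_single)
qed

text \<open>\<open>tens\<close> reads words letter by letter, whereas the factorwise action puts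
  arbitrary vectors into the slots. Expanding the two inner slots one after the other reconciles
  them; the outer slots hold 1, which is fixed.\<close>

lemma act_tens:
  assumes h: "h \<in> G" and p: "keys p \<subseteq> {w. length w = 2}"
  shows "tensor_map \<Lambda> 4 (map (act h)) (TS.tcls 4 (tens (single [] 1) (single [] 1) p)) =
    TS.tcls 4 (tens (single [] 1) (single [] 1) (tact h p))"
proof -
  let ?u = "single [] (1::'k)"
  let ?l = "\<lambda>i. cl (single [i] 1)"
  have c: "tens ?u ?u p \<in> carrier (TS.F 4)" "tens ?u ?u (tact h p) \<in> carrier (TS.F 4)"
    using tens_closed[OF p] tens_closed[OF keys_tact_pair[OF p]] by simp_all
  have m: "tensor_map \<Lambda> 4 (map (act h)) (TS.tcls 4 (tens ?u ?u p)) =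
      TS.tcls 4 (lin (\<lambda>xs. single (map (act h) xs) 1) (tens ?u ?u p))"
    by (rule TS.tensor_map_tcls[OF TS.slotwise_map[OF slot_linear_act[OF h]] c(1)]) simp
  have e: "lin (\<lambda>xs. single (map (act h) xs) 1) (tens ?u ?u p) =
    lin (\<lambda>w. single ([cl ?u] @ map (\<lambda>i. cl (vec (h (v i)))) w @ [cl ?u]) 1) p"
    by (simp add: tens_def pm_linear_lin_eq[OF pm_linear_lin] act_cl[OF h] comp_def)
  have t: "tens ?u ?u (tact h p) = lin (\<lambda>w. tens ?u ?u (tact h (single w 1))) p"
    unfolding tens_def by (subst pm_linear_eq_lin[OF linear_tact, of h p]) (simp add: pm_linear_lin_eq[OF pm_linear_lin])
  have d: "single ([cl ?u] @ map (\<lambda>i. cl (vec (h (v i)))) w @ [cl ?u]) 1 - tens ?u ?u (tact h (single w 1)) \<in> TS.R 4"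
    if w: "w \<in> keys p" for w
  proof -
    have "length w = 2" using w p by auto
    then obtain i j where w: "w = [i, j]" by (auto simp: length_Suc_conv numeral_2_eq_2)
    define x where "x = vec (h (v i))"
    define y where "y = vec (h (v j))"
    have kx: "keys x \<subseteq> {w. length w = 1}" "keys y \<subseteq> {w. length w = 1}"
      unfolding x_def y_def vec_expand by (intro keys_sum_subset keys_scale_subset; simp)+
    have "tens ?u ?u (x \<star> y) = lin (\<lambda>a. lin (\<lambda>b. single ([cl ?u] @ map ?l (a @ b) @ [cl ?u]) 1) y) x"
      by (simp add: tens_def tensor_mult_eq_lin pm_linear_lin_eq[OF pm_linear_lin])
    also have "\<dots> = lin (\<lambda>a. lin (\<lambda>b. single [cl ?u, cl (single a 1), cl (single b 1), cl ?u] 1) y) x"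
    proof (intro lin_cong)
      fix a b assume "a \<in> keys x" "b \<in> keys y"
      then have "length a = 1" "length b = 1" using kx by auto
      then obtain a' b' where "a = [a']" "b = [b']" by (auto simp: length_Suc_conv)
      then show "single ([cl ?u] @ map ?l (a @ b) @ [cl ?u]) 1 = single [cl ?u, cl (single a 1), cl (single b 1), cl ?u] (1::'k)"
        by simp
    qed
    finally have T: "tens ?u ?u (x \<star> y) = lin (\<lambda>a. lin (\<lambda>b. single [cl ?u, cl (single a 1), cl (single b 1), cl ?u] 1) y) x" .
    have 1: "single [cl ?u, cl x, cl y, cl ?u] 1 - lin (\<lambda>a. single [cl ?u, cl (single a 1), cl y, cl ?u] 1) x \<in> TS.R 4"
      using slot_expand[of "[cl ?u]" "[cl y, cl ?u]" 4 x] by simp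
    have "single [cl ?u, cl (single a 1), cl y, cl ?u] 1 - lin (\<lambda>b. single [cl ?u, cl (single a 1), cl (single b 1), cl ?u] 1) y \<in> TS.R 4" for a
      using slot_expand[of "[cl ?u, cl (single a 1)]" "[cl ?u]" 4 y] by simp
    then have 2: "lin (\<lambda>a. single [cl ?u, cl (single a 1), cl y, cl ?u] 1 - lin (\<lambda>b. single [cl ?u, cl (single a 1), cl (single b 1), cl ?u] 1) y) x \<in> TS.R 4"
      by (intro TS.R_lin)
    have 3: "lin (\<lambda>a. f a - g a) x = lin f x - lin g x" for f g :: "'i list \<Rightarrow> ('i list \<Rightarrow>\<^sub>0 'k) set list \<Rightarrow>\<^sub>0 'k"
      by (simp add: lin_def pm.scale_right_diff_distrib sum_subtractf)
    show ?thesis using TS.R_add[OF 1 2] by (simp add: 3 T w tact_Cons flip: x_def y_def)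
  qed
  have "lin (\<lambda>xs. single (map (act h) xs) 1) (tens ?u ?u p) - tens ?u ?u (tact h p) =
    lin (\<lambda>w. single ([cl ?u] @ map (\<lambda>i. cl (vec (h (v i)))) w @ [cl ?u]) 1 - tens ?u ?u (tact h (single w 1))) p"
    unfolding e t by (simp add: lin_def pm.scale_right_diff_distrib sum_subtractf)
  also have "\<dots> \<in> TS.R 4" by (intro TS.R_lin d)
  finally show ?thesis unfolding m
    by (intro TS.tcls_eqI TS.slotwise_F[OF TS.slotwise_map[OF slot_linear_act[OF h]]] c) simp
qed

text \<open>Invariance of the cocycle under the inverse of \<open>h\<close> reads \<eta>(\<epsilon>)
  = h^{-1} \<eta>(h \<epsilon>) h. Here h \<epsilon> expands in the Koszul generators as
  \<open>tact_qrel\<close> prescribes for the relations. The claim is this equation at the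
  coefficient of h^{-1} g h, where the right side contributes the coefficient of \<eta>(h
  \<epsilon>) at g.\<close>

lemma \<kappa>_invariant:
  assumes h: "h \<in> G" and ij: "i \<le> j" and g: "g \<in> G"
  shows "(\<Sum>(a, b) | a \<le> b. lookup (tact h (qrel q i j)) [a, b] * \<kappa> (v b) (v a) g) =
    \<kappa> (v j) (v i) (inv\<^bsub>\<Gamma>\<^esub> h \<circ> g \<circ> h)"
proof -
  let ?h = "inv\<^bsub>\<Gamma>\<^esub> h" and ?u = "single [] (1::'k)"
  let ?\<beta> = "\<lambda>(a, b). idx_add (unit_idx a) (unit_idx b) :: 'i \<Rightarrow> nat"
  let ?F = "\<lambda>x. lookup (tact h (qrel q i j)) [fst x, snd x]"
  define P :: "('i \<times> 'i) set" where "P = {(a, b). a \<le> b}"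
  define \<epsilon> where "\<epsilon> = koszul_eps q (?\<beta> (i, j))"
  define p where "p x = pm_scale (?F x) (tens ?u ?u (koszul_f q (?\<beta> x)))" for x
  have m: "msize (?\<beta> x) = 2" for x by (cases x) (simp add: msize_units)
  have kf: "koszul_f q (?\<beta> x) = qrel q (fst x) (snd x)" if "x \<in> P" for x
    using that koszul_f_pair[of "fst x" "snd x"] by (auto simp: P_def)
  have k2: "keys (koszul_f q (?\<beta> x)) \<subseteq> {w. length w = 2}" for x
    using keys_koszul_f[of q "?\<beta> x"] m[of x] by simp
  have eps: "\<epsilon> = TS.tcls 4 (tens ?u ?u (qrel q i j))"
    using koszul_eps_tens[of "?\<beta> (i, j)"] m[of "(i, j)"] koszul_f_pair[OF ij, of q] by (simp add: \<epsilon>_def)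
  have "\<epsilon> \<in> carrier (koszul q 2)"
    using tens_in_koszul[OF m, of ?u ?u "(i, j)"] koszul_f_pair[OF ij, of q] by (simp add: eps)
  moreover have "?h \<in> carrier \<Gamma>" using h by simp
  \<comment> \<open>The condition is instantiated at the inverse, so that the factorwise action
    inside is by \<open>h\<close> itself.\<close>
  ultimately have inv: "\<eta> \<epsilon> = skew_elt \<Lambda> \<Gamma> \<one>\<^bsub>\<Lambda>\<^esub> ?h \<otimes>\<^bsub>SK\<^esub> \<eta> (tensor_map \<Lambda> 4 (map (act (inv\<^bsub>\<Gamma>\<^esub> ?h))) \<epsilon>)
        \<otimes>\<^bsub>SK\<^esub> skew_elt \<Lambda> \<Gamma> \<one>\<^bsub>\<Lambda>\<^esub> (inv\<^bsub>\<Gamma>\<^esub> ?h)"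
    using cocycle[unfolded constant_2_cocycle_def Let_def, THEN conjunct2, THEN conjunct2, THEN conjunct2, rule_format] by blast
  have q2: "keys (qrel q i j) \<subseteq> {w. length w = 2}" using k2[of "(i, j)"] koszul_f_pair[OF ij, of q] by simp
  have "tens ?u ?u (tact h (qrel q i j)) = (\<Sum>x\<in>P. p x)"
  proof -
    have "tens ?u ?u (tact h (qrel q i j)) = (\<Sum>x\<in>P. pm_scale (?F x) (tens ?u ?u (qrel q (fst x) (snd x))))"
      unfolding tens_def by (subst tact_qrel[OF h]) (simp add: lin_sum lin_scale case_prod_unfold P_def)
    then show ?thesis by (simp add: p_def kf)
  qed
  then have map_eps: "tensor_map \<Lambda> 4 (map (act h)) \<epsilon> = TS.tcls 4 (\<Sum>x\<in>P. p x)"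
    unfolding eps act_tens[OF h q2] by simp
  have ES: "TS.tcls 4 (\<Sum>x\<in>P. p x) \<in> carrier (koszul q 2) \<and>
    (\<forall>g\<in>G. \<eta> (TS.tcls 4 (\<Sum>x\<in>P. p x)) g = cl (\<Sum>x\<in>P. single [] (?F x * ev (?\<beta> x) g)))"
  proof (rule \<eta>_sum)
    fix x
    have t: "TS.tcls 4 (p x) = TS.tcls 4 (tens (pm_scale (?F x) ?u) ?u (koszul_f q (?\<beta> x)))"
      unfolding p_def using tens_scale(1)[OF k2[of x]] by simp
    show "p x \<in> carrier (TS.F 4)"
      unfolding p_def using tens_closed[OF k2[of x]] by (intro TS.F_scale) simp
    show "TS.tcls 4 (p x) \<in> carrier (koszul q 2)" unfolding t using tens_in_koszul[OF m] by simp
    fix g assume "g \<in> G"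
    then show "\<eta> (TS.tcls 4 (p x)) g = cl (single [] (?F x * ev (?\<beta> x) g))"
      unfolding t by (subst \<eta>_tens[OF m]) (simp_all add: mult.commute)
  qed simp
  have \<eta>_sum_eq: "\<eta> (TS.tcls 4 (\<Sum>x\<in>P. p x)) = skcl (\<lambda>g\<in>G. single [] (\<Sum>x\<in>P. ?F x * ev (?\<beta> x) g))"
  proof
    fix g
    show "\<eta> (TS.tcls 4 (\<Sum>x\<in>P. p x)) g = skcl (\<lambda>g\<in>G. single [] (\<Sum>x\<in>P. ?F x * ev (?\<beta> x) g)) g"
    proof (cases "g \<in> G")
      case True
      have "(single [] (\<Sum>x\<in>P. f x) :: 'i list \<Rightarrow>\<^sub>0 'k) = (\<Sum>x\<in>P. single [] (f x))" for f :: "'i \<times> 'i \<Rightarrow> 'k"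
        by (induction P rule: infinite_finite_induct) (simp_all add: single_add)
      then show ?thesis using ES True by simp
    next
      case False
      then show ?thesis using \<eta>_closed[OF ES[THEN conjunct1]] by (auto simp: skcl_def skew_def)
    qed
  qed
  have "\<eta> \<epsilon> = skcl (welt ?u ?h \<otimes>\<^bsub>S\<^esub> (\<lambda>g\<in>G. single [] (\<Sum>x\<in>P. ?F x * ev (?\<beta> x) g)) \<otimes>\<^bsub>S\<^esub> welt ?u h)"
    using inv unfolding map_eps \<eta>_sum_eq cls_one skew_elt_skcl skcl_mult G_inv_inv[OF h] .
  then have "\<eta> \<epsilon> (?h \<circ> g \<circ> h) = cl (single [] (\<Sum>x\<in>P. ?F x * ev (?\<beta> x) g))"
    using welt_one_mult(2)[of ?h "?h \<circ> g \<circ> h"] welt_one_mult(1)[of ?h] h g by (simp add: comp_assoc)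
  moreover have "\<eta> \<epsilon> (?h \<circ> g \<circ> h) = cl (single [] (ev (?\<beta> (i, j)) (?h \<circ> g \<circ> h)))"
    unfolding \<epsilon>_def \<eta>_eps[OF m[of "(i, j)"]] group_alg_elt_skcl using h g by simp
  ultimately have "ev (?\<beta> (i, j)) (?h \<circ> g \<circ> h) = (\<Sum>x\<in>P. ?F x * ev (?\<beta> x) g)"
    by (intro cl_scalar_inj) (simp only:)
  moreover have "(\<Sum>x\<in>P. ?F x * ev (?\<beta> x) g) = (\<Sum>(a, b) | a \<le> b. lookup (tact h (qrel q i j)) [a, b] * \<kappa> (v b) (v a) g)"
    unfolding P_def by (intro sum.cong) (auto simp: ev_pair g)
  ultimately show ?thesis using ev_pair[OF ij, of "?h \<circ> g \<circ> h"] h g by simp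
qed

lemma hecke_data: "hecke_data scale v G q \<kappa>"
proof unfold_locales
  fix i j g assume "i \<noteq> j" "g \<in> G" "\<kappa> (v i) (v j) g \<noteq> 0"
  then show "g (v i) = scale (- q i j) (v i)" by (intro expand_rows cocycle_square)
next
  fix i j k g assume "i \<noteq> j" "k \<noteq> i" "k \<noteq> j" "g \<in> G" "\<kappa> (v i) (v j) g \<noteq> 0"
  then show "g (v k) = scale (q k i * q k j) (v k)" by (intro expand_rows cocycle_other)
qed (rule q_inv \<kappa>_skew \<kappa>_diag tact_qrel \<kappa>_invariant; assumption)+

end

theorem theorem4p11:
  fixes scale :: "'k::field \<Rightarrow> 'v::ab_group_add \<Rightarrow> 'v"
    and v :: "'i::{finite,linorder} \<Rightarrow> 'v"
    and G :: "('v \<Rightarrow> 'v) set"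
    and q :: "'i \<Rightarrow> 'i \<Rightarrow> 'k"
    and act :: "('v \<Rightarrow> 'v) \<Rightarrow> ('i list \<Rightarrow>\<^sub>0 'k) set \<Rightarrow> ('i list \<Rightarrow>\<^sub>0 'k) set"
    and \<eta> :: "(('i list \<Rightarrow>\<^sub>0 'k) set list \<Rightarrow>\<^sub>0 'k) set \<Rightarrow> ('v \<Rightarrow> 'v) \<Rightarrow> ('i list \<Rightarrow>\<^sub>0 'k) set"
    and \<kappa> :: "'v \<Rightarrow> 'v \<Rightarrow> ('v \<Rightarrow> 'v) \<Rightarrow> 'k"
  assumes "CHAR('k) \<noteq> 2"
    and "vector_space scale"
    and "basis_family scale v"
    and "subgroup G (GL scale)"
    and "finite G"
    and "\<not> CHAR('k) dvd card G"
    and "\<And>i j. q i j \<noteq> 0"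
    and "\<And>i j. i \<noteq> j \<Longrightarrow> q i j = inverse (q j i)"
    and "extends_action scale v q G act"
    and "constant_2_cocycle q (linear_group scale G) act \<eta>"
    and "\<And>i. \<eta> (koszul_eps q (idx_add (unit_idx i) (unit_idx i)))
           = \<zero>\<^bsub>skew (qext q) (linear_group scale G) act\<^esub>"
    and "bilinear_to_group_alg scale G \<kappa>"
    and "\<And>i g. g \<in> G \<Longrightarrow> \<kappa> (v i) (v i) g = 0"
    and "\<And>i j. i < j \<Longrightarrow>
           group_alg_elt (qext q) (linear_group scale G) (\<kappa> (v j) (v i))
           = \<eta> (koszul_eps q (idx_add (unit_idx i) (unit_idx j)))"
    and "\<And>i j. i < j \<Longrightarrow>
           group_alg_elt (qext q) (linear_group scale G) (\<kappa> (v i) (v j))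
           = (- q i j) \<odot>\<^bsub>skew (qext q) (linear_group scale G) act\<^esub>
               \<eta> (koszul_eps q (idx_add (unit_idx i) (unit_idx j)))"
  shows "truncated_quantum_DHA scale v q G \<kappa>"
proof -
  have "q i j * q j i = 1" if "i \<noteq> j" for i j
    using assms(7)[of j i] assms(8)[OF that] by simp
  then interpret cocycle_kappa scale v G q act \<eta> \<kappa>
    using assms by (intro cocycle_kappa.intro cocycle_data.intro linear_group_data.intro
        linear_group_data_axioms.intro cocycle_data_axioms.intro cocycle_kappa_axioms.intro)
  show ?thesis by (rule hecke_data.pbw[OF hecke_data])
qed

end
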